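(* Let $\varrho>0$ and let $T\subset\mathbb R^d$ be a polytopal set, of diameter $h_T$, that is star-shaped with respect to every point of a ball of radius $\varrho h_T$. Let two integers $\ell\ge1$ and $s\in\{1,\ldots,\ell+1\}$ be given. Then there exists a real number $C>0$ depending only on $d$, $\varrho$, $\ell$ and $s$ such that, for all $m\in\{0,\ldots,s\}$ and all $\mathbf v\in H^s(T)^d$, $$|\mathbf v-\boldsymbol\pi_{\varepsilon,T}^{\ell}\mathbf v|_{H^m(T)^d}\le C\,h_T^{s-m}\,|\mathbf v|_{H^s(T)^d},$$ where $\boldsymbol\pi_{\varepsilon,T}^{\ell}:H^1(T)^d\to\mathbb P^\ell(T)^d$ is the strain projector.
   Context: $d\in\{2,3\}$ is the space dimension. A polytopal set is a bounded connected open set of $\mathbb R^d$ that is polygonal ($d=2$) or polyhedral ($d=3$), i.e. its boundary is a finite union of flat faces; it need not be convex. $T$ is star-shaped with respect to a point $y$ if $y\in T$ and $[x,y]\subset T$ for every $x\in T$. $\mathbb P^\ell(T)$ is the space of polynomials of total degree $\le\ell$ on $T$. $(\cdot,\cdot)_T$ is the $L^2(T)$ inner product; $\nabla_s$ and $\nabla_{ss}$ are the symmetric and skew-symmetric parts of the gradient $\nabla\mathbf u=(\partial_ju_i)_{i,j}$; $|\cdot|_{H^m(T)^d}$ is the usual Sobolev seminorm (the $L^2$-norm if $m=0$). Strain projector: for $\mathbf v\in H^1(T)^d$, $\boldsymbol\pi_{\varepsilon,T}^\ell\mathbf v\in\mathbb P^\ell(T)^d$ is the unique polynomial such that $(\nabla_s\boldsymbol\pi_{\varepsilon,T}^\ell\mathbf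 v,\nabla_s\mathbf w)_T=(\nabla_s\mathbf v,\nabla_s\mathbf w)_T$ for all $\mathbf w\in\mathbb P^\ell(T)^d$, $\int_T\boldsymbol\pi_{\varepsilon,T}^\ell\mathbf v=\int_T\mathbf v$, and $\int_T\nabla_{ss}\boldsymbol\pi_{\varepsilon,T}^\ell\mathbf v=\int_T\nabla_{ss}\mathbf v$. *)

theory Defs
  imports "HOL-Analysis.Analysis"
begin

subsection \<open>Geometry\<close>

text \<open>
  The faces are closed convex polytopes of codimension one; a planar non-convex face is a finite
  union of such polytopes, so the set itself may be non-convex, with non-convex faces.
\<close>
definition polytopal :: "(real ^ 'd) set \<Rightarrow> bool" where
  "polytopal T \<longleftrightarrow> T \<noteq> {} \<and> open T \<and> bounded T \<and> connected T \<and>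
     (\<exists>\<F>. finite \<F> \<and> (\<forall>F\<in>\<F>. polytope F \<and> aff_dim F = int CARD('d) - 1) \<and> frontier T = \<Union>\<F>)"

definition star_shaped_wrt :: "(real ^ 'd) set \<Rightarrow> real ^ 'd \<Rightarrow> bool" where
  "star_shaped_wrt T y \<longleftrightarrow> y \<in> T \<and> (\<forall>x\<in>T. closed_segment x y \<subseteq> T)"

subsection \<open>Weak derivatives and Sobolev spaces\<close>

text \<open>
  Multi-indices are functions \<open>\<alpha> :: 'd \<Rightarrow> nat\<close>, of order \<open>sum \<alpha> UNIV\<close>.
\<close>

definition partial_deriv :: "'d \<Rightarrow> (real ^ 'd \<Rightarrow> real) \<Rightarrow> real ^ 'd \<Rightarrow> real" where
  "partial_deriv j f x = frechet_derivative f (at x) (axis j 1)"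

text \<open>
  Requiring every iterated partial derivative to be Frechet differentiable everywhere makes all of
  them continuous, hence this is the class of infinitely differentiable functions.
\<close>
definition smooth_fun :: "(real ^ 'd \<Rightarrow> real) \<Rightarrow> bool" where
  "smooth_fun f \<longleftrightarrow> (\<forall>js x. foldr partial_deriv js f differentiable (at x))"

definition test_functions :: "(real ^ 'd) set \<Rightarrow> (real ^ 'd \<Rightarrow> real) set" where
  "test_functions T =
     {\<phi>. smooth_fun \<phi> \<and> compact (closure {x. \<phi> x \<noteq> 0}) \<and> closure {x. \<phi> x \<noteq> 0} \<subseteq> T}"

definition locally_integrable :: "(real ^ 'd) set \<Rightarrow> (real ^ 'd \<Rightarrow> real) \<Rightarrow> bool" where
  "locally_integrable T u \<longleftrightarrow> (\<forall>K. compact K \<and> K \<subseteq> T \<longrightarrow> set_integrable lebesgue K u)"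

text \<open>
  The lists \<open>js\<close> are the enumerations of \<open>\<alpha>\<close> with multiplicity, so \<open>foldr partial_deriv js \<phi>\<close> is the
  classical derivative of \<open>\<phi>\<close> of multi-index \<open>\<alpha>\<close>, whichever enumeration is taken.
\<close>
definition has_weak_deriv ::
    "(real ^ 'd) set \<Rightarrow> ('d \<Rightarrow> nat) \<Rightarrow> (real ^ 'd \<Rightarrow> real) \<Rightarrow> (real ^ 'd \<Rightarrow> real) \<Rightarrow> bool" where
  "has_weak_deriv T \<alpha> u g \<longleftrightarrow> locally_integrable T u \<and> locally_integrable T g \<and>
     (\<forall>\<phi>\<in>test_functions T. \<forall>js. count_list js = \<alpha> \<longrightarrow>
        (LINT x:T|lebesgue. u x * foldr partial_deriv js \<phi> x)
          = (- 1) ^ sum \<alpha> UNIV * (LINT x:T|lebesgue. g x * \<phi> x))"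

text \<open>Weak derivatives are unique almost everywhere in \<open>T\<close>, so the choice is immaterial in integrals.\<close>
definition weak_deriv ::
    "(real ^ 'd) set \<Rightarrow> ('d \<Rightarrow> nat) \<Rightarrow> (real ^ 'd \<Rightarrow> real) \<Rightarrow> real ^ 'd \<Rightarrow> real" where
  "weak_deriv T \<alpha> u = (SOME g. has_weak_deriv T \<alpha> u g)"

definition square_integrable :: "(real ^ 'd) set \<Rightarrow> (real ^ 'd \<Rightarrow> real) \<Rightarrow> bool" where
  "square_integrable T u \<longleftrightarrow>
     set_borel_measurable lebesgue T u \<and> set_integrable lebesgue T (\<lambda>x. (u x)\<^sup>2)"

text \<open>Elements of Sobolev spaces are represented by functions; values outside \<open>T\<close> are irrelevant.\<close>
definition sobolev :: "nat \<Rightarrow> (real ^ 'd) set \<Rightarrow> (real ^ 'd \<Rightarrow> real) set" where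
  "sobolev s T = {u. square_integrable T u \<and>
     (\<forall>\<alpha>. sum \<alpha> UNIV \<le> s \<longrightarrow> (\<exists>g. has_weak_deriv T \<alpha> u g \<and> square_integrable T g))}"

definition sobolev_vec :: "nat \<Rightarrow> (real ^ 'd) set \<Rightarrow> (real ^ 'd \<Rightarrow> real ^ 'd) set" where
  "sobolev_vec s T = {v. \<forall>i. (\<lambda>x. v x $ i) \<in> sobolev s T}"

definition sobolev_seminorm :: "nat \<Rightarrow> (real ^ 'd) set \<Rightarrow> (real ^ 'd \<Rightarrow> real ^ 'd) \<Rightarrow> real" where
  "sobolev_seminorm m T v = sqrt (\<Sum>i\<in>UNIV. \<Sum>\<alpha> | sum \<alpha> UNIV = m.
     LINT x:T|lebesgue. (weak_deriv T \<alpha> (\<lambda>y. v y $ i) x)\<^sup>2)"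

subsection \<open>The strain projector\<close>

text \<open>
  Polynomials are functions on the whole space; one vanishing on a nonempty open set vanishes
  identically, so for such \<open>T\<close> they correspond to their restrictions to \<open>T\<close>.
\<close>
definition poly_space :: "nat \<Rightarrow> (real ^ 'd \<Rightarrow> real) set" where
  "poly_space l = {p. \<exists>c :: ('d \<Rightarrow> nat) \<Rightarrow> real.
     p = (\<lambda>x. \<Sum>\<alpha> | sum \<alpha> UNIV \<le> l. c \<alpha> * (\<Prod>i\<in>UNIV. (x $ i) ^ \<alpha> i))}"

definition poly_space_vec :: "nat \<Rightarrow> (real ^ 'd \<Rightarrow> real ^ 'd) set" where
  "poly_space_vec l = {p. \<forall>i. (\<lambda>x. p x $ i) \<in> poly_space l}"

definition grad ::
    "(real ^ 'd) set \<Rightarrow> (real ^ 'd \<Rightarrow> real ^ 'd) \<Rightarrow> real ^ 'd \<Rightarrow> real ^ 'd ^ 'd" where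
  "grad T u x = (\<chi> i j. weak_deriv T (\<lambda>k. if k = j then 1 else 0) (\<lambda>y. u y $ i) x)"

definition sym_grad ::
    "(real ^ 'd) set \<Rightarrow> (real ^ 'd \<Rightarrow> real ^ 'd) \<Rightarrow> real ^ 'd \<Rightarrow> real ^ 'd ^ 'd" where
  "sym_grad T u x = (1 / 2) *\<^sub>R (grad T u x + transpose (grad T u x))"

definition skew_grad ::
    "(real ^ 'd) set \<Rightarrow> (real ^ 'd \<Rightarrow> real ^ 'd) \<Rightarrow> real ^ 'd \<Rightarrow> real ^ 'd ^ 'd" where
  "skew_grad T u x = (1 / 2) *\<^sub>R (grad T u x - transpose (grad T u x))"

text \<open>The inner product of the type \<open>real ^ 'd ^ 'd\<close> is the Frobenius product.\<close>
definition L2_inner ::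
    "(real ^ 'd) set \<Rightarrow> (real ^ 'd \<Rightarrow> real ^ 'd ^ 'd) \<Rightarrow> (real ^ 'd \<Rightarrow> real ^ 'd ^ 'd) \<Rightarrow> real" where
  "L2_inner T A B = (LINT x:T|lebesgue. A x \<bullet> B x)"

definition strain_projector ::
    "nat \<Rightarrow> (real ^ 'd) set \<Rightarrow> (real ^ 'd \<Rightarrow> real ^ 'd) \<Rightarrow> real ^ 'd \<Rightarrow> real ^ 'd" where
  "strain_projector l T v = (THE p. p \<in> poly_space_vec l \<and>
     (\<forall>w\<in>poly_space_vec l.
        L2_inner T (sym_grad T p) (sym_grad T w) = L2_inner T (sym_grad T v) (sym_grad T w)) \<and>
     (LINT x:T|lebesgue. p x) = (LINT x:T|lebesgue. v x) \<and>
     (LINT x:T|lebesgue. skew_grad T p x) = (LINT x:T|lebesgue. skew_grad T v x))"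

end

theory Submission
  imports Defs
begin

text \<open>
  The classical route through Korn's inequality for Sobolev functions and the averaged Taylor polynomial
  is replaced by two uniform tools. The first is the Poincare inequality for star-shaped sets: if \<open>B\<close> is the ball of
  centres, \<open>u x - u y\<close> is integrated along the segment from \<open>x \<in> T\<close> to \<open>y \<in> B\<close>, which lies in \<open>T\<close>; substituting
  in \<open>x\<close> on the half near \<open>x\<close> and in \<open>y\<close> on the half near \<open>y\<close> loses a factor of at most \<open>2\<close> per dimension. Weak
  derivatives are reached by mollification: the points whose cube of side \<open>\<delta>\<close> stays in \<open>T\<close> form
  again a star-shaped set. The second tool is the inverse inequality for polynomials, which compares
  them on \<open>T\<close> with the ball of centres and is uniform by scaling.

  Choosing a polynomial \<open>q\<close> of degree below \<open>s\<close> such that all derivatives of \<open>v - q\<close> of order below \<open>s\<close> have mean zero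
  and iterating the Poincare inequality bounds \<open>v - q\<close> in every seminorm. The projector fixes \<open>q\<close>, so only its stability
  is needed, and this takes Korn's inequality for polynomials alone. The derivatives of the
  skew gradient are combinations of derivatives of the symmetric one, hence controlled by the inverse inequality,
  and the Poincare inequality removes the derivative again.

  Squared norms are used throughout, so that no square root occurs before the last step.
\<close>

subsection \<open>Smooth bump functions\<close>

text \<open>A compactness argument on T itself would give a constant that depends on T. Hence every
  estimate is either explicit or proved on a fixed ball and moved to T by scaling, so that T enters
  only through \<rho> and h. The powers of h make Korn's inequality uniform: on squared norms the
  inverse inequality costs h^-2 and the Poincare inequality repays h^2. The inverse inequality says
  nothing about v, but the projection of the remainder v - q is a polynomial. Stability is therefore
  used for first derivatives only; higher orders of that projection follow from the inverse
  inequality, order zero from the Poincare inequality and the prescribed mean. The projector is a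
  definite description, so its existence and uniqueness belong to the proof. Both rest on the same
  fact, again Korn's inequality: a polynomial field without strain, with mean zero and mean rotation
  zero, vanishes.\<close>

lemma has_derivative_prod_coordinates:
  fixes B :: "'d::finite \<Rightarrow> nat \<Rightarrow> real \<Rightarrow> real" and x :: "real ^ 'd"
  assumes "\<And>i k t. (B i k has_real_derivative B i (Suc k) t) (at t)"
  shows "((\<lambda>y. c * (\<Prod>i\<in>UNIV. B i (k i) (y $ i))) has_derivative
     (\<lambda>v. \<Sum>j\<in>UNIV. v $ j * (c * (\<Prod>i\<in>UNIV. B i ((k(j := Suc (k j))) i) (x $ i))))) (at x)"
proof -
  have 1: "((\<lambda>y. B i (k i) (y $ i)) has_derivative (\<lambda>v. v $ i * B i (Suc (k i)) (x $ i))) (at x)" for i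
  proof -
    have "((\<lambda>y::real^'d. y $ i) has_derivative (\<lambda>v. v $ i)) (at x)"
      by (rule bounded_linear_imp_has_derivative[OF bounded_linear_vec_nth])
    from has_derivative_compose[OF this assms[of i "k i" "x $ i", unfolded has_field_derivative_def]]
    show ?thesis by (simp add: o_def mult.commute)
  qed
  have "((\<lambda>y. c * (\<Prod>i\<in>UNIV. B i (k i) (y $ i))) has_derivative
      (\<lambda>v. c * (\<Sum>j\<in>UNIV. v $ j * B j (Suc (k j)) (x $ j) * (\<Prod>i\<in>UNIV - {j}. B i (k i) (x $ i))))) (at x)"
    by (intro has_derivative_mult_right has_derivative_prod 1)
  moreover have "B j (Suc (k j)) (x $ j) * (\<Prod>i\<in>UNIV - {j}. B i (k i) (x $ i)) =
      (\<Prod>i\<in>UNIV. B i ((k(j := Suc (k j))) i) (x $ i))" for j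
    by (subst prod.remove[of UNIV j]) (auto intro!: prod.cong)
  ultimately show ?thesis
    by (simp add: sum_distrib_left mult_ac)
qed

lemma partial_deriv_eq:
  assumes "(f has_derivative D) (at x)"
  shows "partial_deriv j f x = D (axis j 1)"
  using frechet_derivative_at[OF assms] by (simp add: partial_deriv_def)

lemma sum_axis_mult: "(\<Sum>i\<in>UNIV. axis j (1::real) $ i * f i) = f (j::'d::finite)"
  by (simp add: axis_def if_distrib[of "\<lambda>a. a * _"] cong: if_cong)

text \<open>\<open>B i k\<close> plays the k-th derivative of the i-th factor, so a differentiation
  only raises one entry of the multi-index and the product form persists. Mollifiers and monomials
  are both instances; one computation serves both.\<close>

lemma foldr_partial_deriv_prod_coordinates:
  fixes B :: "'d::finite \<Rightarrow> nat \<Rightarrow> real \<Rightarrow> real"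
  assumes "\<And>i k t. (B i k has_real_derivative B i (Suc k) t) (at t)"
  shows "foldr partial_deriv js (\<lambda>y. c * (\<Prod>i\<in>UNIV. B i (k i) (y $ i))) =
    (\<lambda>y. c * (\<Prod>i\<in>UNIV. B i (k i + count_list js i) (y $ i)))"
proof (induction js)
  case (Cons j js)
  show ?case
  proof
    fix x
    have eq: "((\<lambda>i. k i + count_list js i)(j := Suc (k j + count_list js j))) i =
      k i + count_list (j # js) i" for i by simp
    show "foldr partial_deriv (j # js) (\<lambda>y. c * (\<Prod>i\<in>UNIV. B i (k i) (y $ i))) x =
      c * (\<Prod>i\<in>UNIV. B i (k i + count_list (j # js) i) (x $ i))"
      unfolding foldr.simps o_apply Cons
      by (subst partial_deriv_eq[OF has_derivative_prod_coordinates[of B, where k = "\<lambda>i. k i + count_list js i", OF assms]])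
        (simp only: sum_axis_mult eq)
  qed
qed simp

lemma smooth_fun_prod_coordinates:
  fixes B :: "'d::finite \<Rightarrow> nat \<Rightarrow> real \<Rightarrow> real"
  assumes "\<And>i k t. (B i k has_real_derivative B i (Suc k) t) (at t)"
  shows "smooth_fun (\<lambda>y. c * (\<Prod>i\<in>UNIV. B i (k i) (y $ i)))"
  unfolding smooth_fun_def foldr_partial_deriv_prod_coordinates[of B, OF assms]
proof (intro allI)
  show "(\<lambda>y. c * (\<Prod>i\<in>UNIV. B i (k i + count_list js i) (y $ i))) differentiable at x" for js x
    using has_derivative_prod_coordinates[of B c "\<lambda>i. k i + count_list js i" x, OF assms]
    by (rule differentiableI)
qed

text \<open>The power of t in the denominator is carried along because differentiating exp (- 1 / t)
  creates such powers: the derivative of \<open>flat_exp k\<close> is a combination of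
  \<open>flat_exp (k + 2)\<close> and \<open>flat_exp (k + 1)\<close>.\<close>

definition flat_exp :: "nat \<Rightarrow> real \<Rightarrow> real" where
  "flat_exp k t = (if t > 0 then exp (- 1 / t) / t ^ k else 0)"

lemma flat_exp_tendsto_0: "((flat_exp k) \<longlongrightarrow> 0) (at 0)"
proof -
  have "((\<lambda>x::real. x ^ k / exp x) \<longlongrightarrow> 0) at_top"
    by (rule tendsto_power_div_exp_0)
  hence "((\<lambda>t::real. inverse t ^ k / exp (inverse t)) \<longlongrightarrow> 0) (at_right 0)"
    by (rule filterlim_compose[OF _ filterlim_inverse_at_top_right])
  hence r: "(flat_exp k \<longlongrightarrow> 0) (at_right 0)"
    by (rule Lim_transform_eventually)
      (auto simp: eventually_at_filter flat_exp_def field_simps exp_minus)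
  have l: "(flat_exp k \<longlongrightarrow> 0) (at_left 0)"
    by (rule Lim_transform_eventually[OF tendsto_const])
      (auto simp: eventually_at_filter flat_exp_def)
  from l r show ?thesis by (rule filterlim_split_at)
qed

lemma flat_exp_has_derivative:
  "(flat_exp k has_real_derivative flat_exp (k + 2) t - real k * flat_exp (k + 1) t) (at t)"
proof -
  consider "t > 0" | "t < 0" | "t = 0" by linarith
  then show ?thesis
  proof cases
    case 1
    have "((\<lambda>t. exp (- 1 / t) / t ^ k) has_real_derivative flat_exp (k + 2) t - real k * flat_exp (k + 1) t) (at t)"
    proof -
      have e: "((\<lambda>t. exp (- 1 / t)) has_real_derivative exp (- 1 / t) / t\<^sup>2) (at t)"
        using 1 by (auto intro!: derivative_eq_intros simp: field_simps power2_eq_square)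
      have p: "real k * t ^ (k - Suc 0) * t = real k * t ^ k" by (cases k) auto
      show ?thesis
        by (rule DERIV_cong[OF DERIV_divide[OF e DERIV_pow]])
          (use 1 p in \<open>auto simp: flat_exp_def field_simps power2_eq_square\<close>)
    qed
    moreover have "\<forall>\<^sub>F s in nhds t. s > 0" using 1 eventually_nhds_in_open[of "{0<..}" t] by simp
    ultimately show ?thesis
      by (subst DERIV_cong_ev[OF refl _ refl]) (auto elim!: eventually_mono simp: flat_exp_def)
  next
    case 2
    have "\<forall>\<^sub>F s in nhds t. s < 0" using 2 eventually_nhds_in_open[of "{..<0}" t] by simp
    then show ?thesis using 2
      by (subst DERIV_cong_ev[OF refl, where g = "\<lambda>_. 0", OF _ refl]) (auto elim!: eventually_mono simp: flat_exp_def)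
  next
    case 3
    \<comment> \<open>At the origin the difference quotient of \<open>flat_exp k\<close> is
      \<open>flat_exp (Suc k)\<close>, whose limit is already known to be 0.\<close>
    have "((\<lambda>s. (flat_exp k s - flat_exp k 0) / (s - 0)) \<longlongrightarrow> 0) (at 0)"
      by (rule Lim_transform_eventually[OF flat_exp_tendsto_0[of "Suc k"]])
        (auto simp: eventually_at_filter flat_exp_def field_simps)
    then show ?thesis using 3 by (simp add: has_field_derivative_iff flat_exp_def)
  qed
qed

text \<open>A class that contains the bump and is closed under differentiation. Smoothness and
  vanishing outside (0, 1) are proved for the whole class by induction and so reach all derivatives
  of the bump at once.\<close>

inductive_set bump_span :: "(real \<Rightarrow> real) set" where
  base: "(\<lambda>t. c * (flat_exp k t * flat_exp m (1 - t))) \<in> bump_span"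
| add: "f \<in> bump_span \<Longrightarrow> g \<in> bump_span \<Longrightarrow> (\<lambda>t. f t + g t) \<in> bump_span"

lemma bump_span_deriv:
  assumes "f \<in> bump_span"
  shows "\<exists>f'\<in>bump_span. \<forall>t. (f has_real_derivative f' t) (at t)"
  using assms
proof induction
  case (base c k m)
  define f' where "f' = (\<lambda>t. (c * (flat_exp (k+2) t * flat_exp m (1 - t)) +
      (- c * real k) * (flat_exp (k+1) t * flat_exp m (1 - t))) +
      ((- c) * (flat_exp k t * flat_exp (m+2) (1 - t)) +
      (c * real m) * (flat_exp k t * flat_exp (m+1) (1 - t))))"
  have "f' \<in> bump_span" unfolding f'_def by (intro bump_span.intros)
  moreover have "((\<lambda>t. c * (flat_exp k t * flat_exp m (1 - t))) has_real_derivative f' t) (at t)" for t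
    unfolding f'_def
    by (auto intro!: derivative_eq_intros flat_exp_has_derivative
      DERIV_chain2[where f = "flat_exp m" and g = "\<lambda>t. 1 - t", OF flat_exp_has_derivative] simp: algebra_simps)
  ultimately show ?case by blast
next
  case (add f g)
  then obtain f' g' where "f' \<in> bump_span" "g' \<in> bump_span"
    "\<forall>t. (f has_real_derivative f' t) (at t)" "\<forall>t. (g has_real_derivative g' t) (at t)" by blast
  then show ?case by (intro bexI[of _ "\<lambda>t. f' t + g' t"] bump_span.add) (auto intro!: derivative_intros)
qed

definition bump :: "nat \<Rightarrow> real \<Rightarrow> real" where
  "bump k = (deriv ^^ k) (\<lambda>t. flat_exp 0 t * flat_exp 0 (1 - t))"

lemma bump_in_span: "bump k \<in> bump_span"
proof (induction k)
  case 0
  show ?case using bump_span.base[of 1 0 0] by (simp add: bump_def)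
next
  case (Suc k)
  obtain f' where f': "f' \<in> bump_span" "\<forall>t. (bump k has_real_derivative f' t) (at t)"
    using bump_span_deriv[OF Suc] by blast
  then have "bump (Suc k) = f'" by (auto simp: bump_def fun_eq_iff intro: DERIV_imp_deriv)
  with f' show ?case by simp
qed

lemma bump_has_derivative: "(bump k has_real_derivative bump (Suc k) t) (at t)"
proof -
  obtain f' where "\<forall>t. (bump k has_real_derivative f' t) (at t)"
    using bump_span_deriv[OF bump_in_span[of k]] by blast
  then show ?thesis using DERIV_deriv_iff_has_field_derivative by (auto simp: bump_def)
qed

lemma bump_eq_0: "t \<le> 0 \<or> t \<ge> 1 \<Longrightarrow> bump k t = 0"
proof -
  have "f \<in> bump_span \<Longrightarrow> t \<le> 0 \<or> t \<ge> 1 \<Longrightarrow> f t = 0" for f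
    by (induction rule: bump_span.induct) (auto simp: flat_exp_def)
  then show "t \<le> 0 \<or> t \<ge> 1 \<Longrightarrow> bump k t = 0" using bump_in_span by blast
qed

lemma bump_0_pos: "0 < t \<Longrightarrow> t < 1 \<Longrightarrow> bump 0 t > 0"
  by (simp add: bump_def flat_exp_def)

lemma bump_0_nonneg: "bump 0 t \<ge> 0"
  by (simp add: bump_def flat_exp_def)

lemma continuous_on_bump [continuous_intros]:
  "continuous_on S f \<Longrightarrow> continuous_on S (\<lambda>x. bump k (f x))"
  by (rule continuous_on_compose2[of UNIV "bump k"])
    (auto intro!: continuous_at_imp_continuous_on DERIV_isCont bump_has_derivative)

lemma bump_bounded: "\<exists>c. \<forall>t. \<bar>bump k t\<bar> \<le> c"
proof -
  have "compact (bump k ` {0..1})" by (intro compact_continuous_image continuous_intros) auto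
  then obtain c where c: "\<forall>y\<in>bump k ` {0..1}. norm y \<le> c" by (auto dest!: compact_imp_bounded simp: bounded_iff)
  have "\<bar>bump k t\<bar> \<le> max c 0" for t
    by (cases "t \<in> {0..1}") (use c bump_eq_0[of t k] in \<open>auto simp: le_max_iff_disj\<close>)
  then show ?thesis by blast
qed

subsection \<open>Mollification\<close>

lemma nn_integral_lborel_affine:
  fixes t :: "'a::euclidean_space" and f :: "'a \<Rightarrow> ennreal"
  assumes [measurable]: "f \<in> borel_measurable borel" and c: "c \<noteq> 0"
  shows "(\<integral>\<^sup>+x. f x \<partial>lborel) = ennreal (\<bar>c\<bar> ^ DIM('a)) * (\<integral>\<^sup>+x. f (t + c *\<^sub>R x) \<partial>lborel)"
  by (subst lborel_affine[OF c, of t])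
    (simp add: nn_integral_density nn_integral_distr nn_integral_cmult)

lemma One_vec_nth [simp]: "(\<Sum>b\<in>Basis. (b :: real ^ 'd::finite) $ i) = 1"
proof -
  have "(One :: real ^ 'd) $ i = 1" by (simp only: cart_eq_inner_axis) (simp add: axis_in_Basis_iff)
  then show ?thesis by simp
qed

text \<open>A product bump rather than a radial one: its iterated derivatives are then given by
  \<open>foldr_partial_deriv_prod_coordinates\<close>.\<close>

definition bump_vec :: "real ^ 'd \<Rightarrow> real" where
  "bump_vec z = (\<Prod>i\<in>UNIV. bump 0 (z $ i))"

lemma bump_vec_nonneg: "bump_vec z \<ge> 0"
  unfolding bump_vec_def by (intro prod_nonneg) (simp add: bump_0_nonneg)

lemma bump_vec_neq_0:
  assumes "bump_vec z \<noteq> 0" shows "0 < z $ i" "z $ i < 1"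
proof -
  have "bump 0 (z $ i) \<noteq> 0" using assms by (auto simp: bump_vec_def)
  then show "0 < z $ i" "z $ i < 1" using bump_eq_0[of "z $ i" 0] by force+
qed

lemma continuous_on_bump_vec [continuous_intros]:
  "continuous_on S f \<Longrightarrow> continuous_on S (\<lambda>x. bump_vec (f x))"
  unfolding bump_vec_def by (intro continuous_intros)

lemma borel_measurable_bump_vec [measurable]: "bump_vec \<in> borel_measurable borel"
  by (intro borel_measurable_continuous_onI continuous_intros)

lemma bump_vec_bounded: "\<exists>c\<ge>0. \<forall>z. bump_vec z \<le> c"
proof -
  obtain c where c: "\<And>t. \<bar>bump 0 t\<bar> \<le> c" using bump_bounded by blast
  have "bump_vec (z::real^'d) \<le> c ^ CARD('d)" for z
  proof -
    have "bump_vec z \<le> (\<Prod>i\<in>(UNIV::'d set). c)" unfolding bump_vec_def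
      by (intro prod_mono) (use c bump_0_nonneg in \<open>auto simp: abs_le_iff\<close>)
    then show ?thesis by simp
  qed
  then show ?thesis using bump_vec_nonneg order_trans by blast
qed

lemma integrable_bump_vec: "integrable lborel (bump_vec :: real^'d::finite \<Rightarrow> real)"
proof -
  have "integrable lborel (\<lambda>z::real^'d. indicator (cbox 0 One) z *\<^sub>R bump_vec z)"
    by (intro borel_integrable_compact continuous_intros) auto
  also have "(\<lambda>z::real^'d. indicator (cbox 0 One) z *\<^sub>R bump_vec z) = bump_vec"
  proof
    fix z :: "real^'d"
    show "indicator (cbox 0 One) z *\<^sub>R bump_vec z = bump_vec z"
      by (cases "bump_vec z = 0") (auto simp: indicator_def mem_box_cart dest: bump_vec_neq_0 intro: less_imp_le)
  qed
  finally show ?thesis .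
qed

definition bump_mass :: "'d::finite itself \<Rightarrow> real" where
  "bump_mass _ = (\<integral>z. bump_vec (z::real^'d) \<partial>lborel)"

text \<open>The bump is positive on the open unit box; a vanishing integral would make this box a
  null set.\<close>

lemma bump_mass_pos: "bump_mass TYPE('d::finite) > 0"
proof (rule ccontr)
  assume "\<not> ?thesis"
  moreover have "(\<integral>z. bump_vec (z::real^'d) \<partial>lborel) \<ge> 0"
    by (intro integral_nonneg_AE) (simp add: bump_vec_nonneg)
  ultimately have "(\<integral>z. bump_vec (z::real^'d) \<partial>lborel) = 0"
    by (simp add: bump_mass_def)
  then have "AE z in lborel. bump_vec (z::real^'d) = 0"
    by (subst (asm) integral_nonneg_eq_0_iff_AE[OF integrable_bump_vec]) (auto simp: bump_vec_nonneg)
  moreover have pos: "bump_vec z > 0" if "z \<in> box 0 One" for z :: "real^'d"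
    using that unfolding bump_vec_def by (intro prod_pos) (auto simp: mem_box_cart intro!: bump_0_pos)
  ultimately have "AE z in lborel. z \<notin> box 0 (One::real^'d)"
    by - (erule AE_mp, rule AE_I2, use pos in force)
  then have "emeasure lborel (box 0 (One::real^'d)) = 0"
    by (subst (asm) AE_iff_measurable[OF _ refl]) (auto simp: Int_def)
  then show False by (simp add: emeasure_lborel_box_eq)
qed

text \<open>The kernel lives on the cube with lower corner x and side \<delta>, not on a cube
  centred at x. This is the shape of the cubes over which the differentiation theorem averages, and
  it fixes the form of \<open>cube_erosion\<close>.\<close>

definition mollifier :: "real \<Rightarrow> real ^ 'd \<Rightarrow> real ^ 'd::finite \<Rightarrow> real" where
  "mollifier \<delta> x y = bump_vec ((1 / \<delta>) *\<^sub>R (y - x)) / (bump_mass TYPE('d) * \<delta> ^ CARD('d))"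

lemma mollifier_nonneg: "\<delta> > 0 \<Longrightarrow> mollifier \<delta> x y \<ge> 0"
  using bump_mass_pos[where 'd='a] by (simp add: mollifier_def bump_vec_nonneg)

lemma mollifier_neq_0:
  assumes "mollifier \<delta> x y \<noteq> 0" "\<delta> > 0" shows "x $ i < y $ i" "y $ i < x $ i + \<delta>"
proof -
  have "bump_vec ((1 / \<delta>) *\<^sub>R (y - x)) \<noteq> 0" using assms by (auto simp: mollifier_def)
  from bump_vec_neq_0[OF this, of i] show "x $ i < y $ i" "y $ i < x $ i + \<delta>"
    using assms by (auto simp: field_simps)
qed

lemma continuous_on_mollifier [continuous_intros]:
  "continuous_on S f \<Longrightarrow> continuous_on S g \<Longrightarrow> continuous_on S (\<lambda>x. mollifier \<delta> (f x) (g x))"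
  unfolding mollifier_def divide_inverse by (intro continuous_intros)

lemma borel_measurable_mollifier [measurable]:
  "f \<in> borel_measurable M \<Longrightarrow> g \<in> borel_measurable M \<Longrightarrow> (\<lambda>x. mollifier \<delta> (f x) (g x)) \<in> borel_measurable M"
  unfolding mollifier_def divide_inverse by (rule borel_measurable_times) simp_all

lemma nn_integral_bump_vec: "(\<integral>\<^sup>+z. bump_vec (z::real^'d::finite) \<partial>lborel) = ennreal (bump_mass TYPE('d))"
  unfolding bump_mass_def by (rule nn_integral_eq_integral[OF integrable_bump_vec]) (simp add: bump_vec_nonneg)

text \<open>Unit mass in either variable. Over y it makes mollification an average; over the base
  point it is used after an exchange of integrals, to see that mollification does not increase the
  L2 norm. The substitution for the second integral has the factor - \<delta>.\<close>

lemma nn_integral_mollifier: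
  fixes x :: "real^'d::finite" assumes "\<delta> > 0"
  shows "(\<integral>\<^sup>+y. mollifier \<delta> x y \<partial>lborel) = 1" "(\<integral>\<^sup>+y. mollifier \<delta> y x \<partial>lborel) = 1"
proof -
  have scaled: "(\<integral>\<^sup>+y. ennreal (bump_vec (y::real^'d) / (bump_mass TYPE('d) * \<delta> ^ CARD('d))) \<partial>lborel) * ennreal (\<delta> ^ CARD('d)) = 1"
  proof -
    have "(\<integral>\<^sup>+y. ennreal (bump_vec (y::real^'d) / (bump_mass TYPE('d) * \<delta> ^ CARD('d))) \<partial>lborel) =
      (\<integral>\<^sup>+y. ennreal (bump_vec (y::real^'d)) * ennreal (1 / (bump_mass TYPE('d) * \<delta> ^ CARD('d))) \<partial>lborel)"
      using assms bump_mass_pos[where 'd='d]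
      by (subst ennreal_mult[symmetric]) (auto simp: bump_vec_nonneg intro!: divide_nonneg_pos)
    also have "\<dots> = ennreal (bump_mass TYPE('d)) * ennreal (1 / (bump_mass TYPE('d) * \<delta> ^ CARD('d)))"
      by (subst nn_integral_multc) (auto simp: nn_integral_bump_vec)
    finally show ?thesis using assms bump_mass_pos[where 'd='d]
      by (simp add: less_imp_le flip: ennreal_mult)
  qed
  have "(\<integral>\<^sup>+y. mollifier \<delta> x y \<partial>lborel) = ennreal (\<bar>\<delta>\<bar> ^ DIM(real^'d)) * (\<integral>\<^sup>+z. mollifier \<delta> x (x + \<delta> *\<^sub>R z) \<partial>lborel)"
    by (rule nn_integral_lborel_affine) (use assms in auto)
  then show "(\<integral>\<^sup>+y. mollifier \<delta> x y \<partial>lborel) = 1"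
    using scaled assms by (simp add: mollifier_def mult.commute)
  have "(\<integral>\<^sup>+y. mollifier \<delta> y x \<partial>lborel) = ennreal (\<bar>- \<delta>\<bar> ^ DIM(real^'d)) * (\<integral>\<^sup>+z. mollifier \<delta> (x + (- \<delta>) *\<^sub>R z) x \<partial>lborel)"
    by (rule nn_integral_lborel_affine) (use assms in auto)
  then show "(\<integral>\<^sup>+y. mollifier \<delta> y x \<partial>lborel) = 1"
    using scaled assms by (simp add: mollifier_def mult.commute)
qed

lemma has_bochner_integral_mollifier:
  assumes "\<delta> > 0" shows "has_bochner_integral lborel (mollifier \<delta> x) 1"
  by (rule has_bochner_integral_nn_integral)
    (use assms nn_integral_mollifier(1)[OF assms, of x] in \<open>auto simp: mollifier_nonneg\<close>)

lemma mollifier_eq_prod: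
  "mollifier \<delta> x = (\<lambda>y. (1 / (bump_mass TYPE('d) * \<delta> ^ CARD('d))) *
      (\<Prod>i\<in>UNIV. bump 0 ((y $ i - x $ i) / \<delta>) / \<delta> ^ 0))" for x :: "real^'d::finite"
  by (simp add: mollifier_def bump_vec_def fun_eq_iff)

lemma scaled_bump_has_derivative:
  shows "((\<lambda>t. bump k ((t - a) / \<delta>) / \<delta> ^ k) has_real_derivative bump (Suc k) ((t - a) / \<delta>) / \<delta> ^ Suc k) (at t)"
proof -
  have "((\<lambda>t. bump k ((t - a) / \<delta>)) has_real_derivative bump (Suc k) ((t - a) / \<delta>) * (1 / \<delta>)) (at t)"
    by (rule DERIV_chain2[OF bump_has_derivative], rule DERIV_cdivide) (auto intro!: derivative_eq_intros)
  from DERIV_cdivide[OF this, of "\<delta> ^ k"] show ?thesis by simp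
qed

lemma mollifier_test_function:
  assumes \<delta>: "\<delta> > 0" and T: "cbox x (x + \<delta> *\<^sub>R One) \<subseteq> T"
  shows "mollifier \<delta> x \<in> test_functions T"
proof -
  have "closure {y. mollifier \<delta> x y \<noteq> 0} \<subseteq> cbox x (x + \<delta> *\<^sub>R One)"
  proof (intro closure_minimal subsetI)
    fix y assume "y \<in> {y. mollifier \<delta> x y \<noteq> 0}"
    then have "x $ i < y $ i \<and> y $ i < x $ i + \<delta>" for i
      using mollifier_neq_0[OF _ \<delta>, of x y i] by simp
    then show "y \<in> cbox x (x + \<delta> *\<^sub>R One)" by (auto simp: mem_box_cart less_imp_le)
  qed auto
  moreover have "smooth_fun (mollifier \<delta> x)" unfolding mollifier_eq_prod
    by (rule smooth_fun_prod_coordinates[of "\<lambda>i k t. bump k ((t - x $ i) / \<delta>) / \<delta> ^ k" _ "\<lambda>_. 0"])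
      (use scaled_bump_has_derivative in auto)
  moreover have "compact (closure {y. mollifier \<delta> x y \<noteq> 0})"
    using calculation(1) by (meson bounded_cbox bounded_subset closed_closure compact_eq_bounded_closed)
  ultimately show ?thesis using T by (auto simp: test_functions_def)
qed

lemma mollifier_has_derivative:
  fixes x :: "real^'d::finite"
  shows "((\<lambda>y. mollifier \<delta> x y) has_derivative (\<lambda>v. \<Sum>j\<in>UNIV. v $ j * partial_deriv j (mollifier \<delta> x) y)) (at y)"
proof -
  define B where "B = (\<lambda>i k t. bump k ((t - x $ i) / \<delta>) / \<delta> ^ k)"
  define c where "c = 1 / (bump_mass TYPE('d) * \<delta> ^ CARD('d))"
  have eq: "mollifier \<delta> x = (\<lambda>y. c * (\<Prod>i\<in>UNIV. B i 0 (y $ i)))"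
    by (simp add: mollifier_eq_prod B_def c_def)
  have "(B i k has_real_derivative B i (Suc k) t) (at t)" for i k t
    unfolding B_def by (rule scaled_bump_has_derivative)
  from has_derivative_prod_coordinates[of B c "\<lambda>_. 0" y, OF this]
  have D: "(mollifier \<delta> x has_derivative (\<lambda>v. \<Sum>j\<in>UNIV. v $ j *
      (c * (\<Prod>i\<in>UNIV. B i (((\<lambda>_. 0)(j := Suc 0)) i) (y $ i))))) (at y)" by (simp only: eq)
  show ?thesis
    by (subst partial_deriv_eq[OF D]) (simp only: sum_axis_mult D)
qed

lemma partial_deriv_mollifier:
  fixes x :: "real^'d::finite"
  shows "partial_deriv j (mollifier \<delta> x) y = (1 / (bump_mass TYPE('d) * \<delta> ^ CARD('d))) *
      (\<Prod>i\<in>UNIV. bump (if i = j then 1 else 0) ((y $ i - x $ i) / \<delta>) / \<delta> ^ (if i = j then 1 else 0))"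
proof -
  have "foldr partial_deriv [j] (mollifier \<delta> x) y = (1 / (bump_mass TYPE('d) * \<delta> ^ CARD('d))) *
      (\<Prod>i\<in>UNIV. bump (0 + count_list [j] i) ((y $ i - x $ i) / \<delta>) / \<delta> ^ (0 + count_list [j] i))"
    unfolding mollifier_eq_prod
    by (subst foldr_partial_deriv_prod_coordinates[of "\<lambda>i k t. bump k ((t - x $ i) / \<delta>) / \<delta> ^ k" _ _ "\<lambda>_. 0"])
     (use scaled_bump_has_derivative in auto)
  then show ?thesis by (auto simp: eq_commute cong: if_cong)
qed

text \<open>Dominated convergence along sequences of difference quotients. A bound w for the
  derivative bounds the quotients as well, by the mean value inequality, and \<open>f' t\<close> is
  measurable as a pointwise limit of them.\<close>

lemma has_real_derivative_integral:
  fixes f :: "real \<Rightarrow> 'a \<Rightarrow> real"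
  assumes int: "\<And>t. integrable M (f t)" and w: "integrable M w"
    and D: "\<And>t y. y \<in> space M \<Longrightarrow> ((\<lambda>t. f t y) has_real_derivative f' t y) (at t)"
    and bd: "\<And>t y. y \<in> space M \<Longrightarrow> \<bar>f' t y\<bar> \<le> w y"
  shows "((\<lambda>t. \<integral>y. f t y \<partial>M) has_real_derivative (\<integral>y. f' t y \<partial>M)) (at t)"
  unfolding has_field_derivative_iff tendsto_at_iff_sequentially comp_def
proof (intro allI impI)
  fix X :: "nat \<Rightarrow> real" assume X: "\<forall>n. X n \<in> UNIV - {t}" "X \<longlonglongrightarrow> t"
  define q where "q = (\<lambda>n y. (f (X n) y - f t y) / (X n - t))"
  have meas: "q n \<in> borel_measurable M" for n
    unfolding q_def using borel_measurable_integrable[OF int] by measurable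
  have lim: "(\<lambda>n. q n y) \<longlonglongrightarrow> f' t y" if "y \<in> space M" for y
    using D[OF that, of t] X unfolding has_field_derivative_iff tendsto_at_iff_sequentially comp_def q_def by blast
  have qw: "\<bar>q n y\<bar> \<le> w y" if y: "y \<in> space M" for n y
  proof -
    have "norm (f (X n) y - f t y) \<le> w y * norm (X n - t)"
      by (rule field_differentiable_bound[of UNIV "\<lambda>t. f t y" "\<lambda>t. f' t y"])
        (use D[OF y] bd[OF y] in auto)
    then show ?thesis using X(1) by (auto simp: q_def field_simps)
  qed
  have meas': "f' t \<in> borel_measurable M" by (rule borel_measurable_LIMSEQ_real[OF lim meas])
  have "(\<lambda>n. \<integral>y. q n y \<partial>M) \<longlonglongrightarrow> (\<integral>y. f' t y \<partial>M)"
    by (rule integral_dominated_convergence[where w = w, OF meas' meas w])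
      (use lim qw in auto)
  moreover have "(\<integral>y. q n y \<partial>M) = ((\<integral>y. f (X n) y \<partial>M) - (\<integral>y. f t y \<partial>M)) / (X n - t)" for n
    unfolding q_def using int by (simp add: Bochner_Integration.integral_diff)
  ultimately show "(\<lambda>n. ((\<integral>y. f (X n) y \<partial>M) - (\<integral>y. f t y \<partial>M)) / (X n - t)) \<longlonglongrightarrow> (\<integral>y. f' t y \<partial>M)"
    by simp
qed

text \<open>Up to a factor free of \<delta> the bound is the reciprocal of the volume of the
  supporting cube, as is required at Lebesgue points, where \<delta> tends to 0.\<close>

lemma mollifier_le:
  "\<exists>K\<ge>0. \<forall>\<delta>>0. \<forall>x y::real^'d::finite. mollifier \<delta> x y \<le> K / \<delta> ^ CARD('d)"
proof -
  obtain c where c: "c \<ge> 0" "\<And>z::real^'d. bump_vec z \<le> c" using bump_vec_bounded by blast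
  show ?thesis
    by (rule exI[of _ "c / bump_mass TYPE('d)"])
      (use c bump_mass_pos[where 'd='d] in \<open>auto simp: mollifier_def intro!: divide_right_mono\<close>)
qed

text \<open>Here K may depend on \<delta>: it only supplies an integrable majorant for
  differentiating under the integral sign at a fixed \<delta>.\<close>

lemma partial_deriv_mollifier_bounded:
  assumes "\<delta> > 0"
  shows "\<exists>K. \<forall>j. \<forall>x y::real^'d::finite. \<bar>partial_deriv j (mollifier \<delta> x) y\<bar> \<le> K"
proof -
  obtain c0 where c0: "\<And>t. \<bar>bump 0 t\<bar> \<le> c0" using bump_bounded by blast
  obtain c1 where c1: "\<And>t. \<bar>bump 1 t\<bar> \<le> c1" using bump_bounded by blast
  define c where "c = max c0 c1 * max 1 (1 / \<delta>)"
  define Z where "Z = 1 / (bump_mass TYPE('d) * \<delta> ^ CARD('d))"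
  have Z: "Z \<ge> 0" using bump_mass_pos[where 'd='d] assms by (simp add: Z_def)
  have b: "\<bar>bump (if i = j then 1 else 0) t / \<delta> ^ (if i = j then 1 else 0)\<bar> \<le> c" for i j :: 'd and t
  proof -
    have "\<bar>bump (if i = j then 1 else 0) t\<bar> * (1 / \<delta> ^ (if i = j then 1 else 0)) \<le> c"
      unfolding c_def by (intro mult_mono) (use c0[of t] c1[of t] assms in auto)
    then show ?thesis using assms by (simp add: abs_divide del: if_split)
  qed
  have "\<bar>partial_deriv j (mollifier \<delta> x) y\<bar> \<le> Z * c ^ CARD('d)" for j and x y :: "real^'d"
  proof -
    have "\<bar>partial_deriv j (mollifier \<delta> x) y\<bar> = Z * (\<Prod>i\<in>UNIV.
      \<bar>bump (if i = j then 1 else 0) ((y $ i - x $ i) / \<delta>) / \<delta> ^ (if i = j then 1 else 0)\<bar>)"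
      using Z unfolding partial_deriv_mollifier abs_mult abs_prod by (simp add: Z_def)
    also have "\<dots> \<le> Z * (\<Prod>i\<in>(UNIV::'d set). c)"
      by (intro mult_left_mono prod_mono) (use b Z in auto)
    finally show ?thesis by simp
  qed
  then show ?thesis by blast
qed

text \<open>The kernel depends on y - x only, so moving the base point by t e amounts to moving y by
  - t e. This is the origin of the minus sign, which later cancels the one in the definition of weak
  derivatives.\<close>

lemma mollifier_line_derivative:
  fixes x e :: "real^'d::finite"
  shows "((\<lambda>t. mollifier \<delta> (x + t *\<^sub>R e) y) has_real_derivative
      - (\<Sum>j\<in>UNIV. e $ j * partial_deriv j (mollifier \<delta> (x + t *\<^sub>R e)) y)) (at t)"
proof -
  have eq: "mollifier \<delta> (x + t *\<^sub>R e) y = mollifier \<delta> x (y - t *\<^sub>R e)" for t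
    by (simp add: mollifier_def algebra_simps)
  have pd: "partial_deriv j (mollifier \<delta> (x + t *\<^sub>R e)) y = partial_deriv j (mollifier \<delta> x) (y - t *\<^sub>R e)" for t j
    unfolding partial_deriv_mollifier by (simp add: algebra_simps)
  have "((\<lambda>t. y - t *\<^sub>R e) has_derivative (\<lambda>s. - (s *\<^sub>R e))) (at t)"
    by (auto intro!: derivative_eq_intros)
  from has_derivative_compose[OF this mollifier_has_derivative]
  have "((\<lambda>t. mollifier \<delta> x (y - t *\<^sub>R e)) has_derivative
    (\<lambda>s. \<Sum>j\<in>UNIV. (- (s *\<^sub>R e)) $ j * partial_deriv j (mollifier \<delta> x) (y - t *\<^sub>R e))) (at t)" .
  then show ?thesis
    unfolding has_field_derivative_def eq pd
    by (rule has_derivative_eq_rhs) (auto simp: fun_eq_iff sum_distrib_left sum_negf mult_ac)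
qed

definition mollify :: "real \<Rightarrow> (real^'d \<Rightarrow> real) \<Rightarrow> real ^ 'd::finite \<Rightarrow> real" where
  "mollify \<delta> u x = (\<integral>y. mollifier \<delta> x y * u y \<partial>lborel)"

lemma integrable_bounded_mult:
  fixes f g :: "'a \<Rightarrow> real"
  assumes "integrable M g" "f \<in> borel_measurable M" "\<And>x. \<bar>f x\<bar> \<le> K"
  shows "integrable M (\<lambda>x. f x * g x)"
proof (rule Bochner_Integration.integrable_bound[of _ "\<lambda>x. K * g x"])
  show "AE x in M. norm (f x * g x) \<le> norm (K * g x)"
  proof (intro AE_I2)
    fix x
    have "\<bar>f x\<bar> \<le> \<bar>K\<bar>" using assms(3)[of x] by linarith
    then show "norm (f x * g x) \<le> norm (K * g x)" by (simp add: abs_mult mult_right_mono)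
  qed
qed (use assms in \<open>auto intro: borel_measurable_integrable\<close>)

lemma integrable_mollifier_mult:
  assumes "\<delta> > 0" "integrable lborel u"
  shows "integrable lborel (\<lambda>y. mollifier \<delta> x y * u y)"
proof -
  obtain K where K: "\<And>x y::real^'a. mollifier \<delta> x y \<le> K / \<delta> ^ CARD('a)" using mollifier_le assms by blast
  show ?thesis
    by (rule integrable_bounded_mult[OF assms(2), of _ "K / \<delta> ^ CARD('a)"])
      (use K mollifier_nonneg[OF assms(1), of x] in \<open>auto simp: abs_of_nonneg\<close>)
qed

lemma borel_measurable_mollify [measurable]:
  assumes [measurable]: "u \<in> borel_measurable borel"
  shows "mollify \<delta> u \<in> borel_measurable borel"
  unfolding mollify_def by measurable

lemma continuous_partial_deriv_mollifier:
  "continuous_on UNIV (\<lambda>y::real^'d::finite. partial_deriv j (mollifier \<delta> x) y)"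
  unfolding partial_deriv_mollifier divide_inverse by (intro continuous_intros)

text \<open>All derivatives fall on the kernel. Where the kernel is a test function, the integrals
  on the right become mollified weak derivatives.\<close>

lemma mollify_line_derivative:
  fixes u :: "real^'d::finite \<Rightarrow> real"
  assumes "\<delta> > 0" and u: "integrable lborel u"
  shows "((\<lambda>t. mollify \<delta> u (x + t *\<^sub>R e)) has_real_derivative
      - (\<Sum>j\<in>UNIV. e $ j * (\<integral>y. u y * partial_deriv j (mollifier \<delta> (x + t *\<^sub>R e)) y \<partial>lborel))) (at t)"
proof -
  obtain K where K: "\<And>j. \<And>x y::real^'d. \<bar>partial_deriv j (mollifier \<delta> x) y\<bar> \<le> K"
    using partial_deriv_mollifier_bounded[OF assms(1)] by blast
  have K0: "K \<ge> 0" using K order_trans[OF abs_ge_zero] by blast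
  define S where "S = (\<Sum>j\<in>UNIV. \<bar>e $ j\<bar> * K)"
  have "((\<lambda>t. \<integral>y. mollifier \<delta> (x + t *\<^sub>R e) y * u y \<partial>lborel) has_real_derivative
     (\<integral>y. - (\<Sum>j\<in>UNIV. e $ j * partial_deriv j (mollifier \<delta> (x + t *\<^sub>R e)) y) * u y \<partial>lborel)) (at t)"
  proof (rule has_real_derivative_integral)
    show "integrable lborel (\<lambda>y. S * \<bar>u y\<bar>)" using u by auto
    fix t y
    show "((\<lambda>t. mollifier \<delta> (x + t *\<^sub>R e) y * u y) has_real_derivative
           - (\<Sum>j\<in>UNIV. e $ j * partial_deriv j (mollifier \<delta> (x + t *\<^sub>R e)) y) * u y) (at t)"
      by (rule DERIV_cmult_right[OF mollifier_line_derivative])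
    have "\<bar>\<Sum>j\<in>UNIV. e $ j * partial_deriv j (mollifier \<delta> (x + t *\<^sub>R e)) y\<bar> \<le> S"
      unfolding S_def by (rule order_trans[OF sum_abs]) (auto simp: abs_mult intro!: sum_mono mult_left_mono K)
    then show "\<bar>- (\<Sum>j\<in>UNIV. e $ j * partial_deriv j (mollifier \<delta> (x + t *\<^sub>R e)) y) * u y\<bar> \<le> S * \<bar>u y\<bar>"
      by (simp add: abs_mult mult_right_mono)
  qed (use assms integrable_mollifier_mult in auto)
  moreover have "(\<integral>y. - (\<Sum>j\<in>UNIV. e $ j * partial_deriv j (mollifier \<delta> (x + t *\<^sub>R e)) y) * u y \<partial>lborel) =
     - (\<Sum>j\<in>UNIV. e $ j * (\<integral>y. u y * partial_deriv j (mollifier \<delta> (x + t *\<^sub>R e)) y \<partial>lborel))"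
  proof -
    have i: "integrable lborel (\<lambda>y. partial_deriv j (mollifier \<delta> (x + t *\<^sub>R e)) y * u y)" for j
      by (rule integrable_bounded_mult[OF u _ K])
        (use continuous_partial_deriv_mollifier borel_measurable_continuous_onI in auto)
    have "(\<integral>y. - (\<Sum>j\<in>UNIV. e $ j * partial_deriv j (mollifier \<delta> (x + t *\<^sub>R e)) y) * u y \<partial>lborel) =
      (\<integral>y. - (\<Sum>j\<in>UNIV. e $ j * (partial_deriv j (mollifier \<delta> (x + t *\<^sub>R e)) y * u y)) \<partial>lborel)"
      by (simp add: sum_distrib_right mult.assoc)
    also have "\<dots> = - (\<Sum>j\<in>UNIV. e $ j * (\<integral>y. partial_deriv j (mollifier \<delta> (x + t *\<^sub>R e)) y * u y \<partial>lborel))"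
      using i by simp
    finally show ?thesis by (simp add: mult.commute)
  qed
  ultimately show ?thesis unfolding mollify_def by simp
qed

text \<open>Jensen's inequality: the variance of u under the probability density
  \<open>mollifier \<delta> x\<close> is nonnegative, and expanding the square gives the
  claim.\<close>

lemma mollify_square_le:
  assumes "\<delta> > 0" and u: "integrable lborel u" "integrable lborel (\<lambda>y. (u y)\<^sup>2)"
  shows "(mollify \<delta> u x)\<^sup>2 \<le> mollify \<delta> (\<lambda>y. (u y)\<^sup>2) x"
proof -
  define m where "m = mollify \<delta> u x"
  note [simp] = integrable_mollifier_mult[OF assms(1) u(1)] integrable_mollifier_mult[OF assms(1) u(2)]
    has_bochner_integral_integral_eq[OF has_bochner_integral_mollifier[OF assms(1)]]
    integrable.intros[OF has_bochner_integral_mollifier[OF assms(1)]]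
  have "0 \<le> (\<integral>y. mollifier \<delta> x y * (u y - m)\<^sup>2 \<partial>lborel)"
    by (intro integral_nonneg_AE) (simp add: mollifier_nonneg assms)
  also have "\<dots> = (\<integral>y. mollifier \<delta> x y * (u y)\<^sup>2 - 2 * m * (mollifier \<delta> x y * u y) + m\<^sup>2 * mollifier \<delta> x y \<partial>lborel)"
    by (intro Bochner_Integration.integral_cong) (auto simp: power2_eq_square algebra_simps)
  also have "\<dots> = mollify \<delta> (\<lambda>y. (u y)\<^sup>2) x - 2 * m * mollify \<delta> u x + m\<^sup>2"
    by (simp add: mollify_def)
  finally show ?thesis by (simp add: m_def power2_eq_square)
qed

lemma nn_integral_mollify_square_le:
  assumes "\<delta> > 0" and u: "integrable lborel u" "integrable lborel (\<lambda>y. (u y)\<^sup>2)"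
  shows "(\<integral>\<^sup>+x. ennreal ((mollify \<delta> u x)\<^sup>2) \<partial>lborel) \<le> (\<integral>\<^sup>+y. ennreal ((u y)\<^sup>2) \<partial>lborel)"
proof -
  have [measurable]: "u \<in> borel_measurable borel" using borel_measurable_integrable[OF u(1)] by simp
  have "(\<integral>\<^sup>+x. ennreal ((mollify \<delta> u x)\<^sup>2) \<partial>lborel) \<le> (\<integral>\<^sup>+x. (\<integral>\<^sup>+y. ennreal (mollifier \<delta> x y * (u y)\<^sup>2) \<partial>lborel) \<partial>lborel)"
  proof (intro nn_integral_mono)
    fix x
    have "(\<integral>\<^sup>+y. ennreal (mollifier \<delta> x y * (u y)\<^sup>2) \<partial>lborel) = ennreal (mollify \<delta> (\<lambda>y. (u y)\<^sup>2) x)"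
      unfolding mollify_def
      by (rule nn_integral_eq_integral[OF integrable_mollifier_mult[OF assms(1) u(2)]])
        (simp add: mollifier_nonneg assms)
    then show "ennreal ((mollify \<delta> u x)\<^sup>2) \<le> (\<integral>\<^sup>+y. ennreal (mollifier \<delta> x y * (u y)\<^sup>2) \<partial>lborel)"
      using mollify_square_le[OF assms] by (simp add: ennreal_leI)
  qed
  also have "\<dots> = (\<integral>\<^sup>+y. (\<integral>\<^sup>+x. ennreal (mollifier \<delta> x y * (u y)\<^sup>2) \<partial>lborel) \<partial>lborel)"
    by (rule lborel_pair.Fubini') measurable
  also have "\<dots> = (\<integral>\<^sup>+y. ennreal ((u y)\<^sup>2) \<partial>lborel)"
    by (intro nn_integral_cong)
      (simp add: ennreal_mult mollifier_nonneg assms nn_integral_multc nn_integral_mollifier)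
  finally show ?thesis .
qed

text \<open>The differentiation theorem is applied to |u - q| for every rational q; the union of
  these countably many exceptional sets is still null. At any other point x a rational q close to
  \<open>u x\<close> is inserted.\<close>

lemma AE_Lebesgue_point:
  fixes u :: "real^'d::finite \<Rightarrow> real"
  assumes u: "integrable lborel u"
  shows "AE x in lborel. \<forall>e>0. \<exists>d>0. \<forall>h. 0 < h \<and> h < d \<longrightarrow>
     (LINT y:cbox x (x + h *\<^sub>R One)|lborel. \<bar>u y - u x\<bar>) \<le> e * h ^ CARD('d)"
proof -
  have si: "set_integrable lborel (cbox a b) (\<lambda>y. \<bar>u y - q\<bar>)" for a b q
  proof -
    have "set_integrable lborel (cbox a b) u"
      unfolding set_integrable_def using u by (intro integrable_mult_indicator) auto
    moreover have "set_integrable lborel (cbox a b) (\<lambda>_. q)"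
      unfolding set_integrable_def by (intro borel_integrable_compact) auto
    ultimately show ?thesis by (intro set_integrable_abs set_integral_diff)
  qed
  have conv: "(LINT y:cbox a b|lborel. \<bar>u y - q\<bar>) = integral (cbox a b) (\<lambda>y. \<bar>u y - q\<bar>)"
    "(\<lambda>y. \<bar>u y - q\<bar>) integrable_on cbox a b" for a b q
    using set_borel_integral_eq_integral[OF si[of a b q]] by auto
  have "\<exists>N. negligible N \<and> (\<forall>x e. x \<notin> N \<and> 0 < e \<longrightarrow> (\<exists>d>0. \<forall>h. 0 < h \<and> h < d \<longrightarrow>
      norm (integral (cbox x (x + h *\<^sub>R One)) (\<lambda>y. \<bar>u y - q\<bar>) /\<^sub>R h ^ DIM(real^'d) - \<bar>u x - q\<bar>) < e))" for q
    by (rule integrable_ccontinuous_explicit[of "\<lambda>y. \<bar>u y - q\<bar>"]) (use conv in blast)+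
  then obtain N where N: "\<And>q. negligible (N q)" "\<And>q x e. x \<notin> N q \<Longrightarrow> 0 < e \<Longrightarrow> (\<exists>d>0. \<forall>h. 0 < h \<and> h < d \<longrightarrow>
      norm (integral (cbox x (x + h *\<^sub>R One)) (\<lambda>y. \<bar>u y - q\<bar>) /\<^sub>R h ^ DIM(real^'d) - \<bar>u x - q\<bar>) < e)"
    by metis
  have "negligible (\<Union>q\<in>\<rat>. N q)"
    by (intro negligible_countable_Union) (use N countable_rat in auto)
  then have "AE x in lebesgue. x \<notin> (\<Union>q\<in>\<rat>. N q)"
    by (intro AE_not_in) (simp add: negligible_iff_null_sets)
  then have "AE x in lborel. x \<notin> (\<Union>q\<in>\<rat>. N q)" by (simp add: AE_completion_iff)
  then show ?thesis
  proof (rule AE_mp, intro AE_I2 impI allI)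
    fix x and e :: real assume x: "x \<notin> (\<Union>q\<in>\<rat>. N q)" and e: "e > 0"
    \<comment> \<open>With q within e / 4 of \<open>u x\<close> the averages of |u y - q| are
      eventually below e / 2, and returning from q to \<open>u x\<close> adds at most e / 4.\<close>
    obtain q where q: "q \<in> \<rat>" "u x < q" "q < u x + e / 4" using Rats_dense_in_real[of "u x" "u x + e/4"] e by auto
    have "e / 4 > 0" using e by simp
    with N(2)[of x q "e / 4"] x q(1) obtain d where d: "d > 0" "\<And>h. 0 < h \<Longrightarrow> h < d \<Longrightarrow>
      norm (integral (cbox x (x + h *\<^sub>R One)) (\<lambda>y. \<bar>u y - q\<bar>) /\<^sub>R h ^ DIM(real^'d) - \<bar>u x - q\<bar>) < e / 4" by blast
    show "\<exists>d>0. \<forall>h. 0 < h \<and> h < d \<longrightarrow>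
     (LINT y:cbox x (x + h *\<^sub>R One)|lborel. \<bar>u y - u x\<bar>) \<le> e * h ^ CARD('d)"
    proof (intro exI[of _ d] conjI allI impI d(1))
      fix h assume h: "0 < h \<and> h < d"
      define Q where "Q = cbox x (x + h *\<^sub>R (One::real^'d))"
      have vol: "measure lborel Q = h ^ CARD('d)"
        unfolding Q_def using h by (subst content_cbox_cart) (auto simp: interval_ne_empty_cart(1))
      have sc: "set_integrable lborel Q (\<lambda>_. c :: real)" for c
        unfolding Q_def set_integrable_def by (intro borel_integrable_compact) auto
      have "(LINT y:Q|lborel. \<bar>u y - q\<bar>) / h ^ CARD('d) < e / 4 + \<bar>u x - q\<bar>"
      proof -
        define I where "I = integral (cbox x (x + h *\<^sub>R One)) (\<lambda>y. \<bar>u y - q\<bar>)"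
        have "norm (I /\<^sub>R h ^ DIM(real^'d) - \<bar>u x - q\<bar>) < e / 4"
          unfolding I_def using h by (intro d(2)) auto
        then have "\<bar>I / h ^ CARD('d) - \<bar>u x - q\<bar>\<bar> < e / 4"
          using h by (simp add: field_simps)
        moreover have "(LINT y:Q|lborel. \<bar>u y - q\<bar>) = I" unfolding I_def Q_def by (rule conv(1))
        ultimately have "\<bar>(LINT y:Q|lborel. \<bar>u y - q\<bar>) / h ^ CARD('d) - \<bar>u x - q\<bar>\<bar> < e / 4" by simp
        from abs_le_D1[OF less_imp_le[OF this]] abs_less_iff[THEN iffD1, OF this] show ?thesis by argo
      qed
      also have "\<dots> \<le> e / 2" using q by simp
      finally have a: "(LINT y:Q|lborel. \<bar>u y - q\<bar>) \<le> e / 2 * h ^ CARD('d)" using h by (simp add: field_simps)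
      have "(LINT y:Q|lborel. \<bar>u y - u x\<bar>) \<le> (LINT y:Q|lborel. \<bar>u y - q\<bar> + e / 4)"
        by (rule set_integral_mono)
          (use q si[folded Q_def] in \<open>auto simp: Q_def sc[unfolded Q_def] si intro!: set_integral_add\<close>)
      also have "\<dots> = (LINT y:Q|lborel. \<bar>u y - q\<bar>) + (LINT y:Q|lborel. e / 4)"
        by (intro set_integral_add sc) (simp add: Q_def si)
      also have "(LINT y:Q|lborel. e / 4) = e / 4 * h ^ CARD('d)"
        unfolding set_lebesgue_integral_def using vol by (simp add: Q_def emeasure_lborel_cbox_eq mult.commute)
      finally show "(LINT y:cbox x (x + h *\<^sub>R One)|lborel. \<bar>u y - u x\<bar>) \<le> e * h ^ CARD('d)"
        unfolding Q_def[symmetric] using a mult_pos_pos[OF e, of "h ^ CARD('d)"] h by simp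
    qed
  qed
qed

text \<open>The kernel is at most K / h^d on a cube of volume h^d, so the error at x is at most K
  times the average of |u - u x| over that cube, which tends to 0 at Lebesgue points.\<close>

lemma AE_mollify_tendsto:
  fixes u :: "real^'d::finite \<Rightarrow> real"
  assumes u: "integrable lborel u" and \<delta>: "\<And>n. \<delta> n > 0" "\<delta> \<longlonglongrightarrow> 0"
  shows "AE x in lborel. (\<lambda>n. mollify (\<delta> n) u x) \<longlonglongrightarrow> u x"
  using AE_Lebesgue_point[OF u]
proof (rule AE_mp, intro AE_I2 impI)
  fix x assume L: "\<forall>e>0. \<exists>d>0. \<forall>h. 0 < h \<and> h < d \<longrightarrow>
     (LINT y:cbox x (x + h *\<^sub>R One)|lborel. \<bar>u y - u x\<bar>) \<le> e * h ^ CARD('d)"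
  obtain K where K: "K \<ge> 0" "\<And>\<delta> x y. \<delta> > 0 \<Longrightarrow> mollifier \<delta> x (y::real^'d) \<le> K / \<delta> ^ CARD('d)"
    using mollifier_le by blast
  have bound: "\<bar>mollify h u x - u x\<bar> \<le> K / h ^ CARD('d) * (LINT y:cbox x (x + h *\<^sub>R One)|lborel. \<bar>u y - u x\<bar>)"
    if h: "h > 0" for h
  proof -
    have i: "integrable lborel (\<lambda>y. mollifier h x y * (u y - u x))"
      using integrable_mollifier_mult[OF h u, of x] integrable.intros[OF has_bochner_integral_mollifier[OF h, of x]]
      by (simp add: right_diff_distrib)
    have "mollify h u x - u x = (\<integral>y. mollifier h x y * (u y - u x) \<partial>lborel)"
      using integrable_mollifier_mult[OF h u, of x] integrable.intros[OF has_bochner_integral_mollifier[OF h, of x]]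
        has_bochner_integral_integral_eq[OF has_bochner_integral_mollifier[OF h, of x]]
      by (simp add: right_diff_distrib mollify_def)
    then have "\<bar>mollify h u x - u x\<bar> \<le> (\<integral>y. \<bar>mollifier h x y * (u y - u x)\<bar> \<partial>lborel)"
      by simp
    also have "\<dots> \<le> (\<integral>y. K / h ^ CARD('d) * (indicator (cbox x (x + h *\<^sub>R One)) y *\<^sub>R \<bar>u y - u x\<bar>) \<partial>lborel)"
    proof (rule integral_mono)
      have "set_integrable lborel (cbox x (x + h *\<^sub>R One)) u"
        unfolding set_integrable_def using u by (intro integrable_mult_indicator) auto
      moreover have "set_integrable lborel (cbox x (x + h *\<^sub>R One)) (\<lambda>_. u x)"
        unfolding set_integrable_def by (intro borel_integrable_compact) auto
      ultimately have "set_integrable lborel (cbox x (x + h *\<^sub>R One)) (\<lambda>y. \<bar>u y - u x\<bar>)"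
        by (intro set_integrable_abs set_integral_diff)
      then show "integrable lborel (\<lambda>y. K / h ^ CARD('d) * (indicator (cbox x (x + h *\<^sub>R One)) y *\<^sub>R \<bar>u y - u x\<bar>))"
        unfolding set_integrable_def by simp
      fix y
      show "\<bar>mollifier h x y * (u y - u x)\<bar> \<le> K / h ^ CARD('d) * (indicator (cbox x (x + h *\<^sub>R One)) y *\<^sub>R \<bar>u y - u x\<bar>)"
      proof (cases "mollifier h x y = 0")
        case True then show ?thesis using K h by (simp)
      next
        case False
        then have "y \<in> cbox x (x + h *\<^sub>R One)"
          using mollifier_neq_0[OF _ h, of x y] by (auto simp: mem_box_cart intro: less_imp_le)
        then show ?thesis using mult_right_mono[OF K(2)[OF h, of x y], of "\<bar>u y - u x\<bar>"] mollifier_nonneg[OF h, of x y]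
          by (simp add: abs_mult)
      qed
    qed (use i in auto)
    finally show ?thesis by (simp add: set_lebesgue_integral_def)
  qed
  show "(\<lambda>n. mollify (\<delta> n) u x) \<longlonglongrightarrow> u x"
  proof (rule LIMSEQ_I)
    fix r :: real assume r: "r > 0"
    \<comment> \<open>K may be 0, hence K + 1 in the denominator; what matters is
      \<open>K * e < r\<close>.\<close>
    define e where "e = r / (2 * (K + 1))"
    have e: "e > 0" "K * e < r" using r K(1) by (auto simp: e_def field_simps add_nonneg_pos)
    with L obtain d where d: "d > 0" "\<And>h. 0 < h \<Longrightarrow> h < d \<Longrightarrow>
      (LINT y:cbox x (x + h *\<^sub>R One)|lborel. \<bar>u y - u x\<bar>) \<le> e * h ^ CARD('d)" by blast
    obtain n0 where n0: "\<And>n. n \<ge> n0 \<Longrightarrow> \<bar>\<delta> n\<bar> < d" using LIMSEQ_D[OF \<delta>(2) d(1)] by auto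
    show "\<exists>no. \<forall>n\<ge>no. norm (mollify (\<delta> n) u x - u x) < r"
    proof (intro exI allI impI)
      fix n assume "n \<ge> n0"
      then have "\<delta> n < d" using n0[of n] by auto
      then have "\<bar>mollify (\<delta> n) u x - u x\<bar> \<le> K / \<delta> n ^ CARD('d) * (e * \<delta> n ^ CARD('d))"
        by (intro order_trans[OF bound[OF \<delta>(1)]] mult_left_mono d(2))
          (use \<delta>(1)[of n] K(1) in auto)
      also have "\<dots> = K * e" using \<delta>(1)[of n] by simp
      finally show "norm (mollify (\<delta> n) u x - u x) < r" using e by simp
    qed
  qed
qed

subsection \<open>Increments over star-shaped sets\<close>

text \<open>At these base points the mollifier is a test function of T, so weak derivatives on T may
  be tested with it.\<close>

definition cube_erosion :: "real \<Rightarrow> (real^'d::finite) set \<Rightarrow> (real^'d) set" where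
  "cube_erosion \<delta> T = {x. cbox x (x + \<delta> *\<^sub>R One) \<subseteq> T}"

lemma cbox_cube_translate: "cbox x (x + \<delta> *\<^sub>R One) = (+) x ` cbox 0 (\<delta> *\<^sub>R (One::real^'d::finite))"
  using cbox_translation[of x 0 "\<delta> *\<^sub>R One"] by simp

text \<open>The complement consists of the differences of the closed set - T and a compact cube,
  hence is closed.\<close>

lemma open_cube_erosion:
  assumes "open T" shows "open (cube_erosion \<delta> T)"
proof -
  have "- cube_erosion \<delta> T = (\<Union>w\<in>-T. \<Union>z\<in>cbox 0 (\<delta> *\<^sub>R One). {w - z})"
    by (auto simp: cube_erosion_def cbox_cube_translate algebra_simps subset_iff)
  moreover have "closed \<dots>" using assms by (intro closed_compact_differences) auto
  ultimately show ?thesis by (simp add: open_closed)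
qed

lemma cube_erosion_subset: "\<delta> > 0 \<Longrightarrow> cube_erosion \<delta> T \<subseteq> T"
  by (auto simp: cube_erosion_def mem_box_cart subset_iff)

lemma eventually_cube_erosion:
  fixes x :: "real^'d::finite"
  assumes "open T" "x \<in> T" "\<delta> \<longlonglongrightarrow> 0"
  shows "\<forall>\<^sub>F n in sequentially. x \<in> cube_erosion (\<delta> n) T"
proof -
  obtain e where e: "e > 0" "ball x e \<subseteq> T" using assms openE by blast
  have "(\<lambda>n. real CARD('d) * \<bar>\<delta> n\<bar>) \<longlonglongrightarrow> real CARD('d) * \<bar>0\<bar>"
    by (intro tendsto_intros assms)
  from order_tendstoD(2)[OF this, of e]
  have "\<forall>\<^sub>F n in sequentially. real CARD('d) * \<bar>\<delta> n\<bar> < e" using e(1) by simp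
  then show ?thesis
  proof eventually_elim
    case (elim n)
    have "y \<in> ball x e" if "y \<in> cbox x (x + \<delta> n *\<^sub>R One)" for y
    proof -
      have "norm (x - y) \<le> (\<Sum>i\<in>UNIV. \<bar>(x - y) $ i\<bar>)" by (rule norm_le_l1_cart)
      also have "\<dots> \<le> (\<Sum>i\<in>(UNIV::'d set). \<bar>\<delta> n\<bar>)"
      proof (intro sum_mono)
        fix i
        have "x $ i \<le> y $ i \<and> y $ i \<le> x $ i + \<delta> n" using that by (simp add: mem_box_cart)
        then show "\<bar>(x - y) $ i\<bar> \<le> \<bar>\<delta> n\<bar>" by simp
      qed
      finally show ?thesis using elim by (simp add: dist_norm)
    qed
    then show ?case using e(2) by (auto simp: cube_erosion_def)
  qed
qed

text \<open>For each z in the cube, \<open>x + z\<close> lies in T and \<open>y + z\<close> in B;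
  the hypothesis is applied to every such translated segment. B has to be eroded together with T for
  this reason.\<close>

lemma cube_erosion_star:
  assumes star: "\<And>x y. x \<in> T \<Longrightarrow> y \<in> B \<Longrightarrow> closed_segment x y \<subseteq> T"
    and x: "x \<in> cube_erosion \<delta> T" and y: "y \<in> cube_erosion \<delta> B" and t: "0 \<le> t" "t \<le> 1"
  shows "x + t *\<^sub>R (y - x) \<in> cube_erosion \<delta> T"
  unfolding cube_erosion_def mem_Collect_eq cbox_cube_translate
proof (intro subsetI, elim imageE)
  fix w z assume w: "w = x + t *\<^sub>R (y - x) + z" and z: "z \<in> cbox 0 (\<delta> *\<^sub>R One)"
  have "x + z \<in> T" "y + z \<in> B" using x y z by (auto simp: cube_erosion_def cbox_cube_translate)
  then have "closed_segment (x + z) (y + z) \<subseteq> T" by (rule star)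
  moreover have "w \<in> closed_segment (x + z) (y + z)"
    using t w by (auto simp: in_segment algebra_simps intro!: exI[of _ t])
  ultimately show "w \<in> T" by blast
qed

text \<open>Cauchy-Schwarz on the unit interval, again as a nonnegative variance: by the fundamental
  theorem of calculus the increment m is the mean of f. The bound is an extended nonnegative
  integral because Tonelli's theorem is applied next.\<close>

lemma square_increment_le_integral:
  fixes F f :: "real \<Rightarrow> real"
  assumes "\<And>t. 0 \<le> t \<Longrightarrow> t \<le> 1 \<Longrightarrow> (F has_real_derivative f t) (at t)" and f: "\<And>t. isCont f t"
  shows "ennreal ((F 1 - F 0)\<^sup>2) \<le> (\<integral>\<^sup>+t. ennreal ((f t)\<^sup>2) * indicator {0..1} t \<partial>lborel)"
proof -
  define m where "m = F 1 - F 0"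
  have m: "(\<integral>t. f t * indicator {0..1} t \<partial>lborel) = m"
    unfolding m_def by (rule integral_FTC_Icc_real) (use assms in auto)
  have c: "continuous_on A f" for A using f continuous_at_imp_continuous_on by blast
  have i: "integrable lborel (\<lambda>t. f t * indicator {0..1} t)" "integrable lborel (\<lambda>t. (f t)\<^sup>2 * indicator {0..1} t)"
    using borel_integrable_atLeastAtMost'[of 0 1 f] borel_integrable_atLeastAtMost'[of 0 1 "\<lambda>t. (f t)\<^sup>2"] c
    by (auto simp: set_integrable_def mult.commute intro!: continuous_intros)
  have i1: "integrable lborel (\<lambda>t::real. indicator {0..1} t :: real)" by simp
  have one: "(\<integral>t. indicator {0..1} (t::real) \<partial>lborel) = (1::real)" by simp
  have "0 \<le> (\<integral>t. (f t - m)\<^sup>2 * indicator {0..1} t \<partial>lborel)"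
    by (intro integral_nonneg_AE) auto
  also have "\<dots> = (\<integral>t. (f t)\<^sup>2 * indicator {0..1} t - 2 * m * (f t * indicator {0..1} t) + m\<^sup>2 * indicator {0..1} t \<partial>lborel)"
    by (intro Bochner_Integration.integral_cong) (auto simp: power2_eq_square algebra_simps)
  also have "\<dots> = (\<integral>t. (f t)\<^sup>2 * indicator {0..1} t \<partial>lborel) - 2 * m * m + m\<^sup>2 * 1"
    using i i1 by (simp add: m)
  finally have "m\<^sup>2 \<le> (\<integral>t. (f t)\<^sup>2 * indicator {0..1} t \<partial>lborel)" by (simp add: power2_eq_square)
  then have "ennreal (m\<^sup>2) \<le> ennreal (\<integral>t. (f t)\<^sup>2 * indicator {0..1} t \<partial>lborel)" by (rule ennreal_leI)
  also have "\<dots> = (\<integral>\<^sup>+t. ennreal ((f t)\<^sup>2 * indicator {0..1} t) \<partial>lborel)"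
    by (rule nn_integral_eq_integral[symmetric]) (use i in auto)
  also have "\<dots> = (\<integral>\<^sup>+t. ennreal ((f t)\<^sup>2) * indicator {0..1} t \<partial>lborel)"
    by (intro nn_integral_cong) (auto simp: indicator_def)
  finally show ?thesis unfolding m_def .
qed

text \<open>The Jacobian factor is c^-d, which is at most 2^d. This is where splitting each segment
  at its midpoint pays off.\<close>

lemma nn_integral_lborel_affine_le:
  fixes t :: "'a::euclidean_space" and f :: "'a \<Rightarrow> ennreal"
  assumes f: "f \<in> borel_measurable borel" and c: "c \<ge> 1 / 2"
  shows "(\<integral>\<^sup>+x. f (t + c *\<^sub>R x) \<partial>lborel) \<le> 2 ^ DIM('a) * (\<integral>\<^sup>+x. f x \<partial>lborel)"
proof -
  have "(\<integral>\<^sup>+x. f (t + c *\<^sub>R x) \<partial>lborel) = 1 * (\<integral>\<^sup>+x. f (t + c *\<^sub>R x) \<partial>lborel)" by simp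
  also have "1 \<le> ennreal (2 ^ DIM('a) * \<bar>c\<bar> ^ DIM('a))"
  proof -
    have "(1::real) \<le> (2 * \<bar>c\<bar>) ^ DIM('a)" using c by (intro one_le_power) auto
    then show ?thesis by (simp add: power_mult_distrib)
  qed
  also have "ennreal (2 ^ DIM('a) * \<bar>c\<bar> ^ DIM('a)) = 2 ^ DIM('a) * ennreal (\<bar>c\<bar> ^ DIM('a))"
    by (simp add: ennreal_mult flip: ennreal_power)
  finally show ?thesis using c
    by (subst nn_integral_lborel_affine[OF f, of c t]) (auto simp: mult.assoc mult_right_mono)
qed

text \<open>Substituting in x leaves a free integral over B, substituting in y leaves one over T.
  The sum of the two measures covers both halves of the segment.\<close>

lemma nn_integral_segments_le:
  fixes G :: "real^'d::finite \<Rightarrow> ennreal"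
  assumes [measurable]: "G \<in> borel_measurable borel" "T \<in> sets borel" "B \<in> sets borel"
  shows "(\<integral>\<^sup>+x. \<integral>\<^sup>+y. indicator T x * indicator B y *
      (\<integral>\<^sup>+t. G (x + t *\<^sub>R (y - x)) * indicator {0..1::real} t \<partial>lborel) \<partial>lborel \<partial>lborel)
    \<le> 2 ^ CARD('d) * (emeasure lborel B + emeasure lborel T) * (\<integral>\<^sup>+z. G z \<partial>lborel)"
proof -
  define \<Phi> where "\<Phi> = (\<lambda>t::real. \<integral>\<^sup>+x. \<integral>\<^sup>+y. indicator T x * indicator B y * G (x + t *\<^sub>R (y - x)) \<partial>lborel \<partial>lborel)"
  define K where "K = 2 ^ CARD('d) * (emeasure lborel B + emeasure lborel T) * (\<integral>\<^sup>+z. G z \<partial>lborel)"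
  have \<Phi>: "\<Phi> t \<le> K" if t: "0 \<le> t" "t \<le> 1" for t
  proof (cases "t \<le> 1 / 2")
    case True
    have "\<Phi> t = (\<integral>\<^sup>+y. \<integral>\<^sup>+x. indicator T x * indicator B y * G (x + t *\<^sub>R (y - x)) \<partial>lborel \<partial>lborel)"
      unfolding \<Phi>_def by (rule lborel_pair.Fubini') measurable
    also have "\<dots> \<le> (\<integral>\<^sup>+y. indicator B y * (2 ^ CARD('d) * (\<integral>\<^sup>+z. G z \<partial>lborel)) \<partial>lborel)"
    proof (intro nn_integral_mono)
      fix y
      have "(\<integral>\<^sup>+x. indicator T x * indicator B y * G (x + t *\<^sub>R (y - x)) \<partial>lborel) \<le>
         (\<integral>\<^sup>+x. indicator B y * G (t *\<^sub>R y + (1 - t) *\<^sub>R x) \<partial>lborel)"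
        by (intro nn_integral_mono) (auto simp: indicator_def algebra_simps)
      also have "\<dots> = indicator B y * (\<integral>\<^sup>+x. G (t *\<^sub>R y + (1 - t) *\<^sub>R x) \<partial>lborel)"
        by (rule nn_integral_cmult) measurable
      also have "\<dots> \<le> indicator B y * (2 ^ DIM(real^'d) * (\<integral>\<^sup>+z. G z \<partial>lborel))"
        by (intro mult_left_mono nn_integral_lborel_affine_le) (use True in auto)
      finally show "(\<integral>\<^sup>+x. indicator T x * indicator B y * G (x + t *\<^sub>R (y - x)) \<partial>lborel) \<le>
        indicator B y * (2 ^ CARD('d) * (\<integral>\<^sup>+z. G z \<partial>lborel))" by simp
    qed
    also have "\<dots> = 2 ^ CARD('d) * emeasure lborel B * (\<integral>\<^sup>+z. G z \<partial>lborel)"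
      by (subst nn_integral_multc) (auto simp: mult_ac)
    also have "\<dots> \<le> K" unfolding K_def by (intro mult_mono) auto
    finally show ?thesis .
  next
    case False
    have "\<Phi> t \<le> (\<integral>\<^sup>+x. indicator T x * (2 ^ CARD('d) * (\<integral>\<^sup>+z. G z \<partial>lborel)) \<partial>lborel)"
      unfolding \<Phi>_def
    proof (intro nn_integral_mono)
      fix x
      have "(\<integral>\<^sup>+y. indicator T x * indicator B y * G (x + t *\<^sub>R (y - x)) \<partial>lborel) \<le>
         (\<integral>\<^sup>+y. indicator T x * G ((1 - t) *\<^sub>R x + t *\<^sub>R y) \<partial>lborel)"
        by (intro nn_integral_mono) (auto simp: indicator_def algebra_simps)
      also have "\<dots> = indicator T x * (\<integral>\<^sup>+y. G ((1 - t) *\<^sub>R x + t *\<^sub>R y) \<partial>lborel)"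
        by (rule nn_integral_cmult) measurable
      also have "\<dots> \<le> indicator T x * (2 ^ DIM(real^'d) * (\<integral>\<^sup>+z. G z \<partial>lborel))"
        by (intro mult_left_mono nn_integral_lborel_affine_le) (use False in auto)
      finally show "(\<integral>\<^sup>+y. indicator T x * indicator B y * G (x + t *\<^sub>R (y - x)) \<partial>lborel) \<le>
        indicator T x * (2 ^ CARD('d) * (\<integral>\<^sup>+z. G z \<partial>lborel))" by simp
    qed
    also have "\<dots> = 2 ^ CARD('d) * emeasure lborel T * (\<integral>\<^sup>+z. G z \<partial>lborel)"
      by (subst nn_integral_multc) (auto simp: mult_ac)
    also have "\<dots> \<le> K" unfolding K_def by (intro mult_mono) auto
    finally show ?thesis .
  qed
  have "(\<integral>\<^sup>+x. \<integral>\<^sup>+y. indicator T x * indicator B y *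
      (\<integral>\<^sup>+t. G (x + t *\<^sub>R (y - x)) * indicator {0..1::real} t \<partial>lborel) \<partial>lborel \<partial>lborel) =
    (\<integral>\<^sup>+x. \<integral>\<^sup>+y. \<integral>\<^sup>+t. indicator T x * indicator B y * G (x + t *\<^sub>R (y - x)) * indicator {0..1::real} t \<partial>lborel \<partial>lborel \<partial>lborel)"
    by (intro nn_integral_cong) (subst nn_integral_cmult[symmetric], auto simp: mult_ac)
  also have "\<dots> = (\<integral>\<^sup>+x. \<integral>\<^sup>+t. \<integral>\<^sup>+y. indicator T x * indicator B y * G (x + t *\<^sub>R (y - x)) * indicator {0..1::real} t \<partial>lborel \<partial>lborel \<partial>lborel)"
    by (intro nn_integral_cong lborel_pair.Fubini') measurable
  also have "\<dots> = (\<integral>\<^sup>+t. \<integral>\<^sup>+x. \<integral>\<^sup>+y. indicator T x * indicator B y * G (x + t *\<^sub>R (y - x)) * indicator {0..1::real} t \<partial>lborel \<partial>lborel \<partial>lborel)"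
    by (rule lborel_pair.Fubini') measurable
  also have "\<dots> = (\<integral>\<^sup>+t. \<Phi> t * indicator {0..1::real} t \<partial>lborel)"
    unfolding \<Phi>_def by (intro nn_integral_cong) (simp add: nn_integral_multc)
  also have "\<dots> \<le> (\<integral>\<^sup>+t. K * indicator {0..1::real} t \<partial>lborel)"
    by (intro nn_integral_mono) (auto simp: indicator_def \<Phi>)
  also have "\<dots> = K" by (simp add: nn_integral_cmult_indicator)
  finally show ?thesis unfolding K_def .
qed


lemma sum_mult_square_le:
  fixes e :: "real^'d::finite"
  shows "(\<Sum>j\<in>UNIV. e $ j * b j)\<^sup>2 \<le> (norm e)\<^sup>2 * (\<Sum>j\<in>UNIV. (b j)\<^sup>2)"
proof -
  have "(e \<bullet> (\<chi> j. b j))\<^sup>2 \<le> (e \<bullet> e) * ((\<chi> j. b j) \<bullet> (\<chi> j. b j))" by (rule Cauchy_Schwarz_ineq)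
  then show ?thesis by (simp add: inner_vec_def power2_norm_eq_inner power2_eq_square[of "b _"])
qed

text \<open>Along a segment inside the eroded set the derivative of the mollified u is a combination
  of the mollified \<open>g j\<close>, by \<open>weak\<close>. The right-hand side contains the
  norms of \<open>g j\<close> themselves and no \<delta>, since mollification does not increase
  them; this allows \<delta> to tend to 0.\<close>

lemma mollified_increments_le:
  fixes u :: "real^'d::finite \<Rightarrow> real"
  assumes T: "open T" and B: "open B" and \<delta>: "\<delta> > 0"
    and star: "\<And>x y. x \<in> T \<Longrightarrow> y \<in> B \<Longrightarrow> closed_segment x y \<subseteq> T"
    and h: "\<And>x y. x \<in> T \<Longrightarrow> y \<in> B \<Longrightarrow> norm (y - x) \<le> h"
    and u: "integrable lborel u" and g: "\<And>j. integrable lborel (g j)" "\<And>j. integrable lborel (\<lambda>y. (g j y)\<^sup>2)"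
    and weak: "\<And>x j. cbox x (x + \<delta> *\<^sub>R One) \<subseteq> T \<Longrightarrow>
      (\<integral>y. u y * partial_deriv j (mollifier \<delta> x) y \<partial>lborel) = - mollify \<delta> (g j) x"
  shows "(\<integral>\<^sup>+x. \<integral>\<^sup>+y. indicator (cube_erosion \<delta> T) x * indicator (cube_erosion \<delta> B) y *
      ennreal ((mollify \<delta> u x - mollify \<delta> u y)\<^sup>2) \<partial>lborel \<partial>lborel)
    \<le> ennreal (h\<^sup>2) * (2 ^ CARD('d) * (emeasure lborel B + emeasure lborel T) *
        (\<Sum>j\<in>UNIV. \<integral>\<^sup>+y. ennreal ((g j y)\<^sup>2) \<partial>lborel))"
proof -
  define T' B' where "T' = cube_erosion \<delta> T" and "B' = cube_erosion \<delta> B"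
  have [measurable]: "T' \<in> sets borel" "B' \<in> sets borel" "u \<in> borel_measurable borel" "\<And>j. g j \<in> borel_measurable borel"
    using borel_open[OF open_cube_erosion[OF T]] borel_open[OF open_cube_erosion[OF B]] borel_measurable_integrable[OF u] borel_measurable_integrable[OF g(1)]
    by (auto simp: T'_def B'_def)
  have sub: "T' \<subseteq> T" "B' \<subseteq> B" using cube_erosion_subset[OF \<delta>] by (auto simp: T'_def B'_def)
  \<comment> \<open>G is cut off to T', the set where the mollified \<open>g j\<close> are known to
    be the derivatives of the mollified u. A segment from T' to B' stays in T', so the cut-off loses
    nothing along it.\<close>
  define G where "G = (\<lambda>z. indicator T' z * ennreal (\<Sum>j\<in>UNIV. (mollify \<delta> (g j) z)\<^sup>2))"
  have [measurable]: "G \<in> borel_measurable borel" unfolding G_def by measurable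
  have incr: "ennreal ((mollify \<delta> u x - mollify \<delta> u y)\<^sup>2) \<le>
      ennreal (h\<^sup>2) * (\<integral>\<^sup>+t. G (x + t *\<^sub>R (y - x)) * indicator {0..1::real} t \<partial>lborel)"
    if x: "x \<in> T'" and y: "y \<in> B'" for x y
  proof -
    define e where "e = y - x"
    define f where "f = (\<lambda>t. \<Sum>j\<in>UNIV. e $ j * mollify \<delta> (g j) (x + t *\<^sub>R e))"
    have seg: "x + t *\<^sub>R e \<in> T'" if "0 \<le> t" "t \<le> 1" for t
      unfolding T'_def e_def by (rule cube_erosion_star[OF star]) (use x y that in \<open>auto simp: T'_def B'_def\<close>)
    have "((\<lambda>t. mollify \<delta> u (x + t *\<^sub>R e)) has_real_derivative f t) (at t)" if "0 \<le> t" "t \<le> 1" for t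
    proof -
      have "cbox (x + t *\<^sub>R e) ((x + t *\<^sub>R e) + \<delta> *\<^sub>R One) \<subseteq> T" using seg[OF that] by (simp add: T'_def cube_erosion_def)
      from weak[OF this] mollify_line_derivative[OF \<delta> u, of x e t] show ?thesis
        by (simp add: f_def sum_negf)
    qed
    moreover have "isCont f t" for t
      unfolding f_def by (intro continuous_intros DERIV_isCont[OF mollify_line_derivative[OF \<delta> g(1)]])
    ultimately have "ennreal ((mollify \<delta> u (x + 1 *\<^sub>R e) - mollify \<delta> u (x + 0 *\<^sub>R e))\<^sup>2) \<le>
      (\<integral>\<^sup>+t. ennreal ((f t)\<^sup>2) * indicator {0..1} t \<partial>lborel)"
      by (rule square_increment_le_integral)
    also have "\<dots> \<le> (\<integral>\<^sup>+t. ennreal (h\<^sup>2) * (G (x + t *\<^sub>R e) * indicator {0..1} t) \<partial>lborel)"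
    proof (intro nn_integral_mono)
      fix t :: real
      show "ennreal ((f t)\<^sup>2) * indicator {0..1} t \<le> ennreal (h\<^sup>2) * (G (x + t *\<^sub>R e) * indicator {0..1} t)"
      proof (cases "t \<in> {0..1}")
        case True
        have "(f t)\<^sup>2 \<le> (norm e)\<^sup>2 * (\<Sum>j\<in>UNIV. (mollify \<delta> (g j) (x + t *\<^sub>R e))\<^sup>2)"
          unfolding f_def by (rule sum_mult_square_le)
        also have "\<dots> \<le> h\<^sup>2 * (\<Sum>j\<in>UNIV. (mollify \<delta> (g j) (x + t *\<^sub>R e))\<^sup>2)"
          using h[of x y] x y sub by (intro mult_right_mono power_mono sum_nonneg) (auto simp: e_def)
        finally have "ennreal ((f t)\<^sup>2) \<le> ennreal (h\<^sup>2) * ennreal (\<Sum>j\<in>UNIV. (mollify \<delta> (g j) (x + t *\<^sub>R e))\<^sup>2)"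
          by (subst ennreal_mult[symmetric]) (auto intro!: ennreal_leI sum_nonneg)
        then show ?thesis using True seg[of t] by (simp add: G_def)
      qed simp
    qed
    also have "\<dots> = ennreal (h\<^sup>2) * (\<integral>\<^sup>+t. G (x + t *\<^sub>R e) * indicator {0..1} t \<partial>lborel)"
      by (rule nn_integral_cmult) measurable
    finally show ?thesis by (simp add: e_def power2_commute)
  qed
  have "(\<integral>\<^sup>+x. \<integral>\<^sup>+y. indicator T' x * indicator B' y *
      ennreal ((mollify \<delta> u x - mollify \<delta> u y)\<^sup>2) \<partial>lborel \<partial>lborel) \<le>
    (\<integral>\<^sup>+x. \<integral>\<^sup>+y. ennreal (h\<^sup>2) * (indicator T' x * indicator B' y *
      (\<integral>\<^sup>+t. G (x + t *\<^sub>R (y - x)) * indicator {0..1::real} t \<partial>lborel)) \<partial>lborel \<partial>lborel)"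
  proof (intro nn_integral_mono)
    fix x y
    show "indicator T' x * indicator B' y * ennreal ((mollify \<delta> u x - mollify \<delta> u y)\<^sup>2) \<le>
      ennreal (h\<^sup>2) * (indicator T' x * indicator B' y *
      (\<integral>\<^sup>+t. G (x + t *\<^sub>R (y - x)) * indicator {0..1::real} t \<partial>lborel))"
      by (cases "x \<in> T' \<and> y \<in> B'") (use incr in auto)
  qed
  also have "\<dots> = ennreal (h\<^sup>2) * (\<integral>\<^sup>+x. \<integral>\<^sup>+y. indicator T' x * indicator B' y *
      (\<integral>\<^sup>+t. G (x + t *\<^sub>R (y - x)) * indicator {0..1::real} t \<partial>lborel) \<partial>lborel \<partial>lborel)"
    by (simp add: nn_integral_cmult)
  also have "\<dots> \<le> ennreal (h\<^sup>2) * (2 ^ CARD('d) * (emeasure lborel B' + emeasure lborel T') * (\<integral>\<^sup>+z. G z \<partial>lborel))"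
    by (intro mult_left_mono nn_integral_segments_le) auto
  also have "\<dots> \<le> ennreal (h\<^sup>2) * (2 ^ CARD('d) * (emeasure lborel B + emeasure lborel T) *
        (\<Sum>j\<in>UNIV. \<integral>\<^sup>+y. ennreal ((g j y)\<^sup>2) \<partial>lborel))"
  proof (intro mult_left_mono mult_mono add_mono emeasure_mono sub)
    have "(\<integral>\<^sup>+z. G z \<partial>lborel) \<le> (\<integral>\<^sup>+z. (\<Sum>j\<in>UNIV. ennreal ((mollify \<delta> (g j) z)\<^sup>2)) \<partial>lborel)"
      by (intro nn_integral_mono) (auto simp: G_def indicator_def)
    also have "\<dots> = (\<Sum>j\<in>UNIV. \<integral>\<^sup>+z. ennreal ((mollify \<delta> (g j) z)\<^sup>2) \<partial>lborel)"
      by (rule nn_integral_sum) simp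
    also have "\<dots> \<le> (\<Sum>j\<in>UNIV. \<integral>\<^sup>+y. ennreal ((g j y)\<^sup>2) \<partial>lborel)"
      by (intro sum_mono nn_integral_mollify_square_le \<delta> g)
    finally show "(\<integral>\<^sup>+z. G z \<partial>lborel) \<le> (\<Sum>j\<in>UNIV. \<integral>\<^sup>+y. ennreal ((g j y)\<^sup>2) \<partial>lborel)" .
  qed (use T B in auto)
  finally show ?thesis unfolding T'_def B'_def .
qed

text \<open>Fatou's lemma, once for each variable. The mollified values converge almost everywhere,
  and the eroded indicators converge because every point of an open set eventually belongs to its
  erosion.\<close>

lemma increments_le:
  fixes u :: "real^'d::finite \<Rightarrow> real"
  assumes T: "open T" and B: "open B"
    and star: "\<And>x y. x \<in> T \<Longrightarrow> y \<in> B \<Longrightarrow> closed_segment x y \<subseteq> T"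
    and h: "\<And>x y. x \<in> T \<Longrightarrow> y \<in> B \<Longrightarrow> norm (y - x) \<le> h"
    and u: "integrable lborel u" and g: "\<And>j. integrable lborel (g j)" "\<And>j. integrable lborel (\<lambda>y. (g j y)\<^sup>2)"
    and weak: "\<And>\<delta> x j. \<delta> > 0 \<Longrightarrow> cbox x (x + \<delta> *\<^sub>R One) \<subseteq> T \<Longrightarrow>
      (\<integral>y. u y * partial_deriv j (mollifier \<delta> x) y \<partial>lborel) = - mollify \<delta> (g j) x"
  shows "(\<integral>\<^sup>+x. \<integral>\<^sup>+y. indicator T x * indicator B y * ennreal ((u x - u y)\<^sup>2) \<partial>lborel \<partial>lborel)
    \<le> ennreal (h\<^sup>2) * (2 ^ CARD('d) * (emeasure lborel B + emeasure lborel T) *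
        (\<Sum>j\<in>UNIV. \<integral>\<^sup>+y. ennreal ((g j y)\<^sup>2) \<partial>lborel))" (is "_ \<le> ?K")
proof -
  define \<delta> where "\<delta> = (\<lambda>n. inverse (real (Suc n)))"
  have \<delta>: "\<delta> n > 0" "\<delta> \<longlonglongrightarrow> 0" for n using LIMSEQ_inverse_real_of_nat by (auto simp: \<delta>_def)
  have [measurable]: "u \<in> borel_measurable borel" "\<And>n. cube_erosion (\<delta> n) T \<in> sets borel" "\<And>n. cube_erosion (\<delta> n) B \<in> sets borel"
    using borel_open[OF open_cube_erosion[OF T]] borel_open[OF open_cube_erosion[OF B]] borel_measurable_integrable[OF u] by auto
  define F where "F = (\<lambda>n x y. indicator (cube_erosion (\<delta> n) T) x * indicator (cube_erosion (\<delta> n) B) y *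
      ennreal ((mollify (\<delta> n) u x - mollify (\<delta> n) u y)\<^sup>2))"
  have [measurable]: "case_prod (F n) \<in> borel_measurable (lborel \<Otimes>\<^sub>M lborel)" for n unfolding F_def by measurable
  have [measurable]: "F n x \<in> borel_measurable borel" for n x unfolding F_def by measurable
  have lim: "indicator T x * indicator B y * ennreal ((u x - u y)\<^sup>2) \<le> liminf (\<lambda>n. F n x y)"
    if "(\<lambda>n. mollify (\<delta> n) u x) \<longlonglongrightarrow> u x" "(\<lambda>n. mollify (\<delta> n) u y) \<longlonglongrightarrow> u y" for x y
  proof (cases "x \<in> T \<and> y \<in> B")
    case True
    have "(\<lambda>n. ennreal ((mollify (\<delta> n) u x - mollify (\<delta> n) u y)\<^sup>2)) \<longlonglongrightarrow> ennreal ((u x - u y)\<^sup>2)"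
      by (intro tendsto_ennrealI tendsto_intros that)
    moreover have "\<forall>\<^sub>F n in sequentially. ennreal ((mollify (\<delta> n) u x - mollify (\<delta> n) u y)\<^sup>2) = F n x y"
      using eventually_cube_erosion[OF T _ \<delta>(2), of x] eventually_cube_erosion[OF B _ \<delta>(2), of y] True
      by (auto simp: F_def elim: eventually_elim2)
    ultimately have "(\<lambda>n. F n x y) \<longlonglongrightarrow> ennreal ((u x - u y)\<^sup>2)" by (rule Lim_transform_eventually)
    then show ?thesis using True by (simp add: lim_imp_Liminf)
  qed auto
  note AE = AE_mollify_tendsto[OF u \<delta>]
  have "(\<integral>\<^sup>+x. \<integral>\<^sup>+y. indicator T x * indicator B y * ennreal ((u x - u y)\<^sup>2) \<partial>lborel \<partial>lborel) \<le>
    (\<integral>\<^sup>+x. \<integral>\<^sup>+y. liminf (\<lambda>n. F n x y) \<partial>lborel \<partial>lborel)"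
  proof (rule nn_integral_mono_AE, rule AE_mp[OF AE], intro AE_I2 impI)
    fix x assume x: "(\<lambda>n. mollify (\<delta> n) u x) \<longlonglongrightarrow> u x"
    show "(\<integral>\<^sup>+y. indicator T x * indicator B y * ennreal ((u x - u y)\<^sup>2) \<partial>lborel) \<le> (\<integral>\<^sup>+y. liminf (\<lambda>n. F n x y) \<partial>lborel)"
      by (rule nn_integral_mono_AE, rule AE_mp[OF AE], intro AE_I2 impI lim x)
  qed
  also have "\<dots> \<le> (\<integral>\<^sup>+x. liminf (\<lambda>n. \<integral>\<^sup>+y. F n x y \<partial>lborel) \<partial>lborel)"
    by (intro nn_integral_mono nn_integral_liminf) simp
  also have "\<dots> \<le> liminf (\<lambda>n. \<integral>\<^sup>+x. \<integral>\<^sup>+y. F n x y \<partial>lborel \<partial>lborel)"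
    by (intro nn_integral_liminf) measurable
  also have "\<dots> \<le> liminf (\<lambda>n. ?K)"
    unfolding F_def by (intro Liminf_mono always_eventually allI mollified_increments_le T B star h \<delta> u g weak)
  also have "\<dots> = ?K" by (rule Liminf_const) simp
  finally show ?thesis .
qed

subsection \<open>Weak derivatives\<close>

definition sq_norm :: "(real ^ 'd) set \<Rightarrow> (real ^ 'd \<Rightarrow> real) \<Rightarrow> real" where
  "sq_norm T f = (\<integral>x. (f x)\<^sup>2 \<partial>lebesgue_on T)"

section \<open>Square integrable functions on bounded open sets\<close>

lemma set_integral_eq_lebesgue_on:
  fixes f :: "real^'d::finite \<Rightarrow> 'b::{banach, second_countable_topology}"
  assumes "T \<in> sets lebesgue"
  shows "(LINT x:T|lebesgue. f x) = (\<integral>x. f x \<partial>lebesgue_on T)"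
  using assms by (simp add: set_lebesgue_integral_def integral_restrict_space)

lemma set_integrable_eq_lebesgue_on:
  fixes f :: "real^'d::finite \<Rightarrow> 'b::{banach, second_countable_topology}"
  assumes "T \<in> sets lebesgue"
  shows "set_integrable lebesgue T f \<longleftrightarrow> integrable (lebesgue_on T) f"
  using assms by (simp add: set_integrable_def integrable_restrict_space)

lemma square_integrable_iff:
  fixes f :: "real^'d::finite \<Rightarrow> real"
  assumes "T \<in> sets lebesgue"
  shows "square_integrable T f \<longleftrightarrow>
    f \<in> borel_measurable (lebesgue_on T) \<and> integrable (lebesgue_on T) (\<lambda>x. (f x)\<^sup>2)"
  using assms by (simp add: square_integrable_def set_borel_measurable_def
    set_integrable_eq_lebesgue_on borel_measurable_restrict_space_iff)

text \<open>Separate from the star-shaped setting below because the balls of the scaling argument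
  are instances too.\<close>

locale bounded_open =
  fixes T :: "(real ^ 'd::finite) set"
  assumes open_T: "open T" and bounded_T: "bounded T"
begin

lemma sets_T [simp, intro]: "T \<in> sets lebesgue" using open_T by simp

lemma finite_measure_T: "finite_measure (lebesgue_on T)"
proof
  have "T \<in> lmeasurable" using bounded_T sets_T by (rule bounded_set_imp_lmeasurable)
  then show "emeasure (lebesgue_on T) (space (lebesgue_on T)) \<noteq> \<infinity>"
    by (simp add: emeasure_restrict_space fmeasurable_def less_top)
qed

lemma integrable_const [simp]: "integrable (lebesgue_on T) (\<lambda>_. c::real)"
  using finite_measure_T by (simp add: finite_measure.integrable_const)

lemma si_iff: "square_integrable T f \<longleftrightarrow>
    f \<in> borel_measurable (lebesgue_on T) \<and> integrable (lebesgue_on T) (\<lambda>x. (f x)\<^sup>2)"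
  by (rule square_integrable_iff) simp

lemma si_measurable: "square_integrable T f \<Longrightarrow> f \<in> borel_measurable (lebesgue_on T)"
  and si_square: "square_integrable T f \<Longrightarrow> integrable (lebesgue_on T) (\<lambda>x. (f x)\<^sup>2)"
  by (simp_all add: si_iff)

lemma si_mult:
  assumes "square_integrable T f" "square_integrable T g"
  shows "integrable (lebesgue_on T) (\<lambda>x. f x * g x)"
proof (rule Bochner_Integration.integrable_bound)
  show "integrable (lebesgue_on T) (\<lambda>x. (f x)\<^sup>2 + (g x)\<^sup>2)" using assms by (simp add: si_square)
  show "(\<lambda>x. f x * g x) \<in> borel_measurable (lebesgue_on T)" using assms[THEN si_measurable] by measurable
  have "\<bar>a * b\<bar> \<le> a\<^sup>2 + b\<^sup>2" for a b :: real
  proof -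
    have "0 \<le> (\<bar>a\<bar> - \<bar>b\<bar>)\<^sup>2" by simp
    then have "2 * \<bar>a * b\<bar> \<le> a\<^sup>2 + b\<^sup>2" by (simp add: power2_diff abs_mult)
    then show ?thesis by (smt (verit) abs_ge_zero)
  qed
  then show "AE x in lebesgue_on T. norm (f x * g x) \<le> norm ((f x)\<^sup>2 + (g x)\<^sup>2)" by simp
qed

lemma si_const [simp]: "square_integrable T (\<lambda>_. c)" by (simp add: si_iff)

lemma si_integrable: "square_integrable T f \<Longrightarrow> integrable (lebesgue_on T) f"
  using si_mult[of f "\<lambda>_. 1"] by simp

lemma si_cmult: "square_integrable T f \<Longrightarrow> square_integrable T (\<lambda>x. c * f x)"
  by (auto simp: si_iff power_mult_distrib)

lemma si_add:
  assumes "square_integrable T f" "square_integrable T g"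
  shows "square_integrable T (\<lambda>x. f x + g x)"
  using assms[THEN si_measurable] assms[THEN si_square] si_mult[OF assms]
  by (simp add: si_iff power2_sum mult.assoc)

lemma si_diff: "square_integrable T f \<Longrightarrow> square_integrable T g \<Longrightarrow> square_integrable T (\<lambda>x. f x - g x)"
  using si_add[of f "\<lambda>x. - 1 * g x"] si_cmult[of g "-1"] by simp

lemma sq_norm_nonneg: "sq_norm T f \<ge> 0"
  unfolding sq_norm_def by (intro integral_nonneg_AE) simp

lemma sq_norm_add_le:
  assumes "square_integrable T f" "square_integrable T g"
  shows "sq_norm T (\<lambda>x. f x + g x) \<le> 2 * sq_norm T f + 2 * sq_norm T g"
proof -
  have "sq_norm T (\<lambda>x. f x + g x) \<le> (\<integral>x. 2 * (f x)\<^sup>2 + 2 * (g x)\<^sup>2 \<partial>lebesgue_on T)"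
    unfolding sq_norm_def
  proof (rule integral_mono)
    show "(f x + g x)\<^sup>2 \<le> 2 * (f x)\<^sup>2 + 2 * (g x)\<^sup>2" for x
      using zero_le_power2[of "f x - g x"] by (simp add: power2_sum power2_diff)
  qed (use assms si_add[OF assms] in \<open>auto simp: si_square\<close>)
  then show ?thesis using assms by (simp add: sq_norm_def si_square)
qed

lemma sq_norm_cmult: "sq_norm T (\<lambda>x. c * f x) = c\<^sup>2 * sq_norm T f"
  by (simp add: sq_norm_def power_mult_distrib)

lemma sq_norm_diff_le:
  assumes "square_integrable T f" "square_integrable T g"
  shows "sq_norm T (\<lambda>x. f x - g x) \<le> 2 * sq_norm T f + 2 * sq_norm T g"
  using sq_norm_add_le[OF assms(1) si_cmult[OF assms(2), of "-1"]] sq_norm_cmult[of "-1" g] by simp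

lemma si_cong_AE:
  assumes f: "square_integrable T f" and e: "AE x in lebesgue_on T. f x = g x"
  shows "square_integrable T g"
proof -
  have "(\<lambda>x. indicator T x *\<^sub>R f x) \<in> borel_measurable lebesgue"
    using si_measurable[OF f] by (simp add: borel_measurable_restrict_space_iff)
  moreover have "AE x in lebesgue. indicator T x *\<^sub>R f x = indicator T x *\<^sub>R g x"
    using e by (auto simp: AE_restrict_space_iff indicator_def)
  ultimately have "(\<lambda>x. indicator T x *\<^sub>R g x) \<in> borel_measurable lebesgue"
    by (rule borel_measurable_AE)
  then have g: "g \<in> borel_measurable (lebesgue_on T)" by (simp add: borel_measurable_restrict_space_iff)
  moreover have "integrable (lebesgue_on T) (\<lambda>x. (g x)\<^sup>2)"
    by (rule integrable_cong_AE_imp[OF si_square[OF f]]) (use g e in auto)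
  ultimately show ?thesis by (simp add: si_iff)
qed

lemma sq_norm_cong_AE:
  assumes f: "square_integrable T f" and e: "AE x in lebesgue_on T. f x = g x"
  shows "sq_norm T f = sq_norm T g"
  unfolding sq_norm_def
  by (rule integral_cong_AE) (use si_measurable[OF f] si_measurable[OF si_cong_AE[OF f e]] e in auto)

end

text \<open>The segment and mollification estimates concern Borel functions on the whole space,
  whereas a Sobolev function is only Lebesgue measurable and arbitrary off its domain. Extension by
  zero and a change on a null set bridge the gap, and integrals against Borel functions are
  preserved.\<close>

lemma borel_version:
  fixes f :: "real^'d::finite \<Rightarrow> real"
  assumes Q: "Q \<in> sets lebesgue" and f: "integrable (lebesgue_on Q) f"
  obtains f' where "f' \<in> borel_measurable borel" "integrable lborel f'"
    "AE x in lebesgue. f' x = indicator Q x * f x"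
    "\<And>\<phi>. \<phi> \<in> borel_measurable borel \<Longrightarrow> (\<integral>x. \<phi> x * f' x \<partial>lborel) = (\<integral>x. \<phi> x * f x \<partial>lebesgue_on Q)"
proof -
  have i: "integrable lebesgue (\<lambda>x. indicator Q x * f x)"
    using f Q by (simp add: integrable_restrict_space)
  from completion_ex_borel_measurable_real[OF borel_measurable_integrable[OF this]]
  obtain f' where f'[measurable]: "f' \<in> borel_measurable borel" and "AE x in lborel. indicator Q x * f x = f' x" by auto
  then have e: "AE x in lebesgue. f' x = indicator Q x * f x" by (auto simp: AE_completion_iff eq_commute)
  have m: "f' \<in> borel_measurable lebesgue" by (simp add: measurable_completion)
  have "integrable lebesgue f'"
    by (rule integrable_cong_AE_imp[OF i m]) (use e in \<open>auto elim: AE_mp\<close>)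
  then have "integrable lborel f'" by (simp add: integrable_completion)
  moreover have "(\<integral>x. \<phi> x * f' x \<partial>lborel) = (\<integral>x. \<phi> x * f x \<partial>lebesgue_on Q)"
    if [measurable]: "\<phi> \<in> borel_measurable borel" for \<phi>
  proof -
    have "(\<integral>x. \<phi> x * f' x \<partial>lborel) = (\<integral>x. \<phi> x * f' x \<partial>lebesgue)"
      by (rule integral_completion[symmetric]) measurable
    also have "\<dots> = (\<integral>x. \<phi> x * (indicator Q x * f x) \<partial>lebesgue)"
    proof (rule integral_cong_AE)
      have "\<phi> \<in> borel_measurable lebesgue" by (simp add: measurable_completion)
      then show "(\<lambda>x. \<phi> x * f' x) \<in> borel_measurable lebesgue" "(\<lambda>x. \<phi> x * (indicator Q x * f x)) \<in> borel_measurable lebesgue"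
        using m borel_measurable_integrable[OF i] by (auto intro: borel_measurable_times)
    qed (use e in \<open>auto elim: AE_mp\<close>)
    also have "\<dots> = (\<integral>x. \<phi> x * f x \<partial>lebesgue_on Q)"
      using Q by (simp add: integral_restrict_space mult_ac)
    finally show ?thesis .
  qed
  ultimately show ?thesis using that[OF f' _ e] by blast
qed

section \<open>Test functions and the fundamental lemma of the calculus of variations\<close>

lemma ex_count_list: "\<exists>js. count_list js = (\<alpha> :: 'd::finite \<Rightarrow> nat)"
proof -
  obtain js where "mset js = Abs_multiset \<alpha>" using ex_mset by blast
  then have "count (mset js) = \<alpha>" by simp
  then show ?thesis by (auto simp: count_mset fun_eq_iff)
qed

lemma test_function_continuous:
  assumes "\<phi> \<in> test_functions T" shows "continuous_on UNIV (foldr partial_deriv js \<phi>)"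
proof -
  have "foldr partial_deriv js \<phi> differentiable at x" for x
    using assms by (auto simp: test_functions_def smooth_fun_def)
  then show ?thesis
    by (simp add: continuous_at_imp_continuous_on differentiable_imp_continuous_within)
qed

lemma partial_deriv_zero_on_open:
  assumes "open U" "\<And>x. x \<in> U \<Longrightarrow> f x = 0" "x \<in> U"
  shows "partial_deriv j f x = 0"
proof -
  have "((\<lambda>_. 0) has_derivative (\<lambda>_. 0)) (at x)" by (rule has_derivative_const)
  from has_derivative_transform_within_open[OF this assms(1,3) assms(2)[symmetric]]
  have "(f has_derivative (\<lambda>_. 0)) (at x)" .
  then show ?thesis by (simp add: partial_deriv_eq)
qed

text \<open>The derivative vanishes on the open complement of the support of \<phi>, so
  differentiation does not enlarge supports.\<close>

lemma test_function_partial_deriv: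
  assumes "\<phi> \<in> test_functions T" shows "partial_deriv j \<phi> \<in> test_functions T"
proof -
  define K where "K = closure {x. \<phi> x \<noteq> 0}"
  have \<phi>: "smooth_fun \<phi>" "compact K" "K \<subseteq> T" using assms by (auto simp: test_functions_def K_def)
  have "smooth_fun (partial_deriv j \<phi>)" unfolding smooth_fun_def
  proof (intro allI)
    fix js x
    have "foldr partial_deriv (js @ [j]) \<phi> differentiable at x" using \<phi>(1) unfolding smooth_fun_def by blast
    then show "foldr partial_deriv js (partial_deriv j \<phi>) differentiable at x" by simp
  qed
  moreover have sub: "{x. partial_deriv j \<phi> x \<noteq> 0} \<subseteq> K"
  proof
    fix x assume "x \<in> {x. partial_deriv j \<phi> x \<noteq> 0}"
    then have nz: "partial_deriv j \<phi> x \<noteq> 0" by simp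
    show "x \<in> K"
    proof (rule ccontr)
      assume "x \<notin> K"
      have z: "\<phi> y = 0" if "y \<in> - K" for y
        using that closure_subset[of "{x. \<phi> x \<noteq> 0}"] by (auto simp: K_def)
      have "open (- K)" "x \<in> - K" using \<open>x \<notin> K\<close> by (simp_all add: K_def open_Compl)
      from partial_deriv_zero_on_open[OF this(1) z this(2)] nz show False by simp
    qed
  qed
  moreover have "closure {x. partial_deriv j \<phi> x \<noteq> 0} \<subseteq> K"
    using sub by (rule closure_minimal) (simp add: K_def)
  ultimately show ?thesis using \<phi> unfolding test_functions_def
    using compact_closure bounded_subset[OF compact_imp_bounded] by blast
qed

lemma test_function_foldr:
  "\<phi> \<in> test_functions T \<Longrightarrow> foldr partial_deriv js \<phi> \<in> test_functions T"
  by (induction js) (auto intro: test_function_partial_deriv)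

lemma integrable_test_function_mult:
  fixes f :: "real^'d::finite \<Rightarrow> real"
  assumes "locally_integrable T f" "\<phi> \<in> test_functions T" and T: "T \<in> sets lebesgue"
  shows "integrable (lebesgue_on T) (\<lambda>x. f x * \<phi> x)"
proof -
  define K where "K = closure {x. \<phi> x \<noteq> 0}"
  have K: "compact K" "K \<subseteq> T" using assms by (auto simp: test_functions_def K_def)
  have c: "continuous_on UNIV \<phi>" using test_function_continuous[OF assms(2), of "[]"] by simp
  then have "compact (\<phi> ` K)" using K(1) continuous_on_subset by (intro compact_continuous_image) auto
  then obtain C where C: "\<And>x. x \<in> K \<Longrightarrow> \<bar>\<phi> x\<bar> \<le> C" by (fastforce dest!: compact_imp_bounded simp: bounded_iff)
  have bd: "\<bar>\<phi> x\<bar> \<le> \<bar>C\<bar>" for x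
  proof (cases "\<phi> x = 0")
    case False
    then have "x \<in> K" by (auto simp: K_def intro: closure_subset[THEN subsetD])
    then show ?thesis using C by force
  qed simp
  have i: "integrable lebesgue (\<lambda>x. indicator K x *\<^sub>R f x)"
    using assms(1) K by (simp add: locally_integrable_def set_integrable_def)
  have "\<phi> \<in> borel_measurable lebesgue"
    using borel_measurable_continuous_onI[OF c] by (simp add: measurable_completion)
  from integrable_bounded_mult[OF i this bd]
  have "integrable lebesgue (\<lambda>x. \<phi> x * (indicator K x *\<^sub>R f x))" .
  also have "(\<lambda>x. \<phi> x * (indicator K x *\<^sub>R f x)) = (\<lambda>x. indicator T x *\<^sub>R (f x * \<phi> x))"
  proof
    fix x show "\<phi> x * (indicator K x *\<^sub>R f x) = indicator T x *\<^sub>R (f x * \<phi> x)"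
      using K(2) closure_subset[of "{x. \<phi> x \<noteq> 0}"] by (cases "\<phi> x = 0") (auto simp: indicator_def K_def)
  qed
  finally show ?thesis using T by (simp add: integrable_restrict_space)
qed

text \<open>Mollifiers are test functions, so the mollified d vanishes wherever the cube fits, while
  it converges to d almost everywhere. As d is only locally integrable, the argument runs on closed
  boxes inside T, countably many of which cover T.\<close>

lemma AE_zero_of_test_functions:
  fixes d :: "real^'d::finite \<Rightarrow> real"
  assumes T: "open T" and d: "locally_integrable T d"
    and zero: "\<And>\<phi>. \<phi> \<in> test_functions T \<Longrightarrow> (\<integral>x. d x * \<phi> x \<partial>lebesgue_on T) = 0"
  shows "AE x in lebesgue_on T. d x = 0"
proof -
  have box: "AE x in lebesgue. x \<in> box a b \<longrightarrow> d x = 0" if ab: "cbox a b \<subseteq> T" for a b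
  proof -
    have Q: "cbox a b \<in> sets lebesgue" by simp
    have "integrable (lebesgue_on (cbox a b)) d"
      using d ab by (simp add: locally_integrable_def flip: set_integrable_eq_lebesgue_on[OF Q])
    then obtain d' where d': "d' \<in> borel_measurable borel" "integrable lborel d'"
      "AE x in lebesgue. d' x = indicator (cbox a b) x * d x"
      "\<And>\<phi>. \<phi> \<in> borel_measurable borel \<Longrightarrow> (\<integral>x. \<phi> x * d' x \<partial>lborel) = (\<integral>x. \<phi> x * d x \<partial>lebesgue_on (cbox a b))"
      using borel_version[OF Q] by blast
    define \<delta> where "\<delta> = (\<lambda>n. inverse (real (Suc n)))"
    have \<delta>: "\<delta> n > 0" "\<delta> \<longlonglongrightarrow> 0" for n using LIMSEQ_inverse_real_of_nat by (auto simp: \<delta>_def)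
    have mz: "mollify (\<delta> n) d' x = 0" if "x \<in> cube_erosion (\<delta> n) (box a b)" for x n
    proof -
      have sub: "cbox x (x + \<delta> n *\<^sub>R One) \<subseteq> box a b" using that by (simp add: cube_erosion_def)
      have t: "mollifier (\<delta> n) x \<in> test_functions T"
        by (rule mollifier_test_function[OF \<delta>(1)]) (use sub ab box_subset_cbox in blast)
      have nz: "y \<in> cbox a b" if "mollifier (\<delta> n) x y \<noteq> 0" for y
        using mollifier_neq_0[OF that \<delta>(1)] sub box_subset_cbox[of a b]
        by (auto simp: mem_box_cart less_imp_le subset_iff)
      have "mollify (\<delta> n) d' x = (\<integral>y. mollifier (\<delta> n) x y * d y \<partial>lebesgue_on (cbox a b))"
        unfolding mollify_def by (rule d'(4)) simp
      also have "\<dots> = (\<integral>y. d y * mollifier (\<delta> n) x y \<partial>lebesgue_on T)"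
        using T ab nz by (subst (1 2) integral_restrict_space)
          (auto intro!: Bochner_Integration.integral_cong simp: indicator_def)
      also have "\<dots> = 0" by (rule zero[OF t])
      finally show ?thesis .
    qed
    have "AE x in lborel. x \<in> box a b \<longrightarrow> d' x = 0"
      using AE_mollify_tendsto[OF d'(2) \<delta>]
    proof (rule AE_mp, intro AE_I2 impI)
      fix x assume l: "(\<lambda>n. mollify (\<delta> n) d' x) \<longlonglongrightarrow> d' x" and x: "x \<in> box a b"
      have "\<forall>\<^sub>F n in sequentially. mollify (\<delta> n) d' x = 0"
        using eventually_cube_erosion[OF open_box x \<delta>(2)] by eventually_elim (rule mz)
      from tendsto_eventually[OF this] l show "d' x = 0" using LIMSEQ_unique by blast
    qed
    then have "AE x in lebesgue. x \<in> box a b \<longrightarrow> d' x = 0" by (simp add: AE_completion_iff)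
    with d'(3) show ?thesis
      by eventually_elim (use box_subset_cbox in \<open>force simp: indicator_def split: if_splits\<close>)
  qed
  \<comment> \<open>Mollification reaches the open box only; its faces form a negligible
    set.\<close>
  have cbox: "AE x in lebesgue. x \<in> cbox a b \<longrightarrow> d x = 0" if ab: "cbox a b \<subseteq> T" for a b
  proof -
    have "AE x in lebesgue. x \<notin> cbox a b - box a b"
      using negligible_frontier_interval by (intro AE_not_in) (simp add: negligible_iff_null_sets)
    with box[OF ab] show ?thesis by eventually_elim auto
  qed
  obtain D where D: "countable D" "D \<subseteq> Pow T" "\<And>X. X \<in> D \<Longrightarrow> \<exists>a b. X = cbox a b" "\<Union>D = T"
    using open_countable_Union_open_cbox[OF T] by metis
  have "AE x in lebesgue. \<forall>X\<in>D. x \<in> X \<longrightarrow> d x = 0"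
  proof (subst AE_ball_countable[OF D(1)], intro ballI)
    fix X assume "X \<in> D"
    then show "AE x in lebesgue. x \<in> X \<longrightarrow> d x = 0" using D(2) D(3)[of X] cbox by auto
  qed
  then show ?thesis using T D(4) by (auto simp: AE_restrict_space_iff elim!: AE_mp)
qed

section \<open>Calculus of weak derivatives\<close>

abbreviation unit_index :: "'d \<Rightarrow> 'd \<Rightarrow> nat" where
  "unit_index j \<equiv> (\<lambda>k. if k = j then 1 else 0)"

text \<open>A first-order multi-index has a single enumeration, so the quantifier over lists in the
  definition of weak derivatives collapses.\<close>

lemma count_list_eq_unit_index: "count_list js = unit_index j \<Longrightarrow> js = [j]"
proof (cases js)
  case Nil
  moreover assume "count_list js = unit_index j"
  ultimately show ?thesis by (auto dest: fun_cong[of _ _ j])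
next
  case (Cons a js')
  moreover assume e: "count_list js = unit_index j"
  ultimately have c: "(if a = k then Suc (count_list js' k) else count_list js' k) = unit_index j k" for k
    by (metis count_list.simps(2) add.commute plus_1_eq_Suc)
  have "a = j" using c[of a] by (auto split: if_splits)
  have "count_list js' k = 0" for k using c[of k] \<open>a = j\<close> by (auto split: if_splits)
  then have "\<forall>k. k \<notin> set js'" by (simp add: count_list_0_iff)
  then have "js' = []" by (cases js') auto
  then show ?thesis using Cons \<open>a = j\<close> by simp
qed

lemma locally_integrable_diff:
  fixes f :: "real^'d::finite \<Rightarrow> real"
  shows "locally_integrable T f \<Longrightarrow> locally_integrable T g \<Longrightarrow> locally_integrable T (\<lambda>x. f x - g x)"
  unfolding locally_integrable_def by (auto intro: set_integral_diff)

context bounded_open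
begin

lemma has_weak_deriv_iff: "has_weak_deriv T \<alpha> u g \<longleftrightarrow> locally_integrable T u \<and> locally_integrable T g \<and>
     (\<forall>\<phi>\<in>test_functions T. \<forall>js. count_list js = \<alpha> \<longrightarrow>
        (\<integral>x. u x * foldr partial_deriv js \<phi> x \<partial>lebesgue_on T)
          = (- 1) ^ sum \<alpha> UNIV * (\<integral>x. g x * \<phi> x \<partial>lebesgue_on T))"
  by (simp add: has_weak_deriv_def set_integral_eq_lebesgue_on)

lemma si_locally_integrable:
  assumes "square_integrable T f" shows "locally_integrable T f"
  unfolding locally_integrable_def
proof (intro allI impI)
  fix K assume K: "compact K \<and> K \<subseteq> T"
  have "set_integrable lebesgue T f"
    using si_integrable[OF assms] by (simp add: set_integrable_eq_lebesgue_on)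
  then show "set_integrable lebesgue K f"
    by (rule set_integrable_subset) (use K in \<open>auto intro: lmeasurable_compact fmeasurableD\<close>)
qed

lemma integrable_mult_test:
  "locally_integrable T f \<Longrightarrow> \<phi> \<in> test_functions T \<Longrightarrow> integrable (lebesgue_on T) (\<lambda>x. f x * \<phi> x)"
  by (rule integrable_test_function_mult) auto

lemma weak_deriv_unique:
  assumes "has_weak_deriv T \<alpha> u g" "has_weak_deriv T \<alpha> u g'"
  shows "AE x in lebesgue_on T. g x = g' x"
proof -
  obtain js where js: "count_list js = \<alpha>" using ex_count_list by blast
  have l: "locally_integrable T g" "locally_integrable T g'" using assms by (auto simp: has_weak_deriv_iff)
  have "AE x in lebesgue_on T. g x - g' x = 0"
  proof (rule AE_zero_of_test_functions[OF open_T locally_integrable_diff[OF l]])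
    fix \<phi> assume \<phi>: "\<phi> \<in> test_functions T"
    have "(- 1) ^ sum \<alpha> UNIV * (\<integral>x. g x * \<phi> x \<partial>lebesgue_on T) = (- 1) ^ sum \<alpha> UNIV * (\<integral>x. g' x * \<phi> x \<partial>lebesgue_on T)"
      using assms \<phi> js by (auto simp: has_weak_deriv_iff)
    then have "(\<integral>x. g x * \<phi> x \<partial>lebesgue_on T) = (\<integral>x. g' x * \<phi> x \<partial>lebesgue_on T)" by simp
    then show "(\<integral>x. (g x - g' x) * \<phi> x \<partial>lebesgue_on T) = 0"
      using l \<phi> by (simp add: left_diff_distrib integrable_mult_test)
  qed
  then show ?thesis by simp
qed

lemma has_weak_deriv_diff:
  assumes "has_weak_deriv T \<alpha> u g" "has_weak_deriv T \<alpha> u' g'"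
  shows "has_weak_deriv T \<alpha> (\<lambda>x. u x - u' x) (\<lambda>x. g x - g' x)"
  using assms unfolding has_weak_deriv_iff
  by (auto intro!: locally_integrable_diff
    simp: left_diff_distrib right_diff_distrib integrable_mult_test test_function_foldr)

text \<open>The Poincare inequality speaks of first derivatives; this lemma makes it applicable to a
  derivative of order \<alpha>. The relation for g is tested with
  \<open>partial_deriv j \<phi>\<close>, the one for k with \<phi>, and the left-hand sides
  coincide.\<close>

lemma has_weak_deriv_step:
  assumes g: "has_weak_deriv T \<alpha> u g" and k: "has_weak_deriv T (\<alpha>(j := Suc (\<alpha> j))) u k"
  shows "has_weak_deriv T (unit_index j) g k"
  unfolding has_weak_deriv_iff
proof (intro conjI ballI allI impI)
  show "locally_integrable T g" "locally_integrable T k" using g k by (auto simp: has_weak_deriv_iff)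
  fix \<phi> js assume \<phi>: "\<phi> \<in> test_functions T" and "count_list js = unit_index j"
  then have js: "js = [j]" by (simp add: count_list_eq_unit_index)
  obtain ks where i: "count_list ks = \<alpha>" using ex_count_list by blast
  \<comment> \<open>Placed at the end of the list, j is the derivative applied first, as testing
    with \<open>partial_deriv j \<phi>\<close> demands.\<close>
  have i': "count_list (ks @ [j]) = \<alpha>(j := Suc (\<alpha> j))" using i by (auto simp: fun_eq_iff)
  have s: "sum (\<alpha>(j := Suc (\<alpha> j))) UNIV = Suc (sum \<alpha> UNIV)"
    by (subst (1 2) sum.remove[of UNIV j]) auto
  have "(\<integral>x. u x * foldr partial_deriv ks (partial_deriv j \<phi>) x \<partial>lebesgue_on T) =
      (- 1) ^ sum \<alpha> UNIV * (\<integral>x. g x * partial_deriv j \<phi> x \<partial>lebesgue_on T)"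
    using g i test_function_partial_deriv[OF \<phi>] by (auto simp: has_weak_deriv_iff)
  moreover have "(\<integral>x. u x * foldr partial_deriv (ks @ [j]) \<phi> x \<partial>lebesgue_on T) =
      (- 1) ^ Suc (sum \<alpha> UNIV) * (\<integral>x. k x * \<phi> x \<partial>lebesgue_on T)"
    using k i' \<phi> unfolding has_weak_deriv_iff s by blast
  ultimately have "(- 1) ^ sum \<alpha> UNIV * (\<integral>x. g x * partial_deriv j \<phi> x \<partial>lebesgue_on T) =
     (- 1) ^ sum \<alpha> UNIV * (- (\<integral>x. k x * \<phi> x \<partial>lebesgue_on T))" by simp
  then have "(\<integral>x. g x * partial_deriv j \<phi> x \<partial>lebesgue_on T) = - (\<integral>x. k x * \<phi> x \<partial>lebesgue_on T)"
    by (simp only: mult_cancel_left) simp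
  then show "(\<integral>x. g x * foldr partial_deriv js \<phi> x \<partial>lebesgue_on T) =
      (- 1) ^ sum (unit_index j) UNIV * (\<integral>x. k x * \<phi> x \<partial>lebesgue_on T)"
    using js by simp
qed

lemma weak_deriv_AE:
  assumes "has_weak_deriv T \<alpha> u g" shows "AE x in lebesgue_on T. weak_deriv T \<alpha> u x = g x"
  unfolding weak_deriv_def
  by (rule weak_deriv_unique[OF someI[of "has_weak_deriv T \<alpha> u", OF assms] assms])

lemma weak_deriv_AE_sym:
  assumes "has_weak_deriv T \<alpha> u g" shows "AE x in lebesgue_on T. g x = weak_deriv T \<alpha> u x"
  unfolding weak_deriv_def
  by (rule weak_deriv_unique[OF assms someI[of "has_weak_deriv T \<alpha> u", OF assms]])

lemma sq_norm_weak_deriv: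
  assumes "has_weak_deriv T \<alpha> u g" "square_integrable T g"
  shows "sq_norm T (weak_deriv T \<alpha> u) = sq_norm T g"
  using sq_norm_cong_AE[OF assms(2) weak_deriv_AE_sym[OF assms(1)]] by simp

lemma sobolev_weak_deriv:
  assumes "u \<in> sobolev s T" "sum \<alpha> UNIV \<le> s"
  shows "has_weak_deriv T \<alpha> u (weak_deriv T \<alpha> u)" "square_integrable T (weak_deriv T \<alpha> u)"
proof -
  obtain g where g: "has_weak_deriv T \<alpha> u g" "square_integrable T g" using assms by (auto simp: sobolev_def)
  show "has_weak_deriv T \<alpha> u (weak_deriv T \<alpha> u)" unfolding weak_deriv_def by (rule someI[of "has_weak_deriv T \<alpha> u", OF g(1)])
  show "square_integrable T (weak_deriv T \<alpha> u)"
    by (rule si_cong_AE[OF g(2) weak_deriv_AE_sym[OF g(1)]])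
qed

lemma has_weak_deriv_0: "square_integrable T u \<Longrightarrow> has_weak_deriv T (\<lambda>_. 0) u u"
proof -
  assume "square_integrable T u"
  moreover have "js = []" if "count_list js = (\<lambda>_. 0)" for js :: "'d list"
  proof -
    have "\<forall>k. k \<notin> set js" using fun_cong[OF that] by (simp add: count_list_0_iff)
    then show ?thesis by (cases js) auto
  qed
  ultimately show ?thesis by (force simp: has_weak_deriv_iff si_locally_integrable)
qed

definition mean :: "(real ^ 'd \<Rightarrow> real) \<Rightarrow> real" where
  "mean f = (\<integral>x. f x \<partial>lebesgue_on T) / measure lebesgue T"

lemma integral_const: "(\<integral>x. c \<partial>lebesgue_on T) = c * measure lebesgue T"
  by (simp add: measure_restrict_space)

lemma sq_norm_const: "sq_norm T (\<lambda>_. c) = c\<^sup>2 * measure lebesgue T"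
  by (simp add: sq_norm_def integral_const del: lebesgue_integral_const)

lemma sq_norm_minus_const:
  assumes "square_integrable T u"
  shows "sq_norm T (\<lambda>x. u x - c) = sq_norm T u - 2 * c * (\<integral>x. u x \<partial>lebesgue_on T) + c\<^sup>2 * measure lebesgue T"
proof -
  have "sq_norm T (\<lambda>x. u x - c) = (\<integral>x. (u x)\<^sup>2 - (2 * c) * u x + c\<^sup>2 \<partial>lebesgue_on T)"
    unfolding sq_norm_def by (intro Bochner_Integration.integral_cong) (auto simp: power2_diff)
  also have "\<dots> = sq_norm T u - 2 * c * (\<integral>x. u x \<partial>lebesgue_on T) + c\<^sup>2 * measure lebesgue T"
    using si_square[OF assms] si_integrable[OF assms]
    by (simp add: sq_norm_def integral_const del: lebesgue_integral_const)
  finally show ?thesis .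
qed

end

subsection \<open>The Poincare inequality\<close>

text \<open>r and h are independent parameters, h being any bound for the distances in T. Uniform
  constants arise later, when r is \<rho> times h.\<close>

locale star_domain = bounded_open T for T :: "(real ^ 'd::finite) set" +
  fixes a :: "real ^ 'd" and r h :: real
  assumes r_pos: "r > 0" and h_pos: "h > 0" and ball_subset: "ball a r \<subseteq> T"
    and star: "\<And>x y. x \<in> T \<Longrightarrow> y \<in> ball a r \<Longrightarrow> closed_segment x y \<subseteq> T"
    and diam: "\<And>x y. x \<in> T \<Longrightarrow> y \<in> T \<Longrightarrow> norm (y - x) \<le> h"
begin

lemma measure_ball_pos: "measure lebesgue (ball a r) > 0"
  using r_pos content_ball_pos[of r a] by simp

lemma measure_T_pos: "measure lebesgue T > 0"
proof -
  have "measure lebesgue (ball a r) \<le> measure lebesgue T"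
    using ball_subset by (intro measure_mono_fmeasurable bounded_set_imp_lmeasurable bounded_T) auto
  then show ?thesis using measure_ball_pos by linarith
qed

text \<open>The mean is the best constant in L2: the two sides differ by the square of
  \<open>c - mean u\<close> times the measure of T. In the Poincare inequality c is the value of u
  at a point of the ball.\<close>

lemma sq_norm_minus_mean_le:
  assumes "square_integrable T u"
  shows "sq_norm T (\<lambda>x. u x - mean u) \<le> sq_norm T (\<lambda>x. u x - c)"
proof -
  define m V where "m = mean u" and "V = measure lebesgue T"
  have i: "(\<integral>x. u x \<partial>lebesgue_on T) = m * V" using measure_T_pos by (simp add: m_def mean_def V_def)
  have "0 \<le> (c - m)\<^sup>2 * V" by (simp add: V_def)
  then show ?thesis
    unfolding sq_norm_minus_const[OF assms] i m_def[symmetric] V_def[symmetric]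
    by (simp add: power2_eq_square algebra_simps)
qed

lemma sq_norm_mean_le:
  assumes "square_integrable T u"
  shows "sq_norm T (\<lambda>_. mean u) \<le> sq_norm T u"
proof -
  define m V where "m = mean u" and "V = measure lebesgue T"
  have i: "(\<integral>x. u x \<partial>lebesgue_on T) = m * V" using measure_T_pos by (simp add: m_def mean_def V_def)
  show ?thesis using sq_norm_nonneg[of "\<lambda>x. u x - mean u"]
    unfolding sq_norm_minus_const[OF assms] i m_def[symmetric] V_def[symmetric] sq_norm_const
    by (simp add: power2_eq_square algebra_simps)
qed

text \<open>The factor of the segment estimate, divided by the measure of the ball over which the
  end points are averaged.\<close>

definition poincare_const :: real where
  "poincare_const = 2 ^ CARD('d) * (measure lebesgue (ball a r) + measure lebesgue T) / measure lebesgue (ball a r)"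

text \<open>For every y in the ball the deviation of u from its mean is at most its deviation from
  the single value at y. Integrating over y turns the right-hand side into the double integral of
  squared increments bounded by \<open>increments_le\<close>; dividing by the measure of the ball
  gives the constant.\<close>

theorem poincare:
  assumes u: "square_integrable T u" and g: "\<And>j. square_integrable T (g j)"
    and w: "\<And>j. has_weak_deriv T (unit_index j) u (g j)"
  shows "sq_norm T (\<lambda>x. u x - mean u) \<le> poincare_const * h\<^sup>2 * (\<Sum>j\<in>UNIV. sq_norm T (g j))"
proof -
  obtain u' where u': "u' \<in> borel_measurable borel" "integrable lborel u'"
    "AE x in lebesgue. u' x = indicator T x * u x"
    "\<And>\<phi>. \<phi> \<in> borel_measurable borel \<Longrightarrow> (\<integral>x. \<phi> x * u' x \<partial>lborel) = (\<integral>x. \<phi> x * u x \<partial>lebesgue_on T)"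
    using borel_version[OF sets_T si_integrable[OF u]] by blast
  define P where "P j g' \<longleftrightarrow> g' \<in> borel_measurable borel \<and> integrable lborel g' \<and>
    (AE x in lebesgue. g' x = indicator T x * g j x) \<and>
    (\<forall>\<phi>. \<phi> \<in> borel_measurable borel \<longrightarrow> (\<integral>x. \<phi> x * g' x \<partial>lborel) = (\<integral>x. \<phi> x * g j x \<partial>lebesgue_on T))" for j g'
  have "\<forall>j. \<exists>g'. P j g'"
    unfolding P_def using borel_version[OF sets_T si_integrable[OF g]] by blast
  from choice[OF this] obtain g' where "\<And>j. P j (g' j)" by blast
  then have g': "\<And>j. g' j \<in> borel_measurable borel" "\<And>j. integrable lborel (g' j)"
    "\<And>j. AE x in lebesgue. g' j x = indicator T x * g j x"
    "\<And>j \<phi>. \<phi> \<in> borel_measurable borel \<Longrightarrow> (\<integral>x. \<phi> x * g' j x \<partial>lborel) = (\<integral>x. \<phi> x * g j x \<partial>lebesgue_on T)"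
    unfolding P_def by blast+
  have [measurable]: "T \<in> sets borel" using open_T by simp
  note [measurable] = u'(1) g'(1)
  have nn: "(\<integral>\<^sup>+x. indicator T x * ennreal ((f' x - c)\<^sup>2) \<partial>lborel) = ennreal (sq_norm T (\<lambda>x. f x - c))"
    if f: "square_integrable T f" "AE x in lebesgue. f' x = indicator T x * f x" for f f' c
  proof -
    have "(\<integral>\<^sup>+x. indicator T x * ennreal ((f' x - c)\<^sup>2) \<partial>lborel) = (\<integral>\<^sup>+x. indicator T x * ennreal ((f' x - c)\<^sup>2) \<partial>lebesgue)"
      by (simp add: nn_integral_completion)
    also have "\<dots> = (\<integral>\<^sup>+x. ennreal ((f x - c)\<^sup>2) * indicator T x \<partial>lebesgue)"
      by (rule nn_integral_cong_AE, use f(2) in eventually_elim) (auto simp: indicator_def)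
    also have "\<dots> = (\<integral>\<^sup>+x. ennreal ((f x - c)\<^sup>2) \<partial>lebesgue_on T)"
      by (rule nn_integral_restrict_space[symmetric]) simp
    also have "\<dots> = ennreal (sq_norm T (\<lambda>x. f x - c))"
      unfolding sq_norm_def by (rule nn_integral_eq_integral) (use si_square[OF si_diff[OF f(1) si_const]] in auto)
    finally show ?thesis .
  qed
  have g0: "(\<integral>\<^sup>+x. ennreal ((g' j x)\<^sup>2) \<partial>lborel) = ennreal (sq_norm T (g j))" for j
  proof -
    have "AE x in lborel. g' j x = indicator T x * g j x" using g'(3)[of j] by (simp add: AE_completion_iff)
    then have "(\<integral>\<^sup>+x. ennreal ((g' j x)\<^sup>2) \<partial>lborel) = (\<integral>\<^sup>+x. indicator T x * ennreal ((g' j x - 0)\<^sup>2) \<partial>lborel)"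
      by (intro nn_integral_cong_AE) (auto elim!: AE_mp simp: indicator_def)
    then show ?thesis using nn[OF g g'(3), of j 0] by simp
  qed
  have g2: "integrable lborel (\<lambda>x. (g' j x)\<^sup>2)" for j
    by (rule integrableI_nonneg) (use g0[of j] in auto)
  have weak: "(\<integral>y. u' y * partial_deriv j (mollifier \<delta> x) y \<partial>lborel) = - mollify \<delta> (g' j) x"
    if \<delta>: "\<delta> > 0" and c: "cbox x (x + \<delta> *\<^sub>R One) \<subseteq> T" for \<delta> x j
  proof -
    have t: "mollifier \<delta> x \<in> test_functions T" by (rule mollifier_test_function[OF \<delta> c])
    have "(\<integral>y. u y * foldr partial_deriv [j] (mollifier \<delta> x) y \<partial>lebesgue_on T) =
      (- 1) ^ sum (unit_index j) UNIV * (\<integral>y. g j y * mollifier \<delta> x y \<partial>lebesgue_on T)"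
    proof -
      have "count_list [j] = unit_index j" by (auto simp: fun_eq_iff)
      then show ?thesis using w[of j] t unfolding has_weak_deriv_iff by blast
    qed
    moreover have "(\<integral>y. partial_deriv j (mollifier \<delta> x) y * u' y \<partial>lborel) =
      (\<integral>y. partial_deriv j (mollifier \<delta> x) y * u y \<partial>lebesgue_on T)"
      by (rule u'(4)) (intro borel_measurable_continuous_onI continuous_partial_deriv_mollifier)
    moreover have "mollify \<delta> (g' j) x = (\<integral>y. mollifier \<delta> x y * g j y \<partial>lebesgue_on T)"
      unfolding mollify_def by (rule g'(4)) simp
    ultimately show ?thesis by (simp add: mult.commute)
  qed
  define B where "B = ball a r"
  have Bm[measurable]: "B \<in> sets borel" and Bo: "open B" by (simp_all add: B_def)
  have em: "emeasure lborel A = ennreal (measure lebesgue A)" if "bounded A" "A \<in> sets borel" for A :: "(real^'d) set"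
    using emeasure_eq_ennreal_measure[of lborel A] emeasure_bounded_finite[OF that(1)] that(2)
    by (simp add: measure_completion less_top)
  have eT: "emeasure lborel T = ennreal (measure lebesgue T)" by (rule em) (simp_all add: bounded_T)
  have eB: "emeasure lborel B = ennreal (measure lebesgue B)" by (rule em) (simp_all add: B_def)
  define \<kappa> where "\<kappa> = sq_norm T (\<lambda>x. u x - mean u)"
  have "ennreal \<kappa> * emeasure lborel B = (\<integral>\<^sup>+y. indicator B y * ennreal \<kappa> \<partial>lborel)"
    by (subst nn_integral_multc) (auto simp: mult.commute)
  also have "\<dots> \<le> (\<integral>\<^sup>+y. indicator B y * (\<integral>\<^sup>+x. indicator T x * ennreal ((u' x - u' y)\<^sup>2) \<partial>lborel) \<partial>lborel)"
  proof (intro nn_integral_mono mult_left_mono)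
    show "ennreal \<kappa> \<le> (\<integral>\<^sup>+x. indicator T x * ennreal ((u' x - u' y)\<^sup>2) \<partial>lborel)" for y
      unfolding nn[OF u u'(3)] \<kappa>_def by (intro ennreal_leI sq_norm_minus_mean_le u)
  qed simp
  also have "\<dots> = (\<integral>\<^sup>+y. \<integral>\<^sup>+x. indicator T x * indicator B y * ennreal ((u' x - u' y)\<^sup>2) \<partial>lborel \<partial>lborel)"
    by (intro nn_integral_cong) (subst nn_integral_cmult[symmetric], auto simp: mult_ac)
  also have "\<dots> = (\<integral>\<^sup>+x. \<integral>\<^sup>+y. indicator T x * indicator B y * ennreal ((u' x - u' y)\<^sup>2) \<partial>lborel \<partial>lborel)"
    by (rule lborel_pair.Fubini') measurable
  also have "\<dots> \<le> ennreal (h\<^sup>2) * (2 ^ CARD('d) * (emeasure lborel B + emeasure lborel T) *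
        (\<Sum>j\<in>UNIV. \<integral>\<^sup>+y. ennreal ((g' j y)\<^sup>2) \<partial>lborel))"
    by (rule increments_le) (use open_T Bo u' g' g2 weak star diam ball_subset in \<open>auto simp: B_def\<close>)
  also have "\<dots> = ennreal (h\<^sup>2 * (2 ^ CARD('d) * (measure lebesgue B + measure lebesgue T) * (\<Sum>j\<in>UNIV. sq_norm T (g j))))"
    unfolding g0 eT eB
    by (simp add: ennreal_mult sq_norm_nonneg sum_nonneg flip: ennreal_power)
  finally have "ennreal (\<kappa> * measure lebesgue B) \<le> ennreal (h\<^sup>2 * (2 ^ CARD('d) * (measure lebesgue B + measure lebesgue T) * (\<Sum>j\<in>UNIV. sq_norm T (g j))))"
    unfolding eB by (simp add: ennreal_mult \<kappa>_def sq_norm_nonneg)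
  then have "\<kappa> * measure lebesgue B \<le> h\<^sup>2 * (2 ^ CARD('d) * (measure lebesgue B + measure lebesgue T) * (\<Sum>j\<in>UNIV. sq_norm T (g j)))"
    by (subst (asm) ennreal_le_iff) (auto intro!: mult_nonneg_nonneg add_nonneg_nonneg sum_nonneg sq_norm_nonneg)
  then show ?thesis using measure_ball_pos unfolding \<kappa>_def poincare_const_def B_def
    by (simp add: field_simps)
qed

end

subsection \<open>Polynomials\<close>

definition monomial :: "('d \<Rightarrow> nat) \<Rightarrow> real ^ 'd::finite \<Rightarrow> real" where
  "monomial \<beta> x = (\<Prod>i\<in>UNIV. (x $ i) ^ \<beta> i)"

definition index_set :: "nat \<Rightarrow> ('d::finite \<Rightarrow> nat) set" where
  "index_set l = {\<beta>. sum \<beta> UNIV \<le> l}"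

lemma finite_index_set [simp]: "finite (index_set l :: ('d::finite \<Rightarrow> nat) set)"
proof (rule finite_subset)
  show "index_set l \<subseteq> Pi\<^sub>E (UNIV :: 'd set) (\<lambda>_. {..l})"
  proof
    fix \<beta> :: "'d \<Rightarrow> nat" assume "\<beta> \<in> index_set l"
    then have "sum \<beta> UNIV \<le> l" by (simp add: index_set_def)
    moreover have "\<beta> i \<le> sum \<beta> UNIV" for i by (rule member_le_sum) auto
    ultimately show "\<beta> \<in> Pi\<^sub>E UNIV (\<lambda>_. {..l})" using order_trans by (auto simp: PiE_def)
  qed
qed (rule finite_PiE, auto)

lemma poly_space_iff: "p \<in> poly_space l \<longleftrightarrow> (\<exists>c. p = (\<lambda>x. \<Sum>\<beta>\<in>index_set l. c \<beta> * monomial \<beta> x))"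
  by (simp add: poly_space_def index_set_def monomial_def)

lemma poly_space_sum_monomials: "(\<lambda>x. \<Sum>\<beta>\<in>index_set l. c \<beta> * monomial \<beta> x) \<in> poly_space l"
  by (auto simp: poly_space_iff)

lemma poly_space_add: "p \<in> poly_space l \<Longrightarrow> q \<in> poly_space l \<Longrightarrow> (\<lambda>x. p x + q x) \<in> poly_space l"
proof -
  assume "p \<in> poly_space l" "q \<in> poly_space l"
  then obtain c d where "p = (\<lambda>x. \<Sum>\<beta>\<in>index_set l. c \<beta> * monomial \<beta> x)" "q = (\<lambda>x. \<Sum>\<beta>\<in>index_set l. d \<beta> * monomial \<beta> x)"
    by (auto simp: poly_space_iff)
  then have "(\<lambda>x. p x + q x) = (\<lambda>x. \<Sum>\<beta>\<in>index_set l. (c \<beta> + d \<beta>) * monomial \<beta> x)"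
    by (simp add: distrib_right sum.distrib)
  then show ?thesis by (simp add: poly_space_sum_monomials)
qed

lemma poly_space_cmult: "p \<in> poly_space l \<Longrightarrow> (\<lambda>x. a * p x) \<in> poly_space l"
proof -
  assume "p \<in> poly_space l"
  then obtain c where "p = (\<lambda>x. \<Sum>\<beta>\<in>index_set l. c \<beta> * monomial \<beta> x)" by (auto simp: poly_space_iff)
  then have "(\<lambda>x. a * p x) = (\<lambda>x. \<Sum>\<beta>\<in>index_set l. (a * c \<beta>) * monomial \<beta> x)"
    by (simp add: sum_distrib_left mult.assoc)
  then show ?thesis by (simp add: poly_space_sum_monomials)
qed

lemma poly_space_0: "(\<lambda>x. 0) \<in> poly_space l"
  using poly_space_sum_monomials[of "\<lambda>_. 0" l] by simp

lemma poly_space_diff: "p \<in> poly_space l \<Longrightarrow> q \<in> poly_space l \<Longrightarrow> (\<lambda>x. p x - q x) \<in> poly_space l"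
  using poly_space_add[of p l "\<lambda>x. - 1 * q x"] poly_space_cmult[of q l "-1"] by simp

lemma poly_space_sum: "(\<And>i. i \<in> I \<Longrightarrow> p i \<in> poly_space l) \<Longrightarrow> (\<lambda>x. \<Sum>i\<in>I. p i x) \<in> poly_space l"
  by (induction I rule: infinite_finite_induct) (auto intro: poly_space_add poly_space_0)

lemma monomial_in_poly_space: "sum \<beta> UNIV \<le> l \<Longrightarrow> monomial \<beta> \<in> poly_space l"
proof -
  assume "sum \<beta> UNIV \<le> l"
  then have "\<beta> \<in> index_set l" by (simp add: index_set_def)
  then have "monomial \<beta> = (\<lambda>x. \<Sum>\<gamma>\<in>index_set l. (if \<gamma> = \<beta> then 1 else 0) * monomial \<gamma> x)"
    by (simp add: if_distrib[of "\<lambda>a. a * _"] cong: if_cong)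
  then show ?thesis unfolding poly_space_iff by (rule exI[of _ "\<lambda>\<gamma>. if \<gamma> = \<beta> then 1 else 0"])
qed

lemma poly_space_mono: "l \<le> l' \<Longrightarrow> poly_space l \<subseteq> poly_space l'"
proof
  fix p :: "real^'d::finite \<Rightarrow> real" assume "l \<le> l'" "p \<in> poly_space l"
  then obtain c where "p = (\<lambda>x. \<Sum>\<beta>\<in>index_set l. c \<beta> * monomial \<beta> x)" by (auto simp: poly_space_iff)
  then show "p \<in> poly_space l'" using \<open>l \<le> l'\<close>
    by (auto intro!: poly_space_sum poly_space_cmult monomial_in_poly_space simp: index_set_def)
qed

lemma monomial_mult: "monomial \<beta> x * monomial \<gamma> x = monomial (\<lambda>i. \<beta> i + \<gamma> i) x"
  by (simp add: monomial_def power_add prod.distrib)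

lemma poly_space_mult:
  assumes "p \<in> poly_space k" "q \<in> poly_space l" shows "(\<lambda>x. p x * q x) \<in> poly_space (k + l)"
proof -
  obtain c d where pq: "p = (\<lambda>x. \<Sum>\<beta>\<in>index_set k. c \<beta> * monomial \<beta> x)" "q = (\<lambda>x. \<Sum>\<beta>\<in>index_set l. d \<beta> * monomial \<beta> x)"
    using assms by (auto simp: poly_space_iff)
  have "(\<lambda>x. p x * q x) = (\<lambda>x. \<Sum>\<beta>\<in>index_set k. \<Sum>\<gamma>\<in>index_set l. (c \<beta> * d \<gamma>) * monomial (\<lambda>i. \<beta> i + \<gamma> i) x)"
    by (simp add: pq sum_product monomial_mult[symmetric] mult_ac)
  then show ?thesis
    by (auto intro!: poly_space_sum poly_space_cmult monomial_in_poly_space simp: index_set_def sum.distrib add_mono)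
qed

lemma poly_space_const: "(\<lambda>x. c) \<in> poly_space l"
  using poly_space_cmult[OF monomial_in_poly_space[of "\<lambda>_. 0" l], of c] by (simp add: monomial_def)

lemma poly_space_coordinate: "(\<lambda>x. x $ i) \<in> poly_space (Suc l)"
proof -
  have "monomial (unit_index i) = (\<lambda>x. x $ i)"
    by (simp add: monomial_def fun_eq_iff if_distrib[of "\<lambda>a. _ ^ a"] prod.delta cong: if_cong)
  then show ?thesis using monomial_in_poly_space[of "unit_index i" "Suc l"] by simp
qed

lemma poly_space_power: "p \<in> poly_space k \<Longrightarrow> (\<lambda>x. p x ^ n) \<in> poly_space (n * k)"
  by (induction n) (auto intro: poly_space_const poly_space_mult)

lemma poly_space_prod:
  "finite I \<Longrightarrow> (\<And>i. i \<in> I \<Longrightarrow> p i \<in> poly_space (n i)) \<Longrightarrow> (\<lambda>x. \<Prod>i\<in>I. p i x) \<in> poly_space (\<Sum>i\<in>I. n i)"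
  by (induction I rule: finite_induct) (auto intro: poly_space_const poly_space_mult)

text \<open>Invariance under affine substitutions permits the passage to the unit ball without
  change of degree.\<close>

lemma poly_space_affine:
  fixes a :: "real^'d::finite"
  assumes "p \<in> poly_space l" shows "(\<lambda>z. p (a + h *\<^sub>R z)) \<in> poly_space l"
proof -
  obtain c where p: "p = (\<lambda>x. \<Sum>\<beta>\<in>index_set l. c \<beta> * monomial \<beta> x)" using assms by (auto simp: poly_space_iff)
  have "(\<lambda>z. monomial \<beta> (a + h *\<^sub>R z)) \<in> poly_space l" if "\<beta> \<in> index_set l" for \<beta>
  proof -
    have "(\<lambda>z. a $ i + h * z $ i) \<in> poly_space (Suc 0)" for i
      by (intro poly_space_add poly_space_const poly_space_cmult poly_space_coordinate)
    from poly_space_power[OF this]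
    have "(\<lambda>z. (a $ i + h * z $ i) ^ \<beta> i) \<in> poly_space (\<beta> i)" for i by simp
    then have "(\<lambda>z. \<Prod>i\<in>UNIV. (a $ i + h * z $ i) ^ \<beta> i) \<in> poly_space (\<Sum>i\<in>UNIV. \<beta> i)"
      by (intro poly_space_prod) auto
    then show ?thesis using that poly_space_mono[of "sum \<beta> UNIV" l] by (auto simp: monomial_def index_set_def)
  qed
  then show ?thesis unfolding p by (intro poly_space_sum poly_space_cmult)
qed

section \<open>Derivatives of polynomials\<close>

definition power_deriv :: "nat \<Rightarrow> nat \<Rightarrow> real \<Rightarrow> real" where
  "power_deriv n k t = (\<Prod>r<k. real n - real r) * t ^ (n - k)"

text \<open>The product is a falling factorial. It contains a zero factor as soon as k exceeds n, so
  the truncated exponent n - k does no harm.\<close>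

lemma power_deriv_has_derivative:
  "(power_deriv n k has_real_derivative power_deriv n (Suc k) t) (at t)"
proof -
  have "((\<lambda>t. (\<Prod>r<k. real n - real r) * t ^ (n - k)) has_real_derivative
      (\<Prod>r<k. real n - real r) * (real (n - k) * t ^ (n - k - Suc 0))) (at t)"
    by (intro DERIV_cmult DERIV_pow)
  moreover have "(\<Prod>r<k. real n - real r) * (real (n - k) * t ^ (n - k - Suc 0)) = power_deriv n (Suc k) t"
  proof (cases "k \<le> n")
    case False
    then have "(\<Prod>r<k. real n - real r) = 0" by (intro prod_zero) (auto intro!: bexI[of _ n])
    then show ?thesis by (simp add: power_deriv_def)
  qed (simp add: power_deriv_def of_nat_diff)
  moreover have "power_deriv n k = (\<lambda>t. (\<Prod>r<k. real n - real r) * t ^ (n - k))"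
    by (simp add: power_deriv_def fun_eq_iff)
  ultimately show ?thesis by (simp only:)
qed

lemma power_deriv_at_0: "power_deriv n k 0 = (if n = k then fact n else 0)"
proof -
  consider "n < k" | "n = k" | "k < n" by linarith
  then show ?thesis
  proof cases
    case 1
    then have "(\<Prod>r<k. real n - real r) = 0" by (intro prod_zero) (auto intro!: bexI[of _ n])
    then show ?thesis using 1 by (simp add: power_deriv_def)
  next
    case 2
    have "(\<Prod>r<k. real k - real r) = fact k"
      using prod.nat_diff_reindex[of "\<lambda>r. real (Suc r)" k]
      by (auto simp: fact_prod_Suc atLeast0LessThan intro!: prod.cong)
    then show ?thesis using 2 by (simp add: power_deriv_def)
  qed (simp add: power_deriv_def)
qed

definition monomial_deriv :: "('d \<Rightarrow> nat) \<Rightarrow> ('d \<Rightarrow> nat) \<Rightarrow> real ^ 'd::finite \<Rightarrow> real" where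
  "monomial_deriv \<alpha> \<beta> x = (\<Prod>i\<in>UNIV. power_deriv (\<beta> i) (\<alpha> i) (x $ i))"

lemma monomial_eq_power_deriv: "monomial \<beta> = (\<lambda>x. 1 * (\<Prod>i\<in>UNIV. power_deriv (\<beta> i) ((\<lambda>_. 0) i) (x $ i)))"
  by (simp add: monomial_def power_deriv_def fun_eq_iff)

lemma smooth_monomial: "smooth_fun (monomial \<beta>)"
  unfolding monomial_eq_power_deriv
  by (rule smooth_fun_prod_coordinates[of "\<lambda>i. power_deriv (\<beta> i)"]) (rule power_deriv_has_derivative)

lemma foldr_partial_deriv_monomial: "foldr partial_deriv js (monomial \<beta>) = monomial_deriv (count_list js) \<beta>"
  unfolding monomial_eq_power_deriv
  by (subst foldr_partial_deriv_prod_coordinates[of "\<lambda>i. power_deriv (\<beta> i)"])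
    (auto simp: monomial_deriv_def fun_eq_iff intro: power_deriv_has_derivative)

lemma monomial_deriv_zero: "\<beta> i < \<alpha> i \<Longrightarrow> monomial_deriv \<alpha> \<beta> x = 0"
proof -
  assume i: "\<beta> i < \<alpha> i"
  have "(\<Prod>r<\<alpha> i. real (\<beta> i) - real r) = 0" using i by (intro prod_zero) (auto intro!: bexI[of _ "\<beta> i"])
  then show ?thesis
    unfolding monomial_deriv_def by (intro prod_zero) (auto intro!: bexI[of _ i] simp: power_deriv_def)
qed

text \<open>If \<alpha> exceeds \<beta> in some entry, the derivative is 0 and lies in every
  polynomial space; otherwise the subtraction of degrees is not truncated.\<close>

lemma monomial_deriv_in_poly_space:
  assumes "sum \<beta> UNIV \<le> l" shows "monomial_deriv \<alpha> \<beta> \<in> poly_space (l - sum \<alpha> UNIV)"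
proof (cases "\<forall>i. \<alpha> i \<le> \<beta> i")
  case True
  have "monomial_deriv \<alpha> \<beta> = (\<lambda>x. (\<Prod>i\<in>UNIV. \<Prod>r<\<alpha> i. real (\<beta> i) - real r) * monomial (\<lambda>i. \<beta> i - \<alpha> i) x)"
    by (simp add: monomial_deriv_def power_deriv_def monomial_def prod.distrib fun_eq_iff)
  moreover have "sum (\<lambda>i. \<beta> i - \<alpha> i) UNIV \<le> l - sum \<alpha> UNIV"
    using assms True by (subst sum_subtractf_nat) auto
  ultimately show ?thesis by (auto intro!: poly_space_cmult monomial_in_poly_space)
next
  case False
  then obtain i where i: "\<beta> i < \<alpha> i" by (auto simp: not_le)
  have "monomial_deriv \<alpha> \<beta> = (\<lambda>x. 0)" using monomial_deriv_zero[of \<beta> i \<alpha>, OF i] by auto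
  then show ?thesis by (simp add: poly_space_0)
qed

lemma foldr_partial_deriv_sum:
  assumes "\<And>i. i \<in> A \<Longrightarrow> smooth_fun (f i)"
  shows "foldr partial_deriv js (\<lambda>x. \<Sum>i\<in>A. c i * f i x) = (\<lambda>x. \<Sum>i\<in>A. c i * foldr partial_deriv js (f i) x)"
proof (induction js)
  case (Cons j js)
  show ?case
  proof
    fix x
    have D: "(foldr partial_deriv js (f i) has_derivative frechet_derivative (foldr partial_deriv js (f i)) (at x)) (at x)"
      if "i \<in> A" for i using assms[OF that] by (auto simp: smooth_fun_def frechet_derivative_works)
    have "((\<lambda>x. \<Sum>i\<in>A. c i * foldr partial_deriv js (f i) x) has_derivative
      (\<lambda>v. \<Sum>i\<in>A. c i * frechet_derivative (foldr partial_deriv js (f i)) (at x) v)) (at x)"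
      by (intro has_derivative_sum has_derivative_mult_right D)
    from partial_deriv_eq[OF this]
    show "foldr partial_deriv (j # js) (\<lambda>x. \<Sum>i\<in>A. c i * f i x) x = (\<Sum>i\<in>A. c i * foldr partial_deriv (j # js) (f i) x)"
      by (simp add: Cons) (simp add: partial_deriv_def)
  qed
qed simp

lemma foldr_partial_deriv_poly:
  "foldr partial_deriv js (\<lambda>x. \<Sum>\<beta>\<in>A. c \<beta> * monomial \<beta> x) = (\<lambda>x. \<Sum>\<beta>\<in>A. c \<beta> * monomial_deriv (count_list js) \<beta> x)"
  by (subst foldr_partial_deriv_sum) (auto simp: smooth_monomial foldr_partial_deriv_monomial)

text \<open>Any enumeration of \<alpha> would do: on polynomials an iterated derivative depends on
  the multiplicities only.\<close>

definition poly_deriv :: "('d \<Rightarrow> nat) \<Rightarrow> (real ^ 'd::finite \<Rightarrow> real) \<Rightarrow> real ^ 'd \<Rightarrow> real" where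
  "poly_deriv \<alpha> p = foldr partial_deriv (SOME js. count_list js = \<alpha>) p"

lemma count_list_some: "count_list (SOME js. count_list js = \<alpha>) = (\<alpha> :: 'd::finite \<Rightarrow> nat)"
  using ex_count_list by (rule someI_ex)

lemma poly_deriv_eq: "poly_deriv \<alpha> (\<lambda>x. \<Sum>\<beta>\<in>A. c \<beta> * monomial \<beta> x) = (\<lambda>x. \<Sum>\<beta>\<in>A. c \<beta> * monomial_deriv \<alpha> \<beta> x)"
  unfolding poly_deriv_def by (simp add: foldr_partial_deriv_poly count_list_some)

lemma foldr_partial_deriv_eq_poly_deriv:
  "p \<in> poly_space l \<Longrightarrow> foldr partial_deriv js p = poly_deriv (count_list js) p"
  by (auto simp: poly_space_iff foldr_partial_deriv_poly poly_deriv_eq)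

lemma poly_deriv_in_poly_space:
  "p \<in> poly_space l \<Longrightarrow> poly_deriv \<alpha> p \<in> poly_space (l - sum \<alpha> UNIV)"
  by (auto simp: poly_space_iff[of p] poly_deriv_eq index_set_def
    intro!: poly_space_sum poly_space_cmult monomial_deriv_in_poly_space)

lemma poly_deriv_in_poly_space': "p \<in> poly_space l \<Longrightarrow> poly_deriv \<alpha> p \<in> poly_space l"
  using poly_deriv_in_poly_space[of p l \<alpha>] poly_space_mono[of "l - sum \<alpha> UNIV" l] by auto

lemma smooth_fun_differentiable: "smooth_fun f \<Longrightarrow> f differentiable at x"
  unfolding smooth_fun_def by (drule spec[of _ "[]"]) simp

lemma smooth_poly: "p \<in> poly_space l \<Longrightarrow> smooth_fun p"
proof -
  assume p: "p \<in> poly_space l"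
  have "foldr partial_deriv js p differentiable at x" for js x
  proof -
    have "poly_deriv (count_list js) p \<in> poly_space l" by (rule poly_deriv_in_poly_space'[OF p])
    then obtain c where "poly_deriv (count_list js) p = (\<lambda>x. \<Sum>\<beta>\<in>index_set l. c \<beta> * monomial \<beta> x)" by (auto simp: poly_space_iff)
    moreover have "monomial \<beta> differentiable at x" for \<beta> :: "'a \<Rightarrow> nat"
      by (rule smooth_fun_differentiable[OF smooth_monomial])
    ultimately show ?thesis unfolding foldr_partial_deriv_eq_poly_deriv[OF p]
      by (auto intro!: differentiable_sum differentiable_mult)
  qed
  then show ?thesis by (simp add: smooth_fun_def)
qed

lemma partial_deriv_poly_deriv:
  assumes "p \<in> poly_space l"
  shows "partial_deriv j (poly_deriv \<alpha> p) = poly_deriv (\<alpha>(j := Suc (\<alpha> j))) p"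
proof -
  define js where "js = (SOME js. count_list js = \<alpha>)"
  have js: "count_list js = \<alpha>" unfolding js_def by (rule count_list_some)
  have "partial_deriv j (poly_deriv \<alpha> p) = foldr partial_deriv (j # js) p"
    by (simp add: poly_deriv_def js_def)
  also have "\<dots> = poly_deriv (count_list (j # js)) p" by (rule foldr_partial_deriv_eq_poly_deriv[OF assms])
  also have "count_list (j # js) = \<alpha>(j := Suc (\<alpha> j))" using js by (auto simp: fun_eq_iff)
  finally show ?thesis .
qed

lemma poly_deriv_0: "p \<in> poly_space l \<Longrightarrow> poly_deriv (\<lambda>_. 0) p = p"
proof -
  have "count_list ([] :: 'a list) = (\<lambda>_. 0)" by auto
  then show "p \<in> poly_space l \<Longrightarrow> poly_deriv (\<lambda>_. 0) p = p"
    using foldr_partial_deriv_eq_poly_deriv[of p l "[]"] by simp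
qed

lemma partial_deriv_eq_poly_deriv: "p \<in> poly_space l \<Longrightarrow> partial_deriv j p = poly_deriv (unit_index j) p"
  using partial_deriv_poly_deriv[of p l j "\<lambda>_. 0"] by (simp add: poly_deriv_0 fun_upd_def cong: if_cong)

lemma partial_deriv_in_poly_space: "p \<in> poly_space l \<Longrightarrow> partial_deriv j p \<in> poly_space l"
  by (simp add: partial_deriv_eq_poly_deriv poly_deriv_in_poly_space')

lemma partial_deriv_commute: "p \<in> poly_space l \<Longrightarrow> partial_deriv i (partial_deriv j p) = partial_deriv j (partial_deriv i p)"
proof -
  have "count_list [i, j] = count_list [j, i]" by auto
  then show "p \<in> poly_space l \<Longrightarrow> ?thesis"
    using foldr_partial_deriv_eq_poly_deriv[of p l "[i, j]"] foldr_partial_deriv_eq_poly_deriv[of p l "[j, i]"] by simp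
qed

lemma poly_differentiable: "p \<in> poly_space l \<Longrightarrow> p differentiable at x"
  by (rule smooth_fun_differentiable[OF smooth_poly])

lemma continuous_on_poly: "p \<in> poly_space l \<Longrightarrow> continuous_on A p"
  by (intro continuous_at_imp_continuous_on ballI differentiable_imp_continuous_within poly_differentiable)

lemma poly_deriv_add:
  assumes p: "p \<in> poly_space l" and q: "q \<in> poly_space l"
  shows "poly_deriv \<alpha> (\<lambda>x. p x + q x) = (\<lambda>x. poly_deriv \<alpha> p x + poly_deriv \<alpha> q x)"
proof -
  obtain c d where pq: "p = (\<lambda>x. \<Sum>\<beta>\<in>index_set l. c \<beta> * monomial \<beta> x)" "q = (\<lambda>x. \<Sum>\<beta>\<in>index_set l. d \<beta> * monomial \<beta> x)"
    using assms by (auto simp: poly_space_iff)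
  have "(\<lambda>x. p x + q x) = (\<lambda>x. \<Sum>\<beta>\<in>index_set l. (c \<beta> + d \<beta>) * monomial \<beta> x)"
    by (simp add: pq distrib_right sum.distrib)
  then have "poly_deriv \<alpha> (\<lambda>x. p x + q x) = (\<lambda>x. \<Sum>\<beta>\<in>index_set l. (c \<beta> + d \<beta>) * monomial_deriv \<alpha> \<beta> x)"
    by (simp only: poly_deriv_eq)
  then show ?thesis unfolding pq poly_deriv_eq by (simp add: distrib_right sum.distrib)
qed

text \<open>All iterated derivatives vanish on U, and the derivative of order \<alpha> at the origin
  sees only the coefficient of \<alpha>, multiplied by a nonzero product of factorials.\<close>

lemma coefficients_zero:
  fixes c :: "('d::finite \<Rightarrow> nat) \<Rightarrow> real"
  assumes U: "open U" "0 \<in> U" and zero: "\<And>x. x \<in> U \<Longrightarrow> (\<Sum>\<beta>\<in>index_set l. c \<beta> * monomial \<beta> x) = 0"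
    and \<alpha>: "\<alpha> \<in> index_set l"
  shows "c \<alpha> = 0"
proof -
  obtain js where js: "count_list js = \<alpha>" using ex_count_list by blast
  have "\<forall>x\<in>U. foldr partial_deriv js (\<lambda>x. \<Sum>\<beta>\<in>index_set l. c \<beta> * monomial \<beta> x) x = 0" for js
    by (induction js) (auto simp: zero intro!: partial_deriv_zero_on_open[OF U(1)])
  from this[of js] U(2) have "(\<Sum>\<beta>\<in>index_set l. c \<beta> * monomial_deriv \<alpha> \<beta> 0) = 0"
    by (simp add: foldr_partial_deriv_poly js)
  moreover have "monomial_deriv \<alpha> \<beta> 0 = (if \<beta> = \<alpha> then (\<Prod>i\<in>UNIV. fact (\<alpha> i)) else 0)" for \<beta>
  proof (cases "\<beta> = \<alpha>")
    case False
    then obtain i where "\<beta> i \<noteq> \<alpha> i" by auto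
    then show ?thesis using False by (auto simp: monomial_deriv_def power_deriv_at_0 intro!: prod_zero)
  qed (simp add: monomial_deriv_def power_deriv_at_0)
  ultimately show ?thesis using \<alpha> by (simp add: if_distrib[of "\<lambda>a. _ * a"] cong: if_cong)
qed

text \<open>Elimination of one variable: completing the square in \<open>c a\<close> leaves the
  Schur complement B' on the remaining indices, which inherits positivity. The same elimination
  yields both conclusions. The coercivity constant later bounds the coefficients of a polynomial by
  its norm; the solvability of the linear system yields the existence of the projection.\<close>

lemma positive_definite_form:
  fixes B :: "'i \<Rightarrow> 'i \<Rightarrow> real"
  assumes "finite A" "\<And>i j. B i j = B j i"
    and "\<And>c i. i \<in> A \<Longrightarrow> c i \<noteq> 0 \<Longrightarrow> 0 < (\<Sum>i\<in>A. \<Sum>j\<in>A. c i * c j * B i j)"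
  shows "(\<exists>k>0. \<forall>c. k * (\<Sum>i\<in>A. (c i)\<^sup>2) \<le> (\<Sum>i\<in>A. \<Sum>j\<in>A. c i * c j * B i j)) \<and>
    (\<forall>F. \<exists>c. \<forall>j\<in>A. (\<Sum>i\<in>A. c i * B i j) = F j)"
  using assms
proof (induction A arbitrary: B rule: finite_induct)
  case empty
  then show ?case by (auto intro: exI[of _ 1])
next
  case (insert a A)
  define b where "b = B a a"
  define B' where "B' = (\<lambda>i j. B i j - B i a * B j a / b)"
  define L where "L = (\<lambda>c. \<Sum>i\<in>A. c i * B i a)"
  have sym: "B i j = B j i" for i j by (rule insert.prems(1))
  have b: "b > 0"
  proof -
    have "0 < (\<Sum>i\<in>insert a A. \<Sum>j\<in>insert a A. (if i = a then 1 else 0) * (if j = a then 1 else 0) * B i j)"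
      by (rule insert.prems(2)[of a "\<lambda>i. if i = a then 1 else 0"]) auto
    also have "\<dots> = b"
    proof -
      have "(i = a) = False" if "i \<in> A" for i using that insert.hyps by auto
      then show ?thesis using insert.hyps by (simp add: b_def cong: sum.cong_simp)
    qed
    finally show ?thesis .
  qed
  have Q': "(\<Sum>i\<in>A. \<Sum>j\<in>A. c i * c j * B' i j) = (\<Sum>i\<in>A. \<Sum>j\<in>A. c i * c j * B i j) - (L c)\<^sup>2 / b" for c
  proof -
    have "(L c)\<^sup>2 / b = (\<Sum>i\<in>A. \<Sum>j\<in>A. c i * c j * (B i a * B j a / b))"
      by (simp add: L_def power2_eq_square sum_product sum_divide_distrib mult_ac)
    then show ?thesis by (simp add: B'_def right_diff_distrib sum_subtractf)
  qed
  have Q: "(\<Sum>i\<in>insert a A. \<Sum>j\<in>insert a A. c i * c j * B i j) =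
      b * (c a + L c / b)\<^sup>2 + (\<Sum>i\<in>A. \<Sum>j\<in>A. c i * c j * B' i j)" for c
  proof -
    have "(\<Sum>i\<in>insert a A. \<Sum>j\<in>insert a A. c i * c j * B i j) =
      c a * c a * b + (\<Sum>j\<in>A. c a * c j * B a j) + ((\<Sum>i\<in>A. c i * c a * B i a) + (\<Sum>i\<in>A. \<Sum>j\<in>A. c i * c j * B i j))"
      using insert.hyps by (simp add: b_def sum.distrib)
    also have "(\<Sum>j\<in>A. c a * c j * B a j) = c a * L c"
      by (simp add: L_def sum_distrib_left sym[of a] mult_ac)
    also have "(\<Sum>i\<in>A. c i * c a * B i a) = c a * L c"
      by (simp add: L_def sum_distrib_left mult_ac)
    finally show ?thesis unfolding Q' using b by (simp add: power2_eq_square field_simps)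
  qed
  have pos: "0 < (\<Sum>i\<in>A. \<Sum>j\<in>A. c i * c j * B' i j)" if "i \<in> A" "c i \<noteq> 0" for c i
  proof -
    \<comment> \<open>This value at a makes the completed square vanish, so the form on
      \<open>insert a A\<close> reduces to the Schur complement on A.\<close>
    define c' where "c' = c(a := - L c / b)"
    have eqA: "c' i = c i" if "i \<in> A" for i using that insert.hyps by (auto simp: c'_def)
    have "L c' = L c" by (simp add: L_def eqA)
    moreover have "(\<Sum>i\<in>A. \<Sum>j\<in>A. c' i * c' j * B' i j) = (\<Sum>i\<in>A. \<Sum>j\<in>A. c i * c j * B' i j)"
      by (simp add: eqA)
    moreover have "0 < (\<Sum>i\<in>insert a A. \<Sum>j\<in>insert a A. c' i * c' j * B i j)"
      by (rule insert.prems(2)[of i]) (use that eqA in auto)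
    moreover have "c' a = - L c / b" by (simp add: c'_def)
    ultimately show ?thesis unfolding Q by simp
  qed
  have "(\<exists>k>0. \<forall>c. k * (\<Sum>i\<in>A. (c i)\<^sup>2) \<le> (\<Sum>i\<in>A. \<Sum>j\<in>A. c i * c j * B' i j)) \<and>
    (\<forall>F. \<exists>c. \<forall>j\<in>A. (\<Sum>i\<in>A. c i * B' i j) = F j)"
    by (rule insert.IH) (auto simp: B'_def sym mult.commute pos[unfolded B'_def])
  then obtain k' where k': "k' > 0" "\<And>c. k' * (\<Sum>i\<in>A. (c i)\<^sup>2) \<le> (\<Sum>i\<in>A. \<Sum>j\<in>A. c i * c j * B' i j)"
    and solve: "\<And>F. \<exists>c. \<forall>j\<in>A. (\<Sum>i\<in>A. c i * B' i j) = F j" by blast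
  define M where "M = (\<Sum>i\<in>A. (B i a)\<^sup>2)"
  have M: "M \<ge> 0" by (simp add: M_def sum_nonneg)
  have LM: "(L c)\<^sup>2 \<le> M * (\<Sum>i\<in>A. (c i)\<^sup>2)" for c
    unfolding L_def M_def using Cauchy_Schwarz_ineq_sum[of c "\<lambda>i. B i a" A] by (simp add: mult.commute)
  \<comment> \<open>With \<open>e = c a + L c / b\<close> one has
    \<open>(c a)\<^sup>2 \<le> 2 * e\<^sup>2 + 2 * (L c / b)\<^sup>2\<close>. The first term is paid
    by \<open>b * e\<^sup>2\<close>, hence 2 / b; the second, together with the sum over A, is paid
    by the form on A, hence the quotient by k'.\<close>
  define K where "K = 2 / b + (1 + 2 * M / b\<^sup>2) / k'"
  have K: "K > 0" unfolding K_def using b k' M by (intro add_pos_pos divide_pos_pos add_pos_nonneg) auto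
  have bound: "1 / K * (\<Sum>i\<in>insert a A. (c i)\<^sup>2) \<le> (\<Sum>i\<in>insert a A. \<Sum>j\<in>insert a A. c i * c j * B i j)" for c
  proof -
    define S where "S = (\<Sum>i\<in>A. (c i)\<^sup>2)"
    define Q0 where "Q0 = (\<Sum>i\<in>A. \<Sum>j\<in>A. c i * c j * B' i j)"
    define e where "e = c a + L c / b"
    have kS: "k' * S \<le> Q0" unfolding S_def Q0_def by (rule k'(2))
    have S0: "S \<ge> 0" by (simp add: S_def sum_nonneg)
    have Q00: "Q0 \<ge> 0" using kS S0 k'(1) mult_nonneg_nonneg[of k' S] by linarith
    have "(c a)\<^sup>2 = (e - L c / b)\<^sup>2" by (simp add: e_def)
    also have "\<dots> \<le> 2 * e\<^sup>2 + 2 * (L c / b)\<^sup>2"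
      using zero_le_power2[of "e + L c / b"] by (simp add: power2_sum power2_diff)
    also have "(L c / b)\<^sup>2 \<le> M * S / b\<^sup>2" using LM[of c] by (simp add: power_divide S_def divide_right_mono)
    finally have "(c a)\<^sup>2 + S \<le> 2 * e\<^sup>2 + (1 + 2 * M / b\<^sup>2) * S" by (simp add: algebra_simps)
    also have "\<dots> = (2 / b) * (b * e\<^sup>2) + ((1 + 2 * M / b\<^sup>2) / k') * (k' * S)" using b k' by simp
    also have "\<dots> \<le> K * (b * e\<^sup>2) + K * Q0"
    proof (intro add_mono mult_mono kS)
      have n: "0 \<le> (1 + 2 * M / b\<^sup>2) / k'" "0 \<le> 2 / b" using b k' M by auto
      then show "2 / b \<le> K" "(1 + 2 * M / b\<^sup>2) / k' \<le> K" unfolding K_def by linarith+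
    qed (use b k' S0 K in auto)
    finally have "(c a)\<^sup>2 + S \<le> K * (b * e\<^sup>2 + Q0)" by (simp add: algebra_simps)
    then have "1 / K * ((c a)\<^sup>2 + S) \<le> b * e\<^sup>2 + Q0" using K by (simp add: field_simps)
    then show ?thesis unfolding Q S_def Q0_def e_def using insert.hyps by simp
  qed
  have "\<exists>c. \<forall>j\<in>insert a A. (\<Sum>i\<in>insert a A. c i * B i j) = F j" for F
  proof -
    obtain c0 where c0: "\<And>j. j \<in> A \<Longrightarrow> (\<Sum>i\<in>A. c0 i * B' i j) = F j - F a * B j a / b"
      using solve[of "\<lambda>j. F j - F a * B j a / b"] by blast
    \<comment> \<open>Back substitution: once the unknowns on A are found, the equation with index a
      determines the remaining one.\<close>
    define c where "c = c0(a := (F a - L c0) / b)"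
    have eqA: "c i = c0 i" if "i \<in> A" for i using that insert.hyps by (auto simp: c_def)
    have "(\<Sum>i\<in>insert a A. c i * B i j) = F j" if j: "j \<in> insert a A" for j
    proof (cases "j = a")
      case True
      have "(\<Sum>i\<in>insert a A. c i * B i a) = c a * b + L c0"
        using insert.hyps by (simp add: b_def L_def eqA)
      then show ?thesis using True b by (simp add: c_def)
    next
      case False
      then have jA: "j \<in> A" using j by simp
      have "(\<Sum>i\<in>A. c0 i * B i j) = (\<Sum>i\<in>A. c0 i * B' i j) + L c0 * B j a / b"
      proof -
        have "L c0 * B j a / b = (\<Sum>i\<in>A. c0 i * (B i a * B j a / b))"
          unfolding L_def sum_distrib_right sum_divide_distrib by (simp add: mult_ac)
        then show ?thesis by (simp add: B'_def right_diff_distrib sum_subtractf)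
      qed
      then have "(\<Sum>i\<in>insert a A. c i * B i j) = c a * B a j + (F j - F a * B j a / b) + L c0 * B j a / b"
        using insert.hyps c0[OF jA] by (simp add: eqA)
      also have "\<dots> = F j" unfolding sym[of a j] using b by (simp add: c_def field_simps)
      finally show ?thesis .
    qed
    then show ?thesis by blast
  qed
  then show ?case using bound K by (meson divide_pos_pos zero_less_one)
qed

section \<open>Integration by parts against test functions\<close>

lemma integral_partial_deriv_eq_0:
  fixes f :: "real^'d::finite \<Rightarrow> real"
  assumes d: "\<And>x. f differentiable at x" and c: "continuous_on UNIV (partial_deriv j f)"
    and bs: "bounded {x. f x \<noteq> 0}"
  shows "(\<integral>x. partial_deriv j f x \<partial>lborel) = 0"
proof -
  obtain R where R: "\<And>x. f x \<noteq> 0 \<Longrightarrow> norm x \<le> R" using bs unfolding bounded_iff by blast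
  have zero: "partial_deriv j f x = 0" if "R < norm x" for x
  proof (rule partial_deriv_zero_on_open[of "- cball 0 R"])
    show "open (- cball (0::real^'d) R)" by (intro open_Compl closed_cball)
  qed (use R that in \<open>force+\<close>)
  have "compact (partial_deriv j f ` cball 0 R)"
    by (intro compact_continuous_image) (use c continuous_on_subset in auto)
  then obtain C where C: "\<And>x. x \<in> cball 0 R \<Longrightarrow> \<bar>partial_deriv j f x\<bar> \<le> C" by (fastforce dest!: compact_imp_bounded simp: bounded_iff)
  have bound: "\<bar>partial_deriv j f x\<bar> \<le> \<bar>C\<bar> * indicator (cball 0 R) x" for x
    using C[of x] zero[of x] by (cases "norm x \<le> R") (auto simp: indicator_def)
  have cf: "continuous_on UNIV f" using d by (simp add: continuous_at_imp_continuous_on differentiable_imp_continuous_within)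
  have int: "integrable lborel f"
  proof -
    have "integrable lborel (\<lambda>x. indicator (cball 0 R) x *\<^sub>R f x)"
      by (intro borel_integrable_compact) (use cf continuous_on_subset in auto)
    moreover have "(\<lambda>x. indicator (cball 0 R) x *\<^sub>R f x) = f"
    proof
      show "indicator (cball 0 R) x *\<^sub>R f x = f x" for x using R[of x] by (cases "f x = 0") (auto simp: indicator_def)
    qed
    ultimately show ?thesis by simp
  qed
  define e where "e = (axis j 1 :: real^'d)"
  \<comment> \<open>By translation invariance the integral of \<open>f (v + x)\<close> does not
    depend on v, so its derivative along e is 0; differentiation under the integral sign identifies
    that derivative with the integral in question.\<close>
  have trans: "has_bochner_integral lborel (\<lambda>x. f (v + x)) (\<integral>x. f x \<partial>lborel)" for v
  proof -
    have [measurable]: "f \<in> borel_measurable borel" using cf by (rule borel_measurable_continuous_onI)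
    have "integrable (distr lborel borel ((+) v)) f" "(\<integral>x. f x \<partial>distr lborel borel ((+) v)) = (\<integral>x. f x \<partial>lborel)"
      using int by (simp_all add: lborel_distr_plus)
    then show ?thesis by (simp add: has_bochner_integral_iff integrable_distr_eq integral_distr)
  qed
  \<comment> \<open>The sine keeps the translations bounded, so that a single integrable majorant serves all of them.\<close>
  have "((\<lambda>t. \<integral>x. f (sin t *\<^sub>R e + x) \<partial>lborel) has_real_derivative
      (\<integral>x. cos 0 * partial_deriv j f (sin 0 *\<^sub>R e + x) \<partial>lborel)) (at 0)"
  proof (rule has_real_derivative_integral[where w = "\<lambda>x. \<bar>C\<bar> * indicator (cball 0 (R + 1)) x"
      and f' = "\<lambda>t x. cos t * partial_deriv j f (sin t *\<^sub>R e + x)"])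
    show "integrable lborel (\<lambda>x. f (sin t *\<^sub>R e + x))" for t using trans by (rule integrable.intros)
    have "emeasure lborel (cball (0::real^'d) (R + 1)) < \<infinity>" by (rule emeasure_bounded_finite) simp
    then show "integrable lborel (\<lambda>x::real^'d. \<bar>C\<bar> * indicator (cball 0 (R + 1)) x)" by simp
    fix t and x :: "real^'d"
    have "((\<lambda>t. sin t *\<^sub>R e + x) has_derivative (\<lambda>s. (cos t * s) *\<^sub>R e)) (at t)"
      by (auto intro!: derivative_eq_intros simp: mult.commute)
    moreover have D: "(f has_derivative frechet_derivative f (at (sin t *\<^sub>R e + x))) (at (sin t *\<^sub>R e + x))"
      using d frechet_derivative_works by blast
    ultimately have "((\<lambda>t. f (sin t *\<^sub>R e + x)) has_derivative
        (\<lambda>s. frechet_derivative f (at (sin t *\<^sub>R e + x)) ((cos t * s) *\<^sub>R e))) (at t)"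
      by (rule has_derivative_compose)
    then show "((\<lambda>t. f (sin t *\<^sub>R e + x)) has_real_derivative cos t * partial_deriv j f (sin t *\<^sub>R e + x)) (at t)"
      unfolding has_field_derivative_def
      by (rule has_derivative_eq_rhs)
        (simp add: fun_eq_iff partial_deriv_def e_def linear_cmul[OF has_derivative_linear[OF D, unfolded e_def]] mult_ac)
    have "\<bar>cos t * partial_deriv j f (sin t *\<^sub>R e + x)\<bar> \<le> 1 * (\<bar>C\<bar> * indicator (cball 0 R) (sin t *\<^sub>R e + x))"
      unfolding abs_mult by (intro mult_mono bound) auto
    also have "\<dots> \<le> \<bar>C\<bar> * indicator (cball 0 (R + 1)) x"
    proof -
      have "norm x \<le> norm (sin t *\<^sub>R e + x) + norm (sin t *\<^sub>R e)"
        using norm_triangle_ineq4[of "sin t *\<^sub>R e + x" "sin t *\<^sub>R e"] by simp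
      moreover have "norm (sin t *\<^sub>R e) \<le> 1" by (simp add: e_def norm_axis_1)
      ultimately show ?thesis by (auto simp: indicator_def)
    qed
    finally show "\<bar>cos t * partial_deriv j f (sin t *\<^sub>R e + x)\<bar> \<le> \<bar>C\<bar> * indicator (cball 0 (R + 1)) x" .
  qed
  moreover have "(\<lambda>t. \<integral>x. f (sin t *\<^sub>R e + x) \<partial>lborel) = (\<lambda>t. \<integral>x. f x \<partial>lborel)"
    using has_bochner_integral_integral_eq[OF trans] by auto
  ultimately show ?thesis using DERIV_unique[OF _ DERIV_const] by fastforce
qed

context bounded_open
begin

lemma si_continuous:
  assumes "continuous_on UNIV f" shows "square_integrable T f"
proof -
  have "compact (f ` closure T)" by (intro compact_continuous_image) (use assms continuous_on_subset bounded_T in auto)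
  then obtain C where C: "\<And>x. x \<in> closure T \<Longrightarrow> \<bar>f x\<bar> \<le> C" by (fastforce dest!: compact_imp_bounded simp: bounded_iff)
  have m: "f \<in> borel_measurable (lebesgue_on T)"
    using borel_measurable_continuous_onI[OF assms] by (simp add: measurable_completion measurable_restrict_space1)
  have "integrable (lebesgue_on T) (\<lambda>x. (f x)\<^sup>2)"
  proof (rule finite_measure.integrable_const_bound[OF finite_measure_T, of _ "C\<^sup>2"])
    show "AE x in lebesgue_on T. norm ((f x)\<^sup>2) \<le> C\<^sup>2"
    proof (rule AE_I2)
      fix x assume "x \<in> space (lebesgue_on T)"
      then have "\<bar>f x\<bar> \<le> C" using C closure_subset[of T] by auto
      then have "\<bar>f x\<bar>\<^sup>2 \<le> C\<^sup>2" by (intro power_mono) auto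
      then show "norm ((f x)\<^sup>2) \<le> C\<^sup>2" by simp
    qed
  qed (use m in simp)
  then show ?thesis using m by (simp add: si_iff)
qed

lemma si_poly: "p \<in> poly_space l \<Longrightarrow> square_integrable T p"
  by (rule si_continuous[OF continuous_on_poly])

lemma integral_eq_lborel:
  fixes f :: "real^'d \<Rightarrow> real"
  assumes "f \<in> borel_measurable borel" "\<And>x. x \<notin> T \<Longrightarrow> f x = 0"
  shows "(\<integral>x. f x \<partial>lebesgue_on T) = (\<integral>x. f x \<partial>lborel)"
proof -
  have "(\<lambda>x. indicator T x *\<^sub>R f x) = f" using assms(2) by (force simp: indicator_def)
  then show ?thesis using assms(1) by (simp add: integral_restrict_space integral_completion)
qed

text \<open>The product of p and \<phi> vanishes off the bounded set T, so its derivative has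
  integral 0 over the whole space, and the product rule splits this integral.\<close>

lemma poly_integration_by_parts:
  assumes p: "p \<in> poly_space l" and \<phi>: "\<phi> \<in> test_functions T"
  shows "(\<integral>x. p x * partial_deriv j \<phi> x \<partial>lebesgue_on T) = - (\<integral>x. partial_deriv j p x * \<phi> x \<partial>lebesgue_on T)"
proof -
  have d\<phi>: "\<phi> differentiable at x" for x
    using \<phi> smooth_fun_differentiable by (auto simp: test_functions_def)
  have vanish: "\<phi> x = 0" if "x \<notin> T" for x
    using \<phi> that closure_subset[of "{x. \<phi> x \<noteq> 0}"] by (auto simp: test_functions_def)
  have vanish': "partial_deriv j \<phi> x = 0" if "x \<notin> T" for x
    using test_function_partial_deriv[OF \<phi>, of j] that closure_subset[of "{x. partial_deriv j \<phi> x \<noteq> 0}"]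
    by (auto simp: test_functions_def)
  have cont: "continuous_on UNIV \<phi>" "continuous_on UNIV (partial_deriv j \<phi>)"
      "continuous_on UNIV p" "continuous_on UNIV (partial_deriv j p)"
    using test_function_continuous[OF \<phi>, of "[]"] test_function_continuous[OF \<phi>, of "[j]"]
      continuous_on_poly[OF p] continuous_on_poly[OF partial_deriv_in_poly_space[OF p]] by simp_all
  have pd: "partial_deriv j (\<lambda>x. p x * \<phi> x) x = p x * partial_deriv j \<phi> x + partial_deriv j p x * \<phi> x" for x
  proof -
    have "((\<lambda>x. p x * \<phi> x) has_derivative (\<lambda>v. p x * frechet_derivative \<phi> (at x) v + frechet_derivative p (at x) v * \<phi> x)) (at x)"
      by (intro has_derivative_mult) (use d\<phi> poly_differentiable[OF p] frechet_derivative_works in blast)+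
    from partial_deriv_eq[OF this] show ?thesis by (simp add: partial_deriv_def)
  qed
  have "(\<integral>x. partial_deriv j (\<lambda>x. p x * \<phi> x) x \<partial>lborel) = 0"
  proof (rule integral_partial_deriv_eq_0)
    show "(\<lambda>x. p x * \<phi> x) differentiable at x" for x
      by (intro differentiable_mult d\<phi> poly_differentiable[OF p])
    show "continuous_on UNIV (partial_deriv j (\<lambda>x. p x * \<phi> x))"
      unfolding pd by (intro continuous_intros cont)
    show "bounded {x. p x * \<phi> x \<noteq> 0}" by (rule bounded_subset[OF bounded_T]) (use vanish in auto)
  qed
  moreover have "(\<integral>x. p x * partial_deriv j \<phi> x + partial_deriv j p x * \<phi> x \<partial>lebesgue_on T) =
      (\<integral>x. partial_deriv j (\<lambda>x. p x * \<phi> x) x \<partial>lborel)"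
    unfolding pd using vanish vanish'
    by (intro integral_eq_lborel borel_measurable_continuous_onI continuous_intros cont) auto
  moreover have "integrable (lebesgue_on T) (\<lambda>x. p x * partial_deriv j \<phi> x)" "integrable (lebesgue_on T) (\<lambda>x. partial_deriv j p x * \<phi> x)"
    by (intro si_mult si_continuous cont)+
  ultimately show ?thesis by simp
qed

text \<open>Each step takes the outermost derivative off \<phi> and makes it the innermost one on p;
  hence the reversed list.\<close>

lemma poly_integration_by_parts_iterated:
  assumes "p \<in> poly_space l" "\<phi> \<in> test_functions T"
  shows "(\<integral>x. p x * foldr partial_deriv js \<phi> x \<partial>lebesgue_on T) =
    (- 1) ^ length js * (\<integral>x. foldr partial_deriv (rev js) p x * \<phi> x \<partial>lebesgue_on T)"
  using assms(1)
proof (induction js arbitrary: p)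
  case (Cons j js)
  have "(\<integral>x. p x * foldr partial_deriv (j # js) \<phi> x \<partial>lebesgue_on T) =
      - (\<integral>x. partial_deriv j p x * foldr partial_deriv js \<phi> x \<partial>lebesgue_on T)"
    using poly_integration_by_parts[OF Cons.prems test_function_foldr[OF assms(2)]] by simp
  then show ?case using Cons.IH[OF partial_deriv_in_poly_space[OF Cons.prems]] by simp
qed simp

lemma has_weak_deriv_poly:
  assumes p: "p \<in> poly_space l"
  shows "has_weak_deriv T \<alpha> p (poly_deriv \<alpha> p)"
  unfolding has_weak_deriv_iff
proof (intro conjI ballI allI impI)
  show "locally_integrable T p" "locally_integrable T (poly_deriv \<alpha> p)"
    using si_poly[OF p] si_poly[OF poly_deriv_in_poly_space[OF p]] by (simp_all add: si_locally_integrable)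
  fix \<phi> and js :: "'d list" assume \<phi>: "\<phi> \<in> test_functions T" and js: "count_list js = \<alpha>"
  have "length js = sum \<alpha> UNIV" using sum_count_set[of js UNIV] js by simp
  moreover have "foldr partial_deriv (rev js) p = poly_deriv \<alpha> p"
    using foldr_partial_deriv_eq_poly_deriv[OF p, of "rev js"] js by (simp add: count_list_rev[abs_def] cong: if_cong)
  ultimately show "(\<integral>x. p x * foldr partial_deriv js \<phi> x \<partial>lebesgue_on T) =
      (- 1) ^ sum \<alpha> UNIV * (\<integral>x. poly_deriv \<alpha> p x * \<phi> x \<partial>lebesgue_on T)"
    using poly_integration_by_parts_iterated[OF p \<phi>, of js] by simp
qed

end

section \<open>Scaling and the inverse inequality for polynomials\<close>

context bounded_open
begin

lemma ennreal_sq_norm: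
  assumes "square_integrable T f"
  shows "ennreal (sq_norm T f) = (\<integral>\<^sup>+x. ennreal ((f x)\<^sup>2) * indicator T x \<partial>lborel)"
proof -
  have "ennreal (sq_norm T f) = (\<integral>\<^sup>+x. ennreal ((f x)\<^sup>2) \<partial>lebesgue_on T)"
    unfolding sq_norm_def by (rule nn_integral_eq_integral[symmetric]) (use si_square[OF assms] in auto)
  also have "\<dots> = (\<integral>\<^sup>+x. ennreal ((f x)\<^sup>2) * indicator T x \<partial>lebesgue)"
    by (rule nn_integral_restrict_space) simp
  finally show ?thesis by (simp add: nn_integral_completion)
qed

text \<open>By continuity a nonzero value persists on a nonempty open subset of T, and such a set is
  not negligible.\<close>

lemma sq_norm_zero_imp_zero:
  assumes c: "continuous_on UNIV f" and z: "sq_norm T f = 0" and x: "x \<in> T"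
  shows "f x = 0"
proof (rule ccontr)
  assume "f x \<noteq> 0"
  define N where "N = T \<inter> {x. f x \<noteq> 0}"
  have "open {x. f x \<noteq> 0}" using c by (intro open_Collect_neq continuous_intros)
  then have N: "open N" "N \<noteq> {}" using open_T x \<open>f x \<noteq> 0\<close> by (auto simp: N_def)
  have "(\<integral>x. (f x)\<^sup>2 \<partial>lebesgue_on T) = 0" using z by (simp add: sq_norm_def)
  then have "AE x in lebesgue_on T. (f x)\<^sup>2 = 0"
    by (subst (asm) integral_nonneg_eq_0_iff_AE[OF si_square[OF si_continuous[OF c]]]) auto
  then have "AE x in lebesgue. x \<in> T \<longrightarrow> f x = 0" by (simp add: AE_restrict_space_iff)
  then have "AE x in lebesgue. x \<notin> N" by eventually_elim (auto simp: N_def)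
  then have "N \<in> null_sets lebesgue" by (simp add: completion.null_sets_iff_AE)
  then show False using open_not_negligible[OF N] by (simp add: negligible_iff_null_sets)
qed

lemma sq_norm_le_bound:
  assumes "square_integrable T f" "\<And>x. x \<in> T \<Longrightarrow> (f x)\<^sup>2 \<le> C"
  shows "sq_norm T f \<le> C * measure lebesgue T"
proof -
  have "sq_norm T f \<le> (\<integral>x. C \<partial>lebesgue_on T)"
    unfolding sq_norm_def by (rule integral_mono) (use assms si_square in auto)
  then show ?thesis by (simp only: integral_const)
qed

end

lemma sq_norm_subset_le:
  assumes "bounded_open S" "bounded_open T" "S \<subseteq> T" "continuous_on UNIV f"
  shows "sq_norm S f \<le> sq_norm T f"
proof -
  interpret S: bounded_open S by fact
  interpret T: bounded_open T by fact
  have "ennreal (sq_norm S f) \<le> ennreal (sq_norm T f)"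
    unfolding S.ennreal_sq_norm[OF S.si_continuous[OF assms(4)]] T.ennreal_sq_norm[OF T.si_continuous[OF assms(4)]]
    by (intro nn_integral_mono) (use assms(3) in \<open>auto simp: indicator_def\<close>)
  then show ?thesis by (simp add: T.sq_norm_nonneg)
qed

lemma bounded_open_ball: "bounded_open (ball (a :: real^'d::finite) r)"
  by unfold_locales auto

lemma sq_norm_ball_scale:
  fixes a :: "real^'d::finite"
  assumes c: "continuous_on UNIV f" and h: "h > 0"
  shows "sq_norm (ball a (\<rho> * h)) f = h ^ CARD('d) * sq_norm (ball 0 \<rho>) (\<lambda>z. f (a + h *\<^sub>R z))"
proof -
  interpret A: bounded_open "ball a (\<rho> * h)" by (rule bounded_open_ball)
  interpret B: bounded_open "ball (0 :: real^'d) \<rho>" by (rule bounded_open_ball)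
  have [measurable]: "f \<in> borel_measurable borel" using c by (rule borel_measurable_continuous_onI)
  have [measurable]: "ball a (\<rho> * h) \<in> sets borel" by simp
  have h0: "h \<noteq> 0" using h by simp
  have c': "continuous_on UNIV (\<lambda>z. f (a + h *\<^sub>R z))"
    by (rule continuous_on_compose2[OF c]) (auto intro!: continuous_intros)
  have b: "a + h *\<^sub>R z \<in> ball a (\<rho> * h) \<longleftrightarrow> z \<in> ball 0 \<rho>" for z
    using h by (simp add: dist_norm mult.commute)
  have "ennreal (sq_norm (ball a (\<rho> * h)) f) =
      ennreal (\<bar>h\<bar> ^ DIM(real^'d)) * (\<integral>\<^sup>+z. ennreal ((f (a + h *\<^sub>R z))\<^sup>2) * indicator (ball a (\<rho> * h)) (a + h *\<^sub>R z) \<partial>lborel)"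
    unfolding A.ennreal_sq_norm[OF A.si_continuous[OF c]] by (rule nn_integral_lborel_affine[OF _ h0]) measurable
  also have "(\<integral>\<^sup>+z. ennreal ((f (a + h *\<^sub>R z))\<^sup>2) * indicator (ball a (\<rho> * h)) (a + h *\<^sub>R z) \<partial>lborel) =
     ennreal (sq_norm (ball 0 \<rho>) (\<lambda>z. f (a + h *\<^sub>R z)))"
    unfolding B.ennreal_sq_norm[OF B.si_continuous[OF c']]
    by (intro nn_integral_cong) (simp only: indicator_def b)
  finally have "ennreal (sq_norm (ball a (\<rho> * h)) f) = ennreal (h ^ CARD('d) * sq_norm (ball 0 \<rho>) (\<lambda>z. f (a + h *\<^sub>R z)))"
    using h by (simp add: ennreal_mult B.sq_norm_nonneg)
  then show ?thesis using h by (subst (asm) ennreal_inj) (auto simp: A.sq_norm_nonneg B.sq_norm_nonneg)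
qed

text \<open>The Gram matrix of the monomials on the ball is positive definite: a polynomial of norm
  0 vanishes on the ball and therefore has zero coefficients.\<close>

lemma coefficient_bound:
  assumes \<rho>: "\<rho> > 0"
  shows "\<exists>k>0. \<forall>c :: ('d::finite \<Rightarrow> nat) \<Rightarrow> real.
    k * (\<Sum>\<beta>\<in>index_set l. (c \<beta>)\<^sup>2) \<le> sq_norm (ball 0 \<rho>) (\<lambda>x. \<Sum>\<beta>\<in>index_set l. c \<beta> * monomial \<beta> x)"
proof -
  interpret B: bounded_open "ball (0 :: real^'d) \<rho>" by (rule bounded_open_ball)
  define G where "G = (\<lambda>\<beta> \<gamma>. \<integral>x. monomial \<beta> x * monomial \<gamma> x \<partial>lebesgue_on (ball (0 :: real^'d) \<rho>))"
  have si: "square_integrable (ball 0 \<rho>) (monomial \<beta> :: real^'d \<Rightarrow> real)" for \<beta>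
    by (rule B.si_poly[OF monomial_in_poly_space[OF order_refl]])
  have Q: "sq_norm (ball 0 \<rho>) (\<lambda>x. \<Sum>\<beta>\<in>index_set l. c \<beta> * monomial \<beta> x) =
    (\<Sum>\<beta>\<in>index_set l. \<Sum>\<gamma>\<in>index_set l. c \<beta> * c \<gamma> * G \<beta> \<gamma>)" for c :: "('d \<Rightarrow> nat) \<Rightarrow> real"
  proof -
    have "sq_norm (ball 0 \<rho>) (\<lambda>x. \<Sum>\<beta>\<in>index_set l. c \<beta> * monomial \<beta> x) =
      (\<integral>x. (\<Sum>\<beta>\<in>index_set l. \<Sum>\<gamma>\<in>index_set l. (c \<beta> * c \<gamma>) * (monomial \<beta> x * monomial \<gamma> x)) \<partial>lebesgue_on (ball (0 :: real^'d) \<rho>))"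
      unfolding sq_norm_def power2_eq_square sum_product by (simp add: mult_ac)
    then show ?thesis by (simp add: G_def B.si_mult[OF si si])
  qed
  have "(\<exists>k>0. \<forall>c. k * (\<Sum>i\<in>index_set l. (c i)\<^sup>2) \<le> (\<Sum>i\<in>index_set l. \<Sum>j\<in>index_set l. c i * c j * G i j)) \<and>
    (\<forall>F. \<exists>c. \<forall>j\<in>index_set l. (\<Sum>i\<in>index_set l. c i * G i j) = F j)"
  proof (rule positive_definite_form)
    show "G i j = G j i" for i j by (simp add: G_def mult.commute)
    fix c :: "('d \<Rightarrow> nat) \<Rightarrow> real" and i assume i: "i \<in> index_set l" "c i \<noteq> 0"
    define p where "p = (\<lambda>x. \<Sum>\<beta>\<in>index_set l. c \<beta> * monomial \<beta> x)"
    have "sq_norm (ball 0 \<rho>) p \<noteq> 0"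
    proof
      assume "sq_norm (ball 0 \<rho>) p = 0"
      then have z: "(\<Sum>\<beta>\<in>index_set l. c \<beta> * monomial \<beta> x) = 0" if "x \<in> ball 0 \<rho>" for x
        using B.sq_norm_zero_imp_zero[OF continuous_on_poly[OF poly_space_sum_monomials]] that unfolding p_def by blast
      have "0 \<in> ball (0::real^'d) \<rho>" using \<rho> by simp
      from coefficients_zero[OF open_ball this z i(1)] have "c i = 0" .
      then show False using i by simp
    qed
    then show "0 < (\<Sum>i\<in>index_set l. \<Sum>j\<in>index_set l. c i * c j * G i j)"
      unfolding Q[symmetric] p_def[symmetric] using B.sq_norm_nonneg[of p] by linarith
  qed simp
  then show ?thesis unfolding Q by blast
qed

text \<open>After translation by a and scaling by h, T lies in the closed unit ball and contains the
  ball of radius \<rho>. The pointwise bound is therefore on the large ball and the norm on the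
  small one, so the shape of T does not enter.\<close>

lemma reference_inverse_inequality:
  assumes \<rho>: "\<rho> > 0"
  shows "\<exists>K\<ge>0. \<forall>q\<in>poly_space l. \<forall>j. \<forall>z\<in>cball (0 :: real^'d::finite) 1.
    (partial_deriv j q z)\<^sup>2 \<le> K * sq_norm (ball 0 \<rho>) q"
proof -
  obtain k where k: "k > 0" "\<And>c :: ('d \<Rightarrow> nat) \<Rightarrow> real. k * (\<Sum>\<beta>\<in>index_set l. (c \<beta>)\<^sup>2) \<le>
      sq_norm (ball 0 \<rho>) (\<lambda>x. \<Sum>\<beta>\<in>index_set l. c \<beta> * monomial \<beta> x)"
    using coefficient_bound[OF \<rho>] by blast
  define D where "D = (\<lambda>z::real^'d. \<Sum>j\<in>UNIV. \<Sum>\<beta>\<in>index_set l. (monomial_deriv (unit_index j) \<beta> z)\<^sup>2)"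
  have "continuous_on (cball 0 1) D" unfolding D_def
    by (intro continuous_intros continuous_on_poly[OF monomial_deriv_in_poly_space[OF order_refl]])
  then have "compact (D ` cball 0 1)" by (intro compact_continuous_image) auto
  then obtain M where M: "\<And>z. z \<in> cball 0 1 \<Longrightarrow> \<bar>D z\<bar> \<le> M" by (fastforce dest!: compact_imp_bounded simp: bounded_iff)
  have M0: "M \<ge> 0" using M[of 0] by force
  have "(partial_deriv j q z)\<^sup>2 \<le> M / k * sq_norm (ball 0 \<rho>) q"
    if q: "q \<in> poly_space l" and z: "z \<in> cball 0 1" for q :: "real^'d \<Rightarrow> real" and j z
  proof -
    obtain c where c: "q = (\<lambda>x. \<Sum>\<beta>\<in>index_set l. c \<beta> * monomial \<beta> x)" using q by (auto simp: poly_space_iff)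
    have "(partial_deriv j q z)\<^sup>2 = (\<Sum>\<beta>\<in>index_set l. c \<beta> * monomial_deriv (unit_index j) \<beta> z)\<^sup>2"
      unfolding partial_deriv_eq_poly_deriv[OF q] by (simp add: c poly_deriv_eq)
    also have "\<dots> \<le> (\<Sum>\<beta>\<in>index_set l. (c \<beta>)\<^sup>2) * (\<Sum>\<beta>\<in>index_set l. (monomial_deriv (unit_index j) \<beta> z)\<^sup>2)"
      by (rule Cauchy_Schwarz_ineq_sum)
    also have "\<dots> \<le> (sq_norm (ball 0 \<rho>) q / k) * M"
    proof (intro mult_mono)
      show "(\<Sum>\<beta>\<in>index_set l. (c \<beta>)\<^sup>2) \<le> sq_norm (ball 0 \<rho>) q / k"
        using k(2)[of c] k(1) by (simp add: c field_simps)
      then show "0 \<le> sq_norm (ball 0 \<rho>) q / k" by (rule order_trans[rotated]) (simp add: sum_nonneg)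
      have "(\<Sum>\<beta>\<in>index_set l. (monomial_deriv (unit_index j) \<beta> z)\<^sup>2) \<le> D z"
        unfolding D_def by (rule member_le_sum) (auto intro: sum_nonneg)
      then show "(\<Sum>\<beta>\<in>index_set l. (monomial_deriv (unit_index j) \<beta> z)\<^sup>2) \<le> M" using M[OF z] by linarith
    qed (auto intro: sum_nonneg)
    finally show ?thesis by (simp add: mult.commute)
  qed
  moreover have "M / k \<ge> 0" using M0 k(1) by simp
  ultimately show ?thesis by blast
qed

lemma partial_deriv_affine:
  fixes a :: "real^'d::finite"
  assumes "p \<in> poly_space l"
  shows "partial_deriv j (\<lambda>z. p (a + h *\<^sub>R z)) z = h * partial_deriv j p (a + h *\<^sub>R z)"
proof -
  have D: "(p has_derivative frechet_derivative p (at (a + h *\<^sub>R z))) (at (a + h *\<^sub>R z))"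
    using poly_differentiable[OF assms] frechet_derivative_works by blast
  have "((\<lambda>z. a + h *\<^sub>R z) has_derivative (\<lambda>v. h *\<^sub>R v)) (at z)" by (auto intro!: derivative_eq_intros)
  from partial_deriv_eq[OF has_derivative_compose[OF this D]] show ?thesis
    using linear_cmul[OF has_derivative_linear[OF D], of h "axis j 1"] by (simp add: partial_deriv_def)
qed

context star_domain
begin

lemma a_in_T: "a \<in> T" using ball_subset r_pos by auto

lemma T_subset_cball: "T \<subseteq> cball a h"
  using diam[OF _ a_in_T] by (auto simp: dist_norm)

lemma measure_T_le: "measure lebesgue T \<le> h ^ CARD('d) * measure lebesgue (ball (0::real^'d) 1)"
proof -
  have "measure lebesgue T \<le> measure lebesgue (cball a h)"
    using T_subset_cball by (intro measure_mono_fmeasurable) auto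
  also have "\<dots> = h ^ CARD('d) * measure lebesgue (ball (0::real^'d) 1)"
    using content_cball_conv_ball[of a h] content_ball_conv_unit_ball[of h a] h_pos by (simp add: measure_completion)
  finally show ?thesis .
qed

end

text \<open>Integrating the pointwise bound over T costs the measure of T, at most h^d times that of
  the unit ball, and this cancels the h^-d of the scaled norm. The chain rule leaves h^-2.\<close>

theorem inverse_inequality:
  assumes \<rho>: "\<rho> > 0"
  shows "\<exists>K\<ge>0. \<forall>(T :: (real^'d::finite) set) a h. star_domain T a (\<rho> * h) h \<longrightarrow>
    (\<forall>p\<in>poly_space l. \<forall>j. sq_norm T (partial_deriv j p) \<le> K / h\<^sup>2 * sq_norm T p)"
proof -
  obtain K where K: "K \<ge> 0" "\<And>q j z. q \<in> poly_space l \<Longrightarrow> z \<in> cball (0 :: real^'d) 1 \<Longrightarrow>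
    (partial_deriv j q z)\<^sup>2 \<le> K * sq_norm (ball 0 \<rho>) q"
    using reference_inverse_inequality[OF \<rho>] by blast
  define V where "V = measure lebesgue (ball (0::real^'d) 1)"
  have V: "V \<ge> 0" by (simp add: V_def)
  have "sq_norm T (partial_deriv j p) \<le> V * K / h\<^sup>2 * sq_norm T p"
    if sd: "star_domain T a (\<rho> * h) h" and p: "p \<in> poly_space l" for T :: "(real^'d) set" and a h p j
  proof -
    interpret star_domain T a "\<rho> * h" h by fact
    define S where "S = sq_norm (ball a (\<rho> * h)) p"
    have S: "0 \<le> S" "S \<le> sq_norm T p"
      unfolding S_def using bounded_open.sq_norm_nonneg[OF bounded_open_ball]
        sq_norm_subset_le[OF bounded_open_ball bounded_open_axioms ball_subset continuous_on_poly[OF p]] by auto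
    have "(partial_deriv j p x)\<^sup>2 \<le> K * S / (h\<^sup>2 * h ^ CARD('d))" if x: "x \<in> T" for x
    proof -
      define z where "z = (1 / h) *\<^sub>R (x - a)"
      have xz: "x = a + h *\<^sub>R z" using h_pos by (simp add: z_def)
      have "norm (x - a) \<le> h" using T_subset_cball x by (auto simp: dist_norm norm_minus_commute)
      then have z: "z \<in> cball 0 1" using h_pos by (simp add: z_def)
      have "(h * partial_deriv j p x)\<^sup>2 \<le> K * sq_norm (ball 0 \<rho>) (\<lambda>z. p (a + h *\<^sub>R z))"
        using K(2)[OF poly_space_affine[OF p] z, where j = j] partial_deriv_affine[OF p] by (simp add: xz)
      also have "sq_norm (ball 0 \<rho>) (\<lambda>z. p (a + h *\<^sub>R z)) = S / h ^ CARD('d)"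
        using h_pos by (simp add: S_def sq_norm_ball_scale[OF continuous_on_poly[OF p] h_pos])
      finally show ?thesis using h_pos by (simp add: power_mult_distrib field_simps)
    qed
    then have "sq_norm T (partial_deriv j p) \<le> K * S / (h\<^sup>2 * h ^ CARD('d)) * measure lebesgue T"
      by (intro sq_norm_le_bound si_poly[OF partial_deriv_in_poly_space[OF p]])
    also have "\<dots> \<le> K * S / (h\<^sup>2 * h ^ CARD('d)) * (h ^ CARD('d) * V)"
      using measure_T_le K(1) S h_pos by (intro mult_left_mono) (auto simp: V_def)
    also have "\<dots> = V * K / h\<^sup>2 * S" using h_pos by simp
    also have "\<dots> \<le> V * K / h\<^sup>2 * sq_norm T p" using S V K(1) by (intro mult_left_mono) auto
    finally show ?thesis .
  qed
  moreover have "V * K \<ge> 0" using V K(1) by simp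
  ultimately show ?thesis by blast
qed

text \<open>T lies in the closed ball of radius h around a, so the measures of T and of the ball of
  centres have a quotient of at most 1 / \<rho>^d.\<close>

lemma poincare_const_le:
  assumes sd: "star_domain (T :: (real^'d::finite) set) a (\<rho> * h) h" and \<rho>: "\<rho> > 0"
  shows "star_domain.poincare_const T a (\<rho> * h) \<le> 2 ^ CARD('d) * (1 + 1 / \<rho> ^ CARD('d))"
proof -
  interpret star_domain T a "\<rho> * h" h by fact
  define V where "V = measure lebesgue (ball (0::real^'d) 1)"
  have V: "V > 0" using content_ball_pos[of 1 "0::real^'d"] by (simp add: V_def)
  have B: "measure lebesgue (ball a (\<rho> * h)) = (\<rho> * h) ^ CARD('d) * V"
    using content_ball_conv_unit_ball[of "\<rho> * h" a] r_pos by (simp add: V_def)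
  have Bp: "(\<rho> * h) ^ CARD('d) * V > 0" using r_pos V by simp
  have "((\<rho> * h) ^ CARD('d) * V + measure lebesgue T) / ((\<rho> * h) ^ CARD('d) * V) \<le>
    ((\<rho> * h) ^ CARD('d) * V + h ^ CARD('d) * V) / ((\<rho> * h) ^ CARD('d) * V)"
    using Bp measure_T_le by (intro divide_right_mono add_left_mono) (auto simp: V_def)
  also have "\<dots> = 1 + 1 / \<rho> ^ CARD('d)" using V \<rho> h_pos by (simp add: field_simps power_mult_distrib)
  finally have "2 ^ CARD('d) * (((\<rho> * h) ^ CARD('d) * V + measure lebesgue T) / ((\<rho> * h) ^ CARD('d) * V)) \<le> 2 ^ CARD('d) * (1 + 1 / \<rho> ^ CARD('d))"
    by (intro mult_left_mono) auto
  then show ?thesis unfolding poincare_const_def B by (simp only: times_divide_eq_right)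
qed

subsection \<open>Polynomial approximation in Sobolev spaces\<close>

lemma finite_order_eq [simp]: "finite {\<alpha> :: 'd::finite \<Rightarrow> nat. sum \<alpha> UNIV = m}"
  by (rule finite_subset[OF _ finite_index_set[of m]]) (auto simp: index_set_def)

lemma sum_Suc_upd: "sum (\<alpha>(j := Suc (\<alpha> j))) UNIV = Suc (sum \<alpha> (UNIV :: 'd::finite set))"
  by (subst (1 2) sum.remove[of UNIV j]) auto

lemma inj_Suc_upd: "inj (\<lambda>\<alpha> :: 'd \<Rightarrow> nat. \<alpha>(j := Suc (\<alpha> j)))"
proof (rule injI, rule ext)
  fix \<alpha> \<beta> :: "'d \<Rightarrow> nat" and i
  assume "\<alpha>(j := Suc (\<alpha> j)) = \<beta>(j := Suc (\<beta> j))"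
  from fun_cong[OF this, of i] show "\<alpha> i = \<beta> i" by (auto split: if_splits)
qed

text \<open>For fixed j, raising the j-th entry is injective, so no term is counted twice.\<close>

lemma sum_Suc_upd_le:
  fixes f :: "('d::finite \<Rightarrow> nat) \<Rightarrow> real"
  assumes "\<And>\<alpha>. f \<alpha> \<ge> 0"
  shows "(\<Sum>\<alpha> | sum \<alpha> UNIV = m. f (\<alpha>(j := Suc (\<alpha> j)))) \<le> (\<Sum>\<alpha> | sum \<alpha> UNIV = Suc m. f \<alpha>)"
proof -
  have "(\<Sum>\<alpha> | sum \<alpha> UNIV = m. f (\<alpha>(j := Suc (\<alpha> j)))) =
      sum f ((\<lambda>\<alpha>. \<alpha>(j := Suc (\<alpha> j))) ` {\<alpha>. sum \<alpha> UNIV = m})"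
    by (subst sum.reindex) (auto intro: inj_on_subset[OF inj_Suc_upd])
  also have "\<dots> \<le> (\<Sum>\<alpha> | sum \<alpha> UNIV = Suc m. f \<alpha>)"
    by (rule sum_mono2) (auto simp: sum_Suc_upd assms simp del: fun_upd_apply)
  finally show ?thesis .
qed

text \<open>Every index of order m + 1 arises by raising some entry of an index of order m, possibly
  in several ways; the multiple counting only enlarges the right-hand side.\<close>

lemma sum_Suc_order_le:
  fixes f :: "('d::finite \<Rightarrow> nat) \<Rightarrow> real"
  assumes "\<And>\<alpha>. f \<alpha> \<ge> 0"
  shows "(\<Sum>\<alpha> | sum \<alpha> UNIV = Suc m. f \<alpha>) \<le> (\<Sum>j\<in>UNIV. \<Sum>\<alpha> | sum \<alpha> UNIV = m. f (\<alpha>(j := Suc (\<alpha> j))))"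
proof -
  define I where "I = (UNIV :: 'd set) \<times> {\<alpha> :: 'd \<Rightarrow> nat. sum \<alpha> UNIV = m}"
  define S where "S = (\<lambda>(j, \<alpha> :: 'd \<Rightarrow> nat). \<alpha>(j := Suc (\<alpha> j)))"
  have "{\<alpha> :: 'd \<Rightarrow> nat. sum \<alpha> UNIV = Suc m} \<subseteq> S ` I"
  proof
    fix \<alpha> :: "'d \<Rightarrow> nat" assume "\<alpha> \<in> {\<alpha>. sum \<alpha> UNIV = Suc m}"
    then have s: "sum \<alpha> UNIV = Suc m" by simp
    then obtain j where j: "\<alpha> j \<noteq> 0" by (metis Zero_not_Suc sum.neutral)
    define \<beta> where "\<beta> = \<alpha>(j := \<alpha> j - 1)"
    have e: "\<beta>(j := Suc (\<beta> j)) = \<alpha>" using j by (auto simp: \<beta>_def)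
    then have "sum \<beta> UNIV = m" using sum_Suc_upd[of \<beta> j] s by simp
    then have "(j, \<beta>) \<in> I" by (simp add: I_def)
    moreover have "\<alpha> = S (j, \<beta>)" using e by (simp add: S_def)
    ultimately show "\<alpha> \<in> S ` I" by blast
  qed
  then have "(\<Sum>\<alpha> | sum \<alpha> UNIV = Suc m. f \<alpha>) \<le> sum f (S ` I)"
    by (rule sum_mono2[rotated]) (auto simp: I_def assms)
  also have "\<dots> \<le> sum (f \<circ> S) I"
    by (rule sum_image_le) (auto simp: I_def assms)
  also have "\<dots> = (\<Sum>j\<in>UNIV. \<Sum>\<alpha> | sum \<alpha> UNIV = m. f (\<alpha>(j := Suc (\<alpha> j))))"
    by (simp add: I_def S_def sum.cartesian_product split_def)
  finally show ?thesis .
qed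

text \<open>Derivatives of order n of the monomials of order n form a diagonal matrix of constants,
  which is what makes means of top order freely prescribable.\<close>

lemma monomial_deriv_same_order:
  assumes "sum \<alpha> UNIV = sum \<beta> (UNIV :: 'd::finite set)"
  shows "monomial_deriv \<alpha> \<beta> x = (if \<alpha> = \<beta> then (\<Prod>i\<in>UNIV. fact (\<beta> i)) else 0)"
proof (cases "\<alpha> = \<beta>")
  case True
  have "power_deriv n n t = fact n" for n t
    using power_deriv_at_0[of n n] by (simp add: power_deriv_def)
  then show ?thesis using True by (simp add: monomial_deriv_def)
next
  case False
  have "\<exists>i. \<beta> i < \<alpha> i"
  proof (rule ccontr)
    assume "\<nexists>i. \<beta> i < \<alpha> i"
    then have le: "\<alpha> i \<le> \<beta> i" for i by (simp add: not_less)
    obtain i where "\<alpha> i \<noteq> \<beta> i" using False by auto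
    then have "\<alpha> i < \<beta> i" using le[of i] by simp
    then have "sum \<alpha> UNIV < sum \<beta> UNIV" using le by (intro sum_strict_mono_ex1) auto
    then show False using assms by simp
  qed
  then show ?thesis using False monomial_deriv_zero by auto
qed

lemma poly_deriv_high_order:
  fixes p :: "real^'d::finite \<Rightarrow> real"
  assumes "p \<in> poly_space l" "l < sum \<alpha> UNIV" shows "poly_deriv \<alpha> p = (\<lambda>_. 0)"
proof -
  obtain c where p: "p = (\<lambda>x. \<Sum>\<beta>\<in>index_set l. c \<beta> * monomial \<beta> x)" using assms(1) by (auto simp: poly_space_iff)
  have "monomial_deriv \<alpha> \<beta> x = 0" if \<beta>: "\<beta> \<in> index_set l" for \<beta> and x :: "real^'d"
  proof -
    have "\<exists>i. \<beta> i < \<alpha> i"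
    proof (rule ccontr)
      assume "\<nexists>i. \<beta> i < \<alpha> i"
      then have "sum \<alpha> UNIV \<le> sum \<beta> UNIV" by (intro sum_mono) (simp add: not_less)
      then show False using \<beta> assms(2) by (simp add: index_set_def)
    qed
    then show ?thesis using monomial_deriv_zero by blast
  qed
  then show ?thesis by (simp add: p poly_deriv_eq)
qed

context star_domain
begin

lemma mean_add: "square_integrable T f \<Longrightarrow> square_integrable T g \<Longrightarrow> mean (\<lambda>x. f x + g x) = mean f + mean g"
  by (simp add: mean_def si_integrable add_divide_distrib)

lemma mean_diff: "square_integrable T f \<Longrightarrow> square_integrable T g \<Longrightarrow> mean (\<lambda>x. f x - g x) = mean f - mean g"
  by (simp add: mean_def si_integrable diff_divide_distrib)

lemma mean_const [simp]: "mean (\<lambda>_. c) = c"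
  using measure_T_pos by (simp add: mean_def integral_const del: lebesgue_integral_const)

lemma mean_cong_AE:
  assumes "square_integrable T f" "AE x in lebesgue_on T. f x = g x" shows "mean f = mean g"
proof -
  have "(\<integral>x. f x \<partial>lebesgue_on T) = (\<integral>x. g x \<partial>lebesgue_on T)"
    by (rule integral_cong_AE) (use assms si_measurable si_cong_AE in auto)
  then show ?thesis by (simp add: mean_def)
qed

text \<open>Triangular solution from the top. The monomials of order n settle the means of that
  order, as their derivatives of order n are constants; they disturb only lower means, which a
  polynomial of lower degree corrects. For n = 0 the degree \<open>n - 1\<close> is truncated to 0,
  and it is the last clause that forces the zero polynomial.\<close>

lemma poly_with_prescribed_means:
  fixes M :: "('d \<Rightarrow> nat) \<Rightarrow> real"
  shows "\<exists>q\<in>poly_space (n - 1). (\<forall>\<alpha>. sum \<alpha> UNIV < n \<longrightarrow> mean (poly_deriv \<alpha> q) = M \<alpha>) \<and>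
    (\<forall>\<alpha>. n \<le> sum \<alpha> UNIV \<longrightarrow> poly_deriv \<alpha> q = (\<lambda>_. 0))"
proof (induction n arbitrary: M)
  case 0
  have "poly_deriv \<alpha> (\<lambda>_. 0) = (\<lambda>_ :: real^'d. 0)" for \<alpha>
    using poly_deriv_eq[of \<alpha> "\<lambda>_. 0" "{}"] by simp
  then show ?case by (intro bexI[of _ "\<lambda>_. 0"] poly_space_0) auto
next
  case (Suc n)
  define c where "c = (\<lambda>\<beta> :: 'd \<Rightarrow> nat. if sum \<beta> UNIV = n then M \<beta> / (\<Prod>i\<in>UNIV. fact (\<beta> i)) else 0)"
  define t where "t = (\<lambda>x :: real^'d. \<Sum>\<beta>\<in>index_set n. c \<beta> * monomial \<beta> x)"
  have t: "t \<in> poly_space n" unfolding t_def by (rule poly_space_sum_monomials)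
  have top: "poly_deriv \<alpha> t = (\<lambda>_. M \<alpha>)" if \<alpha>: "sum \<alpha> UNIV = n" for \<alpha>
  proof
    fix x
    have "poly_deriv \<alpha> t x = (\<Sum>\<beta>\<in>index_set n. c \<beta> * monomial_deriv \<alpha> \<beta> x)"
      by (simp add: t_def poly_deriv_eq)
    also have "\<dots> = (\<Sum>\<beta>\<in>index_set n. if \<beta> = \<alpha> then M \<alpha> else 0)"
    proof (rule sum.cong[OF refl])
      fix \<beta> :: "'d \<Rightarrow> nat"
      have "(\<Prod>i\<in>UNIV. fact (\<alpha> i)) \<noteq> (0::real)" by simp
      then show "c \<beta> * monomial_deriv \<alpha> \<beta> x = (if \<beta> = \<alpha> then M \<alpha> else 0)"
        using \<alpha> by (cases "sum \<beta> UNIV = n") (auto simp: c_def monomial_deriv_same_order)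
    qed
    also have "\<dots> = M \<alpha>"
    proof -
      have "\<alpha> \<in> index_set n" using \<alpha> by (simp add: index_set_def)
      then show ?thesis by simp
    qed
    finally show "poly_deriv \<alpha> t x = M \<alpha>" .
  qed
  \<comment> \<open>The lower means are prescribed with the contribution of t already
    subtracted.\<close>
  obtain q where q: "q \<in> poly_space (n - 1)"
    "\<And>\<alpha>. sum \<alpha> UNIV < n \<Longrightarrow> mean (poly_deriv \<alpha> q) = M \<alpha> - mean (poly_deriv \<alpha> t)"
    "\<And>\<alpha>. n \<le> sum \<alpha> UNIV \<Longrightarrow> poly_deriv \<alpha> q = (\<lambda>_. 0)"
    using Suc.IH[of "\<lambda>\<alpha>. M \<alpha> - mean (poly_deriv \<alpha> t)"] by blast
  have qn: "q \<in> poly_space n" using q(1) poly_space_mono[of "n - 1" n] by auto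
  define p where "p = (\<lambda>x. q x + t x)"
  have p: "p \<in> poly_space n" unfolding p_def by (rule poly_space_add[OF qn t])
  have pd: "poly_deriv \<alpha> p = (\<lambda>x. poly_deriv \<alpha> q x + poly_deriv \<alpha> t x)" for \<alpha>
    unfolding p_def by (rule poly_deriv_add[OF qn t])
  have "mean (poly_deriv \<alpha> p) = M \<alpha>" if "sum \<alpha> UNIV < Suc n" for \<alpha>
  proof (cases "sum \<alpha> UNIV = n")
    case True
    then show ?thesis by (simp add: pd q(3) top)
  next
    case False
    then have "mean (poly_deriv \<alpha> p) = mean (poly_deriv \<alpha> q) + mean (poly_deriv \<alpha> t)"
      unfolding pd by (intro mean_add si_poly[OF poly_deriv_in_poly_space[OF qn]] si_poly[OF poly_deriv_in_poly_space[OF t]])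
    then show ?thesis using False that q(2)[of \<alpha>] by simp
  qed
  moreover have "poly_deriv \<alpha> p = (\<lambda>_. 0)" if "Suc n \<le> sum \<alpha> UNIV" for \<alpha>
    using poly_deriv_high_order[OF p] that by simp
  ultimately show ?case using p by (intro bexI[of _ p]) auto
qed

definition level_norm :: "nat \<Rightarrow> (real^'d \<Rightarrow> real) \<Rightarrow> real" where
  "level_norm m u = (\<Sum>\<alpha> | sum \<alpha> UNIV = m. sq_norm T (weak_deriv T \<alpha> u))"

lemma level_norm_nonneg: "level_norm m u \<ge> 0"
  unfolding level_norm_def by (intro sum_nonneg sq_norm_nonneg)

lemma poincare_const_nonneg: "poincare_const \<ge> 0"
  unfolding poincare_const_def by simp

text \<open>The Poincare inequality is applied to every derivative of order m, whose mean is 0. The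
  dimension appears because each direction j contributes at most one full copy of the next
  level.\<close>

lemma level_norm_step:
  assumes w: "w \<in> sobolev s T" and m: "m < s"
    and mean0: "\<And>\<alpha>. sum \<alpha> UNIV = m \<Longrightarrow> mean (weak_deriv T \<alpha> w) = 0"
  shows "level_norm m w \<le> poincare_const * h\<^sup>2 * real CARD('d) * level_norm (Suc m) w"
proof -
  define f where "f = (\<lambda>\<alpha>. sq_norm T (weak_deriv T \<alpha> w))"
  have "f \<alpha> \<le> poincare_const * h\<^sup>2 * (\<Sum>j\<in>UNIV. f (\<alpha>(j := Suc (\<alpha> j))))" if \<alpha>: "sum \<alpha> UNIV = m" for \<alpha>
  proof -
    have 1: "has_weak_deriv T \<alpha> w (weak_deriv T \<alpha> w)" "square_integrable T (weak_deriv T \<alpha> w)"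
      using sobolev_weak_deriv[OF w, of \<alpha>] \<alpha> m by auto
    have 2: "has_weak_deriv T (\<alpha>(j := Suc (\<alpha> j))) w (weak_deriv T (\<alpha>(j := Suc (\<alpha> j))) w)"
      "square_integrable T (weak_deriv T (\<alpha>(j := Suc (\<alpha> j))) w)" for j
      using sobolev_weak_deriv[OF w, of "\<alpha>(j := Suc (\<alpha> j))"] \<alpha> m unfolding sum_Suc_upd by auto
    from poincare[OF 1(2) 2(2) has_weak_deriv_step[OF 1(1) 2(1)]] show ?thesis
      by (simp add: f_def mean0[OF \<alpha>])
  qed
  then have "level_norm m w \<le> (\<Sum>\<alpha> | sum \<alpha> UNIV = m. poincare_const * h\<^sup>2 * (\<Sum>j\<in>UNIV. f (\<alpha>(j := Suc (\<alpha> j)))))"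
    unfolding level_norm_def f_def[symmetric] by (intro sum_mono) auto
  also have "\<dots> = poincare_const * h\<^sup>2 * (\<Sum>j\<in>UNIV. \<Sum>\<alpha> | sum \<alpha> UNIV = m. f (\<alpha>(j := Suc (\<alpha> j))))"
    by (subst sum.swap) (simp add: sum_distrib_left)
  also have "\<dots> \<le> poincare_const * h\<^sup>2 * (\<Sum>j\<in>(UNIV :: 'd set). level_norm (Suc m) w)"
    unfolding level_norm_def f_def[symmetric]
    by (intro mult_left_mono sum_mono sum_Suc_upd_le) (auto simp: f_def sq_norm_nonneg poincare_const_nonneg)
  finally show ?thesis by (simp add: mult_ac)
qed

text \<open>Downward induction on the order, gaining the factor of one Poincare inequality per step.
  It can start from the seminorm of u itself because the derivatives of order s of q vanish.\<close>

theorem polynomial_approximation: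
  assumes u: "u \<in> sobolev s T"
  shows "\<exists>q\<in>poly_space (s - 1). (\<lambda>x. u x - q x) \<in> sobolev s T \<and>
    (\<forall>m\<le>s. level_norm m (\<lambda>x. u x - q x) \<le> (poincare_const * h\<^sup>2 * real CARD('d)) ^ (s - m) * level_norm s u)"
proof -
  obtain q where q: "q \<in> poly_space (s - 1)"
    "\<And>\<alpha>. sum \<alpha> UNIV < s \<Longrightarrow> mean (poly_deriv \<alpha> q) = mean (weak_deriv T \<alpha> u)"
    "\<And>\<alpha>. s \<le> sum \<alpha> UNIV \<Longrightarrow> poly_deriv \<alpha> q = (\<lambda>_. 0)"
    using poly_with_prescribed_means[of s "\<lambda>\<alpha>. mean (weak_deriv T \<alpha> u)"] by blast
  define w where "w = (\<lambda>x. u x - q x)"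
  define C where "C = poincare_const * h\<^sup>2 * real CARD('d)"
  have C: "C \<ge> 0" using poincare_const_nonneg by (simp add: C_def)
  note qd = si_poly[OF poly_deriv_in_poly_space[OF q(1)]]
  have wd: "has_weak_deriv T \<alpha> w (\<lambda>x. weak_deriv T \<alpha> u x - poly_deriv \<alpha> q x)"
    "square_integrable T (\<lambda>x. weak_deriv T \<alpha> u x - poly_deriv \<alpha> q x)" if "sum \<alpha> UNIV \<le> s" for \<alpha>
    unfolding w_def using sobolev_weak_deriv[OF u that] has_weak_deriv_poly[OF q(1)] qd
    by (auto intro: has_weak_deriv_diff si_diff)
  have "square_integrable T u" using u by (simp add: sobolev_def)
  then have w: "w \<in> sobolev s T" unfolding sobolev_def using wd si_poly[OF q(1)]
    by (auto simp: w_def intro: si_diff)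
  have mean0: "mean (weak_deriv T \<alpha> w) = 0" if \<alpha>: "sum \<alpha> UNIV < s" for \<alpha>
  proof -
    have "mean (weak_deriv T \<alpha> w) = mean (\<lambda>x. weak_deriv T \<alpha> u x - poly_deriv \<alpha> q x)"
      by (rule mean_cong_AE[OF sobolev_weak_deriv(2)[OF w] weak_deriv_AE[OF wd(1)]]) (use \<alpha> in auto)
    also have "\<dots> = 0" using sobolev_weak_deriv(2)[OF u, of \<alpha>] qd q(2)[OF \<alpha>] \<alpha> by (simp add: mean_diff)
    finally show ?thesis .
  qed
  have top: "level_norm s w = level_norm s u"
    unfolding level_norm_def
  proof (rule sum.cong[OF refl])
    fix \<alpha> assume "\<alpha> \<in> {\<alpha> :: 'd \<Rightarrow> nat. sum \<alpha> UNIV = s}"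
    then have \<alpha>: "sum \<alpha> UNIV = s" by simp
    show "sq_norm T (weak_deriv T \<alpha> w) = sq_norm T (weak_deriv T \<alpha> u)"
      using sq_norm_weak_deriv[OF wd[of \<alpha>]] \<alpha> q(3)[of \<alpha>] by simp
  qed
  have "level_norm m w \<le> C ^ (s - m) * level_norm s u" if "m \<le> s" for m
    using that
  proof (induction rule: inc_induct)
    case base
    then show ?case by (simp add: top)
  next
    case (step m)
    have "level_norm m w \<le> C * level_norm (Suc m) w"
      unfolding C_def by (rule level_norm_step[OF w]) (use step mean0 in auto)
    also have "\<dots> \<le> C * (C ^ (s - Suc m) * level_norm s u)"
      by (intro mult_left_mono step C)
    also have "\<dots> = C ^ (s - m) * level_norm s u"
      using step by (simp add: Suc_diff_Suc flip: power_Suc mult.assoc)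
    finally show ?case .
  qed
  then show ?thesis using q(1) w unfolding w_def C_def by blast
qed

lemma level_norm_diff_le:
  assumes u: "u \<in> sobolev s T" and p: "p \<in> poly_space l" and m: "m \<le> s"
  shows "level_norm m (\<lambda>x. u x - p x) \<le> 2 * level_norm m u + 2 * level_norm m p"
  unfolding level_norm_def sum_distrib_left sum.distrib[symmetric]
proof (intro sum_mono)
  fix \<alpha> assume "\<alpha> \<in> {\<alpha> :: 'd \<Rightarrow> nat. sum \<alpha> UNIV = m}"
  then have \<alpha>: "sum \<alpha> UNIV \<le> s" using m by simp
  note D = sobolev_weak_deriv[OF u \<alpha>]
  note P = has_weak_deriv_poly[OF p, of \<alpha>] si_poly[OF poly_deriv_in_poly_space[OF p], of \<alpha>]
  have "sq_norm T (weak_deriv T \<alpha> (\<lambda>x. u x - p x)) = sq_norm T (\<lambda>x. weak_deriv T \<alpha> u x - poly_deriv \<alpha> p x)"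
    by (rule sq_norm_weak_deriv[OF has_weak_deriv_diff[OF D(1) P(1)] si_diff[OF D(2) P(2)]])
  also have "\<dots> \<le> 2 * sq_norm T (weak_deriv T \<alpha> u) + 2 * sq_norm T (poly_deriv \<alpha> p)"
    by (rule sq_norm_diff_le[OF D(2) P(2)])
  finally show "sq_norm T (weak_deriv T \<alpha> (\<lambda>x. u x - p x)) \<le> 2 * sq_norm T (weak_deriv T \<alpha> u) + 2 * sq_norm T (weak_deriv T \<alpha> p)"
    using sq_norm_weak_deriv[OF P] by simp
qed

lemma level_norm_poly:
  assumes "p \<in> poly_space l" shows "level_norm m p = (\<Sum>\<alpha> | sum \<alpha> UNIV = m. sq_norm T (poly_deriv \<alpha> p))"
  unfolding level_norm_def
  by (intro sum.cong refl sq_norm_weak_deriv[OF has_weak_deriv_poly[OF assms] si_poly[OF poly_deriv_in_poly_space[OF assms]]])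

lemma level_norm_0: "square_integrable T u \<Longrightarrow> level_norm 0 u = sq_norm T u"
proof -
  assume u: "square_integrable T u"
  have "{\<alpha> :: 'd \<Rightarrow> nat. sum \<alpha> UNIV = 0} = {\<lambda>_. 0}" by auto
  then have "level_norm 0 u = sq_norm T (weak_deriv T (\<lambda>_. 0) u)" by (simp add: level_norm_def)
  then show ?thesis using sq_norm_weak_deriv[OF has_weak_deriv_0[OF u] u] by simp
qed

lemma order_1_eq: "{\<alpha> :: 'd \<Rightarrow> nat. sum \<alpha> UNIV = 1} = range unit_index"
proof (intro set_eqI iffI)
  fix \<alpha> :: "'d \<Rightarrow> nat" assume "\<alpha> \<in> {\<alpha>. sum \<alpha> UNIV = 1}"
  then have s: "sum \<alpha> UNIV = 1" by simp
  then obtain j where j: "\<alpha> j \<noteq> 0" by (metis zero_neq_one sum.neutral)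
  have "sum \<alpha> UNIV = \<alpha> j + sum \<alpha> (UNIV - {j})" by (rule sum.remove) auto
  then have "\<alpha> j = 1" "sum \<alpha> (UNIV - {j}) = 0" using s j by linarith+
  then have "\<alpha> = unit_index j" by auto
  then show "\<alpha> \<in> range unit_index" by blast
qed auto

lemma level_norm_1: "level_norm 1 u = (\<Sum>j\<in>UNIV. sq_norm T (weak_deriv T (unit_index j) u))"
proof -
  have "inj (unit_index :: 'd \<Rightarrow> 'd \<Rightarrow> nat)"
    by (rule injI) (metis zero_neq_one)
  then show ?thesis unfolding level_norm_def order_1_eq by (subst sum.reindex) (auto simp: o_def)
qed

lemma level_norm_1_poly: "p \<in> poly_space l \<Longrightarrow> level_norm 1 p = (\<Sum>j\<in>UNIV. sq_norm T (partial_deriv j p))"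
  unfolding level_norm_1 partial_deriv_eq_poly_deriv
  by (intro sum.cong refl sq_norm_weak_deriv has_weak_deriv_poly si_poly[OF poly_deriv_in_poly_space])

text \<open>The derivatives of p are regarded as elements of the same \<open>poly_space l\<close>,
  so that a single K serves every order.\<close>

lemma level_norm_Suc_poly_le:
  assumes p: "p \<in> poly_space l"
    and inv: "\<And>q j. q \<in> poly_space l \<Longrightarrow> sq_norm T (partial_deriv j q) \<le> K / h\<^sup>2 * sq_norm T q"
  shows "level_norm (Suc m) p \<le> real CARD('d) * K / h\<^sup>2 * level_norm m p"
proof -
  have "level_norm (Suc m) p \<le> (\<Sum>j\<in>UNIV. \<Sum>\<alpha> | sum \<alpha> UNIV = m. sq_norm T (poly_deriv (\<alpha>(j := Suc (\<alpha> j))) p))"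
    unfolding level_norm_poly[OF p] by (rule sum_Suc_order_le) (rule sq_norm_nonneg)
  also have "\<dots> \<le> (\<Sum>j\<in>(UNIV :: 'd set). \<Sum>\<alpha> | sum \<alpha> UNIV = m. K / h\<^sup>2 * sq_norm T (poly_deriv \<alpha> p))"
    unfolding partial_deriv_poly_deriv[OF p, symmetric]
    by (intro sum_mono inv poly_deriv_in_poly_space'[OF p])
  also have "\<dots> = real CARD('d) * K / h\<^sup>2 * level_norm m p"
    unfolding level_norm_poly[OF p] by (simp add: sum_distrib_left mult.assoc)
  finally show ?thesis .
qed

end

subsection \<open>The Korn inequality for polynomials\<close>

definition sym_part :: "('d \<Rightarrow> 'd \<Rightarrow> real ^ 'd \<Rightarrow> real) \<Rightarrow> 'd \<Rightarrow> 'd \<Rightarrow> real ^ 'd \<Rightarrow> real" where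
  "sym_part G i j x = 1 / 2 * G i j x + 1 / 2 * G j i x"

text \<open>The coefficient - 1 / 2 is written out so that one estimate, for any coefficient whose
  square is 1 / 4, covers both parts.\<close>

definition skew_part :: "('d \<Rightarrow> 'd \<Rightarrow> real ^ 'd \<Rightarrow> real) \<Rightarrow> 'd \<Rightarrow> 'd \<Rightarrow> real ^ 'd \<Rightarrow> real" where
  "skew_part G i j x = 1 / 2 * G i j x + (- 1 / 2) * G j i x"

definition poly_grad :: "('d \<Rightarrow> real ^ 'd \<Rightarrow> real) \<Rightarrow> 'd \<Rightarrow> 'd \<Rightarrow> real ^ 'd \<Rightarrow> real" where
  "poly_grad P i j = partial_deriv j (P i)"

lemma partial_deriv_linear:
  fixes p :: "real^'d::finite \<Rightarrow> real"
  assumes p: "p \<in> poly_space l" and q: "q \<in> poly_space l"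
  shows "partial_deriv j (\<lambda>x. a * p x + b * q x) x = a * partial_deriv j p x + b * partial_deriv j q x"
proof -
  have D: "(p has_derivative frechet_derivative p (at x)) (at x)" "(q has_derivative frechet_derivative q (at x)) (at x)"
    using poly_differentiable[OF p] poly_differentiable[OF q] frechet_derivative_works by blast+
  have "((\<lambda>x. a * p x + b * q x) has_derivative
    (\<lambda>v. a * frechet_derivative p (at x) v + b * frechet_derivative q (at x) v)) (at x)"
    by (intro has_derivative_add has_derivative_mult_right D)
  from partial_deriv_eq[OF this] show ?thesis by (simp add: partial_deriv_def)
qed

lemma sym_part_in_poly_space: "(\<And>i j. G i j \<in> poly_space l) \<Longrightarrow> sym_part G i j \<in> poly_space l"
  unfolding sym_part_def[abs_def] by (intro poly_space_add poly_space_cmult)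

lemma skew_part_in_poly_space: "(\<And>i j. G i j \<in> poly_space l) \<Longrightarrow> skew_part G i j \<in> poly_space l"
  unfolding skew_part_def[abs_def] by (intro poly_space_add poly_space_cmult)

lemma poly_grad_in_poly_space: "(\<And>i. P i \<in> poly_space l) \<Longrightarrow> poly_grad P i j \<in> poly_space l"
  unfolding poly_grad_def by (rule partial_deriv_in_poly_space)

text \<open>On the right-hand side the mixed second derivatives of \<open>P k\<close> cancel; the
  second derivatives of \<open>P i\<close> and \<open>P j\<close> that remain form the left-hand
  side.\<close>

lemma partial_deriv_skew_part:
  fixes P :: "'d::finite \<Rightarrow> real^'d \<Rightarrow> real"
  assumes P: "\<And>i. P i \<in> poly_space l"
  shows "partial_deriv k (skew_part (poly_grad P) i j) x =
    partial_deriv j (sym_part (poly_grad P) i k) x - partial_deriv i (sym_part (poly_grad P) j k) x"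
proof -
  note J = poly_grad_in_poly_space[of P, OF P]
  have s: "partial_deriv m (sym_part (poly_grad P) i j) x = 1 / 2 * partial_deriv m (partial_deriv j (P i)) x + 1 / 2 * partial_deriv m (partial_deriv i (P j)) x" for m i j
    unfolding sym_part_def[abs_def] partial_deriv_linear[OF J J] by (simp add: poly_grad_def)
  have "partial_deriv k (skew_part (poly_grad P) i j) x = 1 / 2 * partial_deriv k (partial_deriv j (P i)) x + (- 1 / 2) * partial_deriv k (partial_deriv i (P j)) x"
    unfolding skew_part_def[abs_def] partial_deriv_linear[OF J J] by (simp add: poly_grad_def)
  then show ?thesis unfolding s
    using partial_deriv_commute[OF P, of k j i] partial_deriv_commute[OF P, of k i j] partial_deriv_commute[OF P, of i j k]
    by simp
qed

context bounded_open
begin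

lemma si_sym_part: "(\<And>i j. square_integrable T (G i j)) \<Longrightarrow> square_integrable T (sym_part G i j)"
  unfolding sym_part_def[abs_def] by (intro si_add si_cmult)

lemma si_skew_part: "(\<And>i j. square_integrable T (G i j)) \<Longrightarrow> square_integrable T (skew_part G i j)"
  unfolding skew_part_def[abs_def] by (intro si_add si_cmult)

lemma half_sum_le: 
  assumes "\<And>i j. square_integrable T (G i j)" and c: "c\<^sup>2 = 1 / 4"
  shows "sq_norm T (\<lambda>x. 1 / 2 * G i j x + c * G j i x) \<le> 1 / 2 * sq_norm T (G i j) + 1 / 2 * sq_norm T (G j i)"
  using sq_norm_add_le[OF si_cmult[OF assms(1)] si_cmult[OF assms(1)], of "1/2" i j c j i]
  unfolding sq_norm_cmult c by (simp add: power2_eq_square)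

lemma sum_half_sum_le:
  fixes G :: "'d \<Rightarrow> 'd \<Rightarrow> real^'d \<Rightarrow> real"
  assumes "\<And>i j. square_integrable T (G i j)" and c: "c\<^sup>2 = 1 / 4"
  shows "(\<Sum>i\<in>UNIV. \<Sum>j\<in>UNIV. sq_norm T (\<lambda>x. 1 / 2 * G i j x + c * G j i x)) \<le> (\<Sum>i\<in>UNIV. \<Sum>j\<in>UNIV. sq_norm T (G i j))"
proof -
  have "(\<Sum>i\<in>UNIV. \<Sum>j\<in>UNIV. sq_norm T (\<lambda>x. 1 / 2 * G i j x + c * G j i x)) \<le>
    (\<Sum>i\<in>UNIV. \<Sum>j\<in>UNIV. 1 / 2 * sq_norm T (G i j) + 1 / 2 * sq_norm T (G j i))"
    by (intro sum_mono half_sum_le assms)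
  also have "\<dots> = 1 / 2 * (\<Sum>i\<in>UNIV. \<Sum>j\<in>UNIV. sq_norm T (G i j)) + 1 / 2 * (\<Sum>i\<in>UNIV. \<Sum>j\<in>UNIV. sq_norm T (G j i))"
    by (simp add: sum.distrib sum_distrib_left)
  also have "(\<Sum>i\<in>UNIV. \<Sum>j\<in>UNIV. sq_norm T (G j i)) = (\<Sum>i\<in>UNIV. \<Sum>j\<in>UNIV. sq_norm T (G i j))"
    by (rule sum.swap)
  finally show ?thesis by simp
qed

lemma sum_sym_part_le:
  fixes G :: "'d \<Rightarrow> 'd \<Rightarrow> real^'d \<Rightarrow> real"
  assumes "\<And>i j. square_integrable T (G i j)"
  shows "(\<Sum>i\<in>UNIV. \<Sum>j\<in>UNIV. sq_norm T (sym_part G i j)) \<le> (\<Sum>i\<in>UNIV. \<Sum>j\<in>UNIV. sq_norm T (G i j))"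
  unfolding sym_part_def[abs_def] using assms by (rule sum_half_sum_le) (simp add: power2_eq_square)

lemma sum_skew_part_le:
  fixes G :: "'d \<Rightarrow> 'd \<Rightarrow> real^'d \<Rightarrow> real"
  assumes "\<And>i j. square_integrable T (G i j)"
  shows "(\<Sum>i\<in>UNIV. \<Sum>j\<in>UNIV. sq_norm T (skew_part G i j)) \<le> (\<Sum>i\<in>UNIV. \<Sum>j\<in>UNIV. sq_norm T (G i j))"
  unfolding skew_part_def[abs_def] using assms by (rule sum_half_sum_le) (simp add: power2_eq_square)

text \<open>The arguments are matrix fields and not displacement fields, so weak gradients and
  polynomial gradients can be inserted alike.\<close>

definition strain_form :: "('d \<Rightarrow> 'd \<Rightarrow> real^'d \<Rightarrow> real) \<Rightarrow> ('d \<Rightarrow> 'd \<Rightarrow> real^'d \<Rightarrow> real) \<Rightarrow> real" where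
  "strain_form G H = (\<Sum>i\<in>UNIV. \<Sum>j\<in>UNIV. \<integral>x. sym_part G i j x * sym_part H i j x \<partial>lebesgue_on T)"

lemma strain_form_self: "strain_form G G = (\<Sum>i\<in>UNIV. \<Sum>j\<in>UNIV. sq_norm T (sym_part G i j))"
  by (simp add: strain_form_def sq_norm_def power2_eq_square)

text \<open>Young's inequality, entry by entry. When \<open>strain_form G H\<close> equals
  \<open>strain_form H H\<close>, as for a projection H of G, it says directly that the strain
  energy of H is at most that of G.\<close>

lemma strain_form_le:
  assumes "\<And>i j. square_integrable T (G i j)" "\<And>i j. square_integrable T (H i j)"
  shows "2 * strain_form G H \<le> strain_form G G + strain_form H H"
proof -
  have "2 * (\<integral>x. f x * g x \<partial>lebesgue_on T) \<le> sq_norm T f + sq_norm T g"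
    if f: "square_integrable T f" and g: "square_integrable T g" for f g
  proof -
    have "(\<integral>x. 2 * (f x * g x) \<partial>lebesgue_on T) \<le> (\<integral>x. (f x)\<^sup>2 + (g x)\<^sup>2 \<partial>lebesgue_on T)"
    proof (rule integral_mono)
      show "2 * (f x * g x) \<le> (f x)\<^sup>2 + (g x)\<^sup>2" for x
        using zero_le_power2[of "f x - g x"] by (simp add: power2_diff)
    qed (use si_mult[OF f g] si_square[OF f] si_square[OF g] in auto)
    then show ?thesis using si_square[OF f] si_square[OF g] by (simp add: sq_norm_def)
  qed
  then show ?thesis unfolding strain_form_self
    unfolding strain_form_def sum_distrib_left sum.distrib[symmetric]
    by (intro sum_mono) (simp add: si_sym_part assms)
qed

end

context star_domain
begin

lemma poly_poincare:
  assumes p: "p \<in> poly_space l"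
  shows "sq_norm T (\<lambda>x. p x - mean p) \<le> poincare_const * h\<^sup>2 * (\<Sum>j\<in>UNIV. sq_norm T (partial_deriv j p))"
  unfolding partial_deriv_eq_poly_deriv[OF p]
  by (rule poincare[OF si_poly[OF p] si_poly[OF poly_deriv_in_poly_space[OF p]] has_weak_deriv_poly[OF p]])

lemma sq_norm_le_minus_mean:
  assumes "square_integrable T u"
  shows "sq_norm T u \<le> 2 * sq_norm T (\<lambda>x. u x - mean u) + 2 * sq_norm T (\<lambda>_. mean u)"
  using sq_norm_add_le[OF si_diff[OF assms si_const] si_const, of "mean u" "mean u"] by simp

text \<open>
  The derivatives of the skew part of a gradient are combinations of derivatives of its symmetric part;
  for polynomials the latter are controlled by the inverse inequality.
\<close>
theorem polynomial_korn:
  fixes P :: "'d \<Rightarrow> real^'d \<Rightarrow> real"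
  assumes P: "\<And>i. P i \<in> poly_space l"
    and inv: "\<And>q j. q \<in> poly_space l \<Longrightarrow> sq_norm T (partial_deriv j q) \<le> K / h\<^sup>2 * sq_norm T q" and K: "K \<ge> 0"
  shows "(\<Sum>i\<in>UNIV. \<Sum>j\<in>UNIV. sq_norm T (poly_grad P i j)) \<le>
    (real CARD('d))\<^sup>2 * (2 + 16 * (poincare_const * K * real CARD('d))) * strain_form (poly_grad P) (poly_grad P) +
    4 * (\<Sum>i\<in>UNIV. \<Sum>j\<in>UNIV. sq_norm T (\<lambda>_. mean (skew_part (poly_grad P) i j)))"
proof -
  define e o' where "e = sym_part (poly_grad P)" and "o' = skew_part (poly_grad P)"
  define E where "E = strain_form (poly_grad P) (poly_grad P)"
  define C where "C = poincare_const * K * real CARD('d)"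
  note J = poly_grad_in_poly_space[of P, OF P]
  have e: "e i j \<in> poly_space l" and o: "o' i j \<in> poly_space l" for i j
    unfolding e_def o'_def by (rule sym_part_in_poly_space skew_part_in_poly_space, rule J)+
  have eE: "sq_norm T (e i j) \<le> E" for i j
  proof -
    have "sq_norm T (e i j) \<le> (\<Sum>j\<in>UNIV. sq_norm T (e i j))" by (rule member_le_sum) (auto simp: sq_norm_nonneg)
    also have "\<dots> \<le> E" unfolding E_def strain_form_self e_def
      by (rule member_le_sum) (auto intro: sum_nonneg simp: sq_norm_nonneg)
    finally show ?thesis .
  qed
  have Kh: "K / h\<^sup>2 \<ge> 0" using K by simp
  have o1: "sq_norm T (partial_deriv k (o' i j)) \<le> 4 * (K / h\<^sup>2 * E)" for i j k
  proof -
    have "sq_norm T (partial_deriv k (o' i j)) = sq_norm T (\<lambda>x. partial_deriv j (e i k) x - partial_deriv i (e j k) x)"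
      unfolding o'_def e_def using partial_deriv_skew_part[OF P] by (auto intro!: arg_cong[of _ _ "sq_norm T"])
    also have "\<dots> \<le> 2 * sq_norm T (partial_deriv j (e i k)) + 2 * sq_norm T (partial_deriv i (e j k))"
      by (intro sq_norm_diff_le si_poly[OF partial_deriv_in_poly_space[OF e]])
    also have "\<dots> \<le> 2 * (K / h\<^sup>2 * E) + 2 * (K / h\<^sup>2 * E)"
      by (intro add_mono mult_left_mono order_trans[OF inv[OF e] mult_left_mono[OF eE Kh]]) auto
    finally show ?thesis by (simp add: mult.commute)
  qed
  have o2: "sq_norm T (\<lambda>x. o' i j x - mean (o' i j)) \<le> 4 * C * E" for i j
  proof -
    have "sq_norm T (\<lambda>x. o' i j x - mean (o' i j)) \<le> poincare_const * h\<^sup>2 * (\<Sum>k\<in>(UNIV :: 'd set). 4 * (K / h\<^sup>2 * E))"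
      by (intro order_trans[OF poly_poincare[OF o]] mult_left_mono sum_mono o1) (simp add: poincare_const_nonneg)
    also have "\<dots> = 4 * C * E" using h_pos by (simp add: C_def)
    finally show ?thesis .
  qed
  \<comment> \<open>2 E comes from the symmetric part and 2 * 2 * 4 C E from the deviation of the
    skew part from its mean; the mean itself carries 2 * 2. The factor d^2 below counts the
    entries.\<close>
  have "sq_norm T (poly_grad P i j) \<le> (2 + 16 * C) * E + 4 * sq_norm T (\<lambda>_. mean (o' i j))" for i j
  proof -
    have "sq_norm T (poly_grad P i j) = sq_norm T (\<lambda>x. e i j x + o' i j x)"
      by (simp add: e_def o'_def sym_part_def skew_part_def)
    also have "\<dots> \<le> 2 * sq_norm T (e i j) + 2 * sq_norm T (o' i j)"
      by (intro sq_norm_add_le si_poly[OF e] si_poly[OF o])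
    also have "\<dots> \<le> 2 * E + 2 * (2 * (4 * C * E) + 2 * sq_norm T (\<lambda>_. mean (o' i j)))"
      by (intro add_mono mult_left_mono eE order_trans[OF sq_norm_le_minus_mean[OF si_poly[OF o]]] o2) auto
    finally show ?thesis by (simp add: algebra_simps)
  qed
  then have "(\<Sum>i\<in>UNIV. \<Sum>j\<in>UNIV. sq_norm T (poly_grad P i j)) \<le>
    (\<Sum>i\<in>UNIV. \<Sum>j\<in>UNIV. (2 + 16 * C) * E + 4 * sq_norm T (\<lambda>_. mean (o' i j)))"
    by (intro sum_mono)
  also have "\<dots> = (real CARD('d))\<^sup>2 * (2 + 16 * C) * E + 4 * (\<Sum>i\<in>UNIV. \<Sum>j\<in>UNIV. sq_norm T (\<lambda>_. mean (o' i j)))"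
    by (simp add: sum.distrib power2_eq_square sum_distrib_left)
  finally show ?thesis unfolding E_def C_def o'_def .
qed

text \<open>The function u and the matrix field G are separate data, not linked by differentiation.
  Subtracting a polynomial then acts on each of them separately, and the choice of weak derivatives
  stays outside the definition.\<close>

definition is_strain_projection :: "nat \<Rightarrow> ('d \<Rightarrow> real^'d \<Rightarrow> real) \<Rightarrow> ('d \<Rightarrow> real^'d \<Rightarrow> real) \<Rightarrow> ('d \<Rightarrow> 'd \<Rightarrow> real^'d \<Rightarrow> real) \<Rightarrow> bool" where
  "is_strain_projection l P u G \<longleftrightarrow> (\<forall>i. P i \<in> poly_space l) \<and>
    (\<forall>Q. (\<forall>i. Q i \<in> poly_space l) \<longrightarrow> strain_form (poly_grad P) (poly_grad Q) = strain_form G (poly_grad Q)) \<and>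
    (\<forall>i. mean (P i) = mean (u i)) \<and> (\<forall>i j. mean (skew_part (poly_grad P) i j) = mean (skew_part G i j))"

text \<open>Korn's inequality leaves the strain energy and the mean rotation of P. The defining
  equations bound the first by the energy of G and identify the second with the mean rotation of G.
  The values of P then follow from the Poincare inequality and the prescribed mean.\<close>

lemma strain_projection_stable:
  assumes P: "is_strain_projection l P u G"
    and u: "\<And>i. square_integrable T (u i)" and G: "\<And>i j. square_integrable T (G i j)"
    and inv: "\<And>q j. q \<in> poly_space l \<Longrightarrow> sq_norm T (partial_deriv j q) \<le> K / h\<^sup>2 * sq_norm T q" and K: "K \<ge> 0"
  shows "(\<Sum>i\<in>UNIV. \<Sum>j\<in>UNIV. sq_norm T (poly_grad P i j)) \<le>
      ((real CARD('d))\<^sup>2 * (2 + 16 * (poincare_const * K * real CARD('d))) + 4) * (\<Sum>i\<in>UNIV. \<Sum>j\<in>UNIV. sq_norm T (G i j))" (is "?a \<le> (?C + 4) * ?g")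
    and "(\<Sum>i\<in>UNIV. sq_norm T (P i)) \<le> 2 * poincare_const * h\<^sup>2 * (\<Sum>i\<in>UNIV. \<Sum>j\<in>UNIV. sq_norm T (poly_grad P i j)) + 2 * (\<Sum>i\<in>UNIV. sq_norm T (u i))"
proof -
  have Pl: "P i \<in> poly_space l" for i using P by (simp add: is_strain_projection_def)
  note J = poly_grad_in_poly_space[of P, OF Pl]
  \<comment> \<open>The projection P itself serves as the test field.\<close>
  have "strain_form (poly_grad P) (poly_grad P) = strain_form G (poly_grad P)"
    using P Pl by (simp add: is_strain_projection_def)
  with strain_form_le[of G "poly_grad P", OF G si_poly[OF J]]
  have "strain_form (poly_grad P) (poly_grad P) \<le> strain_form G G" by simp
  also have "\<dots> \<le> ?g" unfolding strain_form_self by (rule sum_sym_part_le[OF G])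
  finally have 1: "strain_form (poly_grad P) (poly_grad P) \<le> ?g" .
  have "(\<Sum>i\<in>UNIV. \<Sum>j\<in>UNIV. sq_norm T (\<lambda>_. mean (skew_part (poly_grad P) i j))) =
     (\<Sum>i\<in>UNIV. \<Sum>j\<in>UNIV. sq_norm T (\<lambda>_. mean (skew_part G i j)))"
    using P by (simp add: is_strain_projection_def)
  also have "\<dots> \<le> (\<Sum>i\<in>UNIV. \<Sum>j\<in>UNIV. sq_norm T (skew_part G i j))"
    by (intro sum_mono sq_norm_mean_le si_skew_part G)
  also have "\<dots> \<le> ?g" by (rule sum_skew_part_le[OF G])
  finally have 2: "(\<Sum>i\<in>UNIV. \<Sum>j\<in>UNIV. sq_norm T (\<lambda>_. mean (skew_part (poly_grad P) i j))) \<le> ?g" .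
  have C: "?C \<ge> 0" using poincare_const_nonneg K by simp
  have "?a \<le> ?C * strain_form (poly_grad P) (poly_grad P) +
      4 * (\<Sum>i\<in>UNIV. \<Sum>j\<in>UNIV. sq_norm T (\<lambda>_. mean (skew_part (poly_grad P) i j)))"
    by (rule polynomial_korn[OF Pl inv K])
  also have "\<dots> \<le> ?C * ?g + 4 * ?g" by (intro add_mono mult_left_mono 1 2 C) simp
  finally show "?a \<le> (?C + 4) * ?g" by (simp only: distrib_right)
  have "(\<Sum>i\<in>UNIV. sq_norm T (P i)) \<le> (\<Sum>i\<in>UNIV. 2 * (poincare_const * h\<^sup>2 * (\<Sum>j\<in>UNIV. sq_norm T (poly_grad P i j))) + 2 * sq_norm T (u i))"
  proof (intro sum_mono)
    fix i
    have "mean (P i) = mean (u i)" using P by (simp add: is_strain_projection_def)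
    then have "sq_norm T (\<lambda>_. mean (P i)) \<le> sq_norm T (u i)" using sq_norm_mean_le[OF u[of i]] by simp
    then show "sq_norm T (P i) \<le> 2 * (poincare_const * h\<^sup>2 * (\<Sum>j\<in>UNIV. sq_norm T (poly_grad P i j))) + 2 * sq_norm T (u i)"
      using sq_norm_le_minus_mean[OF si_poly[OF Pl[of i]]] poly_poincare[OF Pl[of i]]
      unfolding poly_grad_def by linarith
  qed
  then show "(\<Sum>i\<in>UNIV. sq_norm T (P i)) \<le> 2 * poincare_const * h\<^sup>2 * ?a + 2 * (\<Sum>i\<in>UNIV. sq_norm T (u i))"
    by (simp add: sum.distrib sum_distrib_left mult.assoc)
qed

end

subsection \<open>The strain projection\<close>

lemma sum_swap_triple: "(\<Sum>i\<in>I. \<Sum>j\<in>J. \<Sum>k\<in>A. f i j k) = (\<Sum>k\<in>A. \<Sum>i\<in>I. \<Sum>j\<in>J. f i j k)"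
proof -
  have "(\<Sum>i\<in>I. \<Sum>j\<in>J. \<Sum>k\<in>A. f i j k) = (\<Sum>i\<in>I. \<Sum>k\<in>A. \<Sum>j\<in>J. f i j k)"
    by (intro sum.cong refl sum.swap)
  also have "\<dots> = (\<Sum>k\<in>A. \<Sum>i\<in>I. \<Sum>j\<in>J. f i j k)" by (rule sum.swap)
  finally show ?thesis .
qed

text \<open>Reading a vector-valued integral componentwise presupposes integrability of the whole
  function; this reduces it to the components.\<close>

lemma integrable_inner_Basis:
  fixes f :: "'a \<Rightarrow> 'b::euclidean_space"
  assumes "\<And>b. b \<in> Basis \<Longrightarrow> integrable M (\<lambda>x. f x \<bullet> b)"
  shows "integrable M f"
proof -
  have "integrable M (\<lambda>x. \<Sum>b\<in>Basis. (f x \<bullet> b) *\<^sub>R b)"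
    using assms by (intro Bochner_Integration.integrable_sum integrable_scaleR_left) auto
  then show ?thesis by (simp add: euclidean_representation)
qed

lemma integral_vec_nth:
  fixes f :: "'a \<Rightarrow> 'b::euclidean_space ^ 'n::finite"
  assumes "integrable M f"
  shows "(\<integral>x. f x \<partial>M) $ i = (\<integral>x. f x $ i \<partial>M)"
  using integral_bounded_linear[OF bounded_linear_vec_nth assms] by simp

lemma integral_real_vec_nth:
  fixes f :: "'a \<Rightarrow> real ^ 'n::finite"
  assumes "\<And>i. integrable M (\<lambda>x. f x $ i)"
  shows "(\<integral>x. f x \<partial>M) $ i = (\<integral>x. f x $ i \<partial>M)"
  by (rule integral_vec_nth, rule integrable_inner_Basis) (auto simp: Basis_vec_def inner_axis assms)

lemma integral_real_matrix_nth:
  fixes f :: "'a \<Rightarrow> real ^ 'n::finite ^ 'm::finite"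
  assumes "\<And>i j. integrable M (\<lambda>x. f x $ i $ j)"
  shows "(\<integral>x. f x \<partial>M) $ i $ j = (\<integral>x. f x $ i $ j \<partial>M)"
proof -
  have "integrable M f"
    by (rule integrable_inner_Basis) (auto simp: Basis_vec_def inner_axis assms)
  from integral_vec_nth[OF this] show ?thesis using integral_real_vec_nth[of M "\<lambda>x. f x $ i" j] assms by simp
qed

lemma sym_part_diff: "sym_part (\<lambda>i j x. G i j x - H i j x) i j x = sym_part G i j x - sym_part H i j x"
  and skew_part_diff: "skew_part (\<lambda>i j x. G i j x - H i j x) i j x = skew_part G i j x - skew_part H i j x"
  by (simp_all add: sym_part_def skew_part_def diff_divide_distrib)

lemma poly_grad_diff:
  fixes P Q :: "'d::finite \<Rightarrow> real^'d \<Rightarrow> real"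
  assumes "\<And>i. P i \<in> poly_space l" "\<And>i. Q i \<in> poly_space l"
  shows "poly_grad (\<lambda>i x. P i x - Q i x) = (\<lambda>i j x. poly_grad P i j x - poly_grad Q i j x)"
proof (intro ext)
  fix i j x
  show "poly_grad (\<lambda>i x. P i x - Q i x) i j x = poly_grad P i j x - poly_grad Q i j x"
    using partial_deriv_linear[OF assms(1)[of i] assms(2)[of i], of j 1 "- 1" x] by (simp add: poly_grad_def)
qed

lemma poly_grad_sum:
  fixes b :: "'k \<Rightarrow> 'd::finite \<Rightarrow> real^'d \<Rightarrow> real"
  assumes "\<And>k i. k \<in> A \<Longrightarrow> b k i \<in> poly_space l"
  shows "poly_grad (\<lambda>i x. \<Sum>k\<in>A. c k * b k i x) i j x = (\<Sum>k\<in>A. c k * poly_grad (b k) i j x)"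
  using foldr_partial_deriv_sum[of A "\<lambda>k. b k i" "[j]" c] smooth_poly[OF assms] by (simp add: poly_grad_def)

context bounded_open
begin

lemma strain_form_commute: "strain_form G H = strain_form H G"
  by (simp add: strain_form_def mult.commute)

lemma strain_form_diff:
  assumes "\<And>i j. square_integrable T (G i j)" "\<And>i j. square_integrable T (H i j)" "\<And>i j. square_integrable T (F i j)"
  shows "strain_form (\<lambda>i j x. G i j x - H i j x) F = strain_form G F - strain_form H F"
proof -
  have "(\<integral>x. sym_part (\<lambda>i j x. G i j x - H i j x) i j x * sym_part F i j x \<partial>lebesgue_on T) =
    (\<integral>x. sym_part G i j x * sym_part F i j x \<partial>lebesgue_on T) - (\<integral>x. sym_part H i j x * sym_part F i j x \<partial>lebesgue_on T)" for i j
    unfolding sym_part_diff left_diff_distrib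
    by (intro Bochner_Integration.integral_diff si_mult si_sym_part assms)
  then show ?thesis by (simp add: strain_form_def sum_subtractf)
qed

lemma strain_form_sum:
  assumes G: "\<And>i j. square_integrable T (G i j)" and b: "\<And>k i. k \<in> A \<Longrightarrow> b k i \<in> poly_space l"
  shows "strain_form G (poly_grad (\<lambda>i x. \<Sum>k\<in>A. c k * b k i x)) = (\<Sum>k\<in>A. c k * strain_form G (poly_grad (b k)))"
proof -
  have s: "sym_part (poly_grad (\<lambda>i x. \<Sum>k\<in>A. c k * b k i x)) i j x = (\<Sum>k\<in>A. c k * sym_part (poly_grad (b k)) i j x)" for i j x
    by (simp add: sym_part_def poly_grad_sum[OF b] sum_divide_distrib sum.distrib add_divide_distrib distrib_left)
  have int: "integrable (lebesgue_on T) (\<lambda>x. sym_part G i j x * sym_part (poly_grad (b k)) i j x)" if "k \<in> A" for i j k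
    by (intro si_mult si_sym_part G si_poly[OF poly_grad_in_poly_space[of "b k", OF b[OF that]]])
  have "(\<integral>x. sym_part G i j x * sym_part (poly_grad (\<lambda>i x. \<Sum>k\<in>A. c k * b k i x)) i j x \<partial>lebesgue_on T) =
    (\<Sum>k\<in>A. c k * (\<integral>x. sym_part G i j x * sym_part (poly_grad (b k)) i j x \<partial>lebesgue_on T))" for i j
  proof -
    have "(\<integral>x. sym_part G i j x * sym_part (poly_grad (\<lambda>i x. \<Sum>k\<in>A. c k * b k i x)) i j x \<partial>lebesgue_on T) =
      (\<integral>x. (\<Sum>k\<in>A. c k * (sym_part G i j x * sym_part (poly_grad (b k)) i j x)) \<partial>lebesgue_on T)"
      by (simp add: s sum_distrib_left mult.left_commute)
    also have "\<dots> = (\<Sum>k\<in>A. c k * (\<integral>x. sym_part G i j x * sym_part (poly_grad (b k)) i j x \<partial>lebesgue_on T))"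
      using int by (subst Bochner_Integration.integral_sum) auto
    finally show ?thesis .
  qed
  then have "strain_form G (poly_grad (\<lambda>i x. \<Sum>k\<in>A. c k * b k i x)) =
    (\<Sum>i\<in>UNIV. \<Sum>j\<in>UNIV. \<Sum>k\<in>A. c k * (\<integral>x. sym_part G i j x * sym_part (poly_grad (b k)) i j x \<partial>lebesgue_on T))"
    by (simp add: strain_form_def)
  also have "\<dots> = (\<Sum>k\<in>A. \<Sum>i\<in>UNIV. \<Sum>j\<in>UNIV. c k * (\<integral>x. sym_part G i j x * sym_part (poly_grad (b k)) i j x \<partial>lebesgue_on T))"
    by (rule sum_swap_triple)
  finally show ?thesis by (simp add: strain_form_def sum_distrib_left)
qed

lemma strain_form_cong_AE:
  assumes "\<And>i j. square_integrable T (G i j)" "\<And>i j. square_integrable T (H i j)"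
    and "\<And>i j. AE x in lebesgue_on T. G i j x = G' i j x" "\<And>i j. AE x in lebesgue_on T. H i j x = H' i j x"
  shows "strain_form G H = strain_form G' H'"
  unfolding strain_form_def
proof (intro sum.cong refl integral_cong_AE)
  fix i j
  have si: "square_integrable T (G' i j)" "square_integrable T (H' i j)" for i j
    using si_cong_AE assms by blast+
  show "(\<lambda>x. sym_part G i j x * sym_part H i j x) \<in> borel_measurable (lebesgue_on T)"
    "(\<lambda>x. sym_part G' i j x * sym_part H' i j x) \<in> borel_measurable (lebesgue_on T)"
    by (intro borel_measurable_integrable si_mult si_sym_part assms si)+
  show "AE x in lebesgue_on T. sym_part G i j x * sym_part H i j x = sym_part G' i j x * sym_part H' i j x"
    using assms(3)[of i j] assms(3)[of j i] assms(4)[of i j] assms(4)[of j i]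
    by eventually_elim (simp add: sym_part_def)
qed

end

context star_domain
begin

lemma mean_sum:
  assumes "\<And>k. k \<in> A \<Longrightarrow> square_integrable T (f k)"
  shows "mean (\<lambda>x. \<Sum>k\<in>A. c k * f k x) = (\<Sum>k\<in>A. c k * mean (f k))"
  unfolding mean_def using si_integrable[OF assms] by (subst Bochner_Integration.integral_sum) (auto simp: sum_divide_distrib)

text \<open>The affine substitution moves the ball of centres to the origin, where the coefficients
  can be read off.\<close>

lemma poly_zero_on_T:
  assumes p: "p \<in> poly_space l" and z: "\<And>x. x \<in> T \<Longrightarrow> p x = 0"
  shows "p = (\<lambda>_. 0)"
proof -
  define q where "q = (\<lambda>z. p (a + r *\<^sub>R z))"
  have "q \<in> poly_space l" unfolding q_def by (rule poly_space_affine[OF p])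
  then obtain c where c: "q = (\<lambda>x. \<Sum>\<beta>\<in>index_set l. c \<beta> * monomial \<beta> x)" by (auto simp: poly_space_iff)
  have qz: "(\<Sum>\<beta>\<in>index_set l. c \<beta> * monomial \<beta> x) = 0" if "x \<in> ball 0 1" for x
  proof -
    have "a + r *\<^sub>R x \<in> ball a r" using that r_pos by (simp add: dist_norm)
    then have "q x = 0" using z ball_subset by (auto simp: q_def)
    then show ?thesis by (simp add: c)
  qed
  have "0 \<in> ball (0 :: real^'d) 1" by simp
  from coefficients_zero[OF open_ball this qz] have q0: "q x = 0" for x by (simp add: c)
  show ?thesis
  proof
    fix x
    have "x = a + r *\<^sub>R ((1 / r) *\<^sub>R (x - a))" using r_pos by simp
    then show "p x = 0" using q0[of "(1 / r) *\<^sub>R (x - a)"] by (simp add: q_def)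
  qed
qed

text \<open>Korn's inequality annihilates the gradient; the Poincare inequality then shows that P
  equals its mean on T, which is 0, and a polynomial vanishing on T vanishes everywhere.\<close>

lemma strain_kernel:
  assumes P: "\<And>i. P i \<in> poly_space l"
    and inv: "\<And>q j. q \<in> poly_space l \<Longrightarrow> sq_norm T (partial_deriv j q) \<le> K / h\<^sup>2 * sq_norm T q" and K: "K \<ge> 0"
    and 1: "strain_form (poly_grad P) (poly_grad P) = 0" and 2: "\<And>i. mean (P i) = 0"
    and 3: "\<And>i j. mean (skew_part (poly_grad P) i j) = 0"
  shows "P i = (\<lambda>_. 0)"
proof -
  have "(\<Sum>i\<in>UNIV. \<Sum>j\<in>UNIV. sq_norm T (poly_grad P i j)) \<le> 0"
    using polynomial_korn[of P, OF P inv K] by (simp add: 1 3 sq_norm_const)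
  then have "(\<Sum>i\<in>UNIV. \<Sum>j\<in>UNIV. sq_norm T (poly_grad P i j)) = 0"
    by (intro antisym sum_nonneg sq_norm_nonneg)
  then have "(\<Sum>j\<in>UNIV. sq_norm T (poly_grad P i j)) = 0"
    by (subst (asm) sum_nonneg_eq_0_iff) (auto intro: sum_nonneg simp: sq_norm_nonneg)
  then have "sq_norm T (\<lambda>x. P i x - mean (P i)) \<le> 0"
    using poly_poincare[OF P[of i]] by (simp add: poly_grad_def)
  then have "sq_norm T (P i) = 0" using sq_norm_nonneg[of "P i"] by (simp add: 2)
  then show ?thesis using sq_norm_zero_imp_zero[OF continuous_on_poly[OF P]] poly_zero_on_T[OF P] by blast
qed

text \<open>
  Adding the products of the two mean values to the strain form makes it positive definite on
  polynomials, and testing with rigid motions recovers the three defining equations separately.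
\<close>
definition projection_form :: "('d \<Rightarrow> 'd \<Rightarrow> real^'d \<Rightarrow> real) \<Rightarrow> ('d \<Rightarrow> real^'d \<Rightarrow> real) \<Rightarrow> ('d \<Rightarrow> real^'d \<Rightarrow> real) \<Rightarrow> real" where
  "projection_form G u Q = strain_form G (poly_grad Q) + (\<Sum>i\<in>UNIV. mean (u i) * mean (Q i)) +
     (\<Sum>i\<in>UNIV. \<Sum>j\<in>UNIV. mean (skew_part G i j) * mean (skew_part (poly_grad Q) i j))"

lemma projection_form_sum:
  assumes G: "\<And>i j. square_integrable T (G i j)" and b: "\<And>k i. k \<in> A \<Longrightarrow> b k i \<in> poly_space l"
  shows "projection_form G u (\<lambda>i x. \<Sum>k\<in>A. c k * b k i x) = (\<Sum>k\<in>A. c k * projection_form G u (b k))"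
proof -
  have s: "skew_part (poly_grad (\<lambda>i x. \<Sum>k\<in>A. c k * b k i x)) i j = (\<lambda>x. \<Sum>k\<in>A. c k * skew_part (poly_grad (b k)) i j x)" for i j
    by (simp add: fun_eq_iff skew_part_def poly_grad_sum[OF b] sum_divide_distrib diff_divide_distrib right_diff_distrib sum_subtractf)
  have "mean (skew_part (poly_grad (\<lambda>i x. \<Sum>k\<in>A. c k * b k i x)) i j) = (\<Sum>k\<in>A. c k * mean (skew_part (poly_grad (b k)) i j))" for i j
    unfolding s by (intro mean_sum si_skew_part si_poly[OF poly_grad_in_poly_space[of "b _", OF b]])
  moreover have "mean (\<lambda>x. \<Sum>k\<in>A. c k * b k i x) = (\<Sum>k\<in>A. c k * mean (b k i))" for i
    by (intro mean_sum si_poly[OF b])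
  moreover have "(\<Sum>i\<in>UNIV. \<Sum>j\<in>UNIV. mean (skew_part G i j) * (\<Sum>k\<in>A. c k * mean (skew_part (poly_grad (b k)) i j))) =
     (\<Sum>k\<in>A. c k * (\<Sum>i\<in>UNIV. \<Sum>j\<in>UNIV. mean (skew_part G i j) * mean (skew_part (poly_grad (b k)) i j)))"
  proof -
    have "(\<Sum>i\<in>UNIV. \<Sum>j\<in>UNIV. mean (skew_part G i j) * (\<Sum>k\<in>A. c k * mean (skew_part (poly_grad (b k)) i j))) =
      (\<Sum>i\<in>UNIV. \<Sum>j\<in>UNIV. \<Sum>k\<in>A. c k * (mean (skew_part G i j) * mean (skew_part (poly_grad (b k)) i j)))"
      by (simp add: sum_distrib_left mult.left_commute)
    also have "\<dots> = (\<Sum>k\<in>A. \<Sum>i\<in>UNIV. \<Sum>j\<in>UNIV. c k * (mean (skew_part G i j) * mean (skew_part (poly_grad (b k)) i j)))"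
      by (rule sum_swap_triple)
    finally show ?thesis by (simp add: sum_distrib_left)
  qed
  moreover have "(\<Sum>i\<in>UNIV. mean (u i) * (\<Sum>k\<in>A. c k * mean (b k i))) = (\<Sum>k\<in>A. c k * (\<Sum>i\<in>UNIV. mean (u i) * mean (b k i)))"
  proof -
    have "(\<Sum>i\<in>UNIV. mean (u i) * (\<Sum>k\<in>A. c k * mean (b k i))) = (\<Sum>i\<in>UNIV. \<Sum>k\<in>A. c k * (mean (u i) * mean (b k i)))"
      by (simp add: sum_distrib_left mult.left_commute)
    also have "\<dots> = (\<Sum>k\<in>A. \<Sum>i\<in>UNIV. c k * (mean (u i) * mean (b k i)))" by (rule sum.swap)
    finally show ?thesis by (simp add: sum_distrib_left)
  qed
  moreover have "strain_form G (poly_grad (\<lambda>i x. \<Sum>k\<in>A. c k * b k i x)) = (\<Sum>k\<in>A. c k * strain_form G (poly_grad (b k)))"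
    by (rule strain_form_sum[OF G b])
  ultimately show ?thesis
    by (simp add: projection_form_def distrib_left sum.distrib)
qed

text \<open>Constant fields see only the mean values. Infinitesimal rotations see the mean rotations
  but also the mean values, so the latter must be settled first. What is left of the equation then
  concerns the strain alone.\<close>

lemma is_strain_projectionI:
  assumes l: "l \<ge> 1" and P: "\<And>i. P i \<in> poly_space l"
    and eq: "\<And>Q. (\<And>i. Q i \<in> poly_space l) \<Longrightarrow> projection_form (poly_grad P) P Q = projection_form G u Q"
  shows "is_strain_projection l P u G"
proof -
  define D where "D = (\<lambda>i. mean (P i) - mean (u i))"
  define E where "E = (\<lambda>i j. mean (skew_part (poly_grad P) i j) - mean (skew_part G i j))"
  have D: "D i = 0" for i
  proof -
    \<comment> \<open>The defect D is itself the constant test field, which turns the equation into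
      a vanishing sum of squares.\<close>
    define Q where "Q = (\<lambda>i (x :: real^'d). D i)"
    have "partial_deriv j (\<lambda>_ :: real^'d. c) x = 0" for j c x
      by (rule partial_deriv_eq[OF has_derivative_const])
    then have "poly_grad Q = (\<lambda>i j x. 0)" by (simp add: fun_eq_iff poly_grad_def Q_def)
    then have "sym_part (poly_grad Q) = (\<lambda>i j x. 0)" "skew_part (poly_grad Q) = (\<lambda>i j x. 0)"
      by (simp_all add: fun_eq_iff sym_part_def skew_part_def)
    then have "(\<Sum>i\<in>UNIV. mean (P i) * D i) = (\<Sum>i\<in>UNIV. mean (u i) * D i)"
      using eq[of Q] by (simp add: projection_form_def strain_form_def Q_def poly_space_const)
    then have "(\<Sum>i\<in>UNIV. (D i)\<^sup>2) = 0"
      by (simp add: D_def power2_eq_square left_diff_distrib sum_subtractf)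
    then show "D i = 0" by (simp add: sum_nonneg_eq_0_iff)
  qed
  have Eskew: "E j i = - E i j" for i j
  proof -
    have "skew_part H j i = (\<lambda>x. 0 - skew_part H i j x)" for H :: "'d \<Rightarrow> 'd \<Rightarrow> real^'d \<Rightarrow> real"
      by (simp add: skew_part_def fun_eq_iff)
    moreover have "mean (\<lambda>x. 0 - f x) = - mean f" for f by (simp add: mean_def)
    ultimately show ?thesis by (simp add: E_def)
  qed
  have E: "E i j = 0" for i j
  proof -
    \<comment> \<open>The linear field with matrix E, admissible because \<open>l \<ge> 1\<close>.
      As E is skew, its strain vanishes and its skew gradient is E; its mean values contribute
      equally to both sides because D is 0.\<close>
    define Q where "Q = (\<lambda>i (x :: real^'d). \<Sum>j\<in>UNIV. E i j * x $ j)"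
    have Q: "Q i \<in> poly_space l" for i
      unfolding Q_def using poly_space_coordinate[of _ "l - 1"] l
      by (intro poly_space_sum poly_space_cmult) simp
    have "partial_deriv j (Q i) x = E i j" for i j x
    proof -
      have "(Q i has_derivative (\<lambda>v. \<Sum>j\<in>UNIV. E i j * v $ j)) (at x)"
        unfolding Q_def by (intro has_derivative_sum has_derivative_mult_right bounded_linear_imp_has_derivative bounded_linear_vec_nth)
      from partial_deriv_eq[OF this] show ?thesis using sum_axis_mult[of j "E i"] by (simp add: mult.commute)
    qed
    then have "poly_grad Q = (\<lambda>i j x. E i j)" by (simp add: fun_eq_iff poly_grad_def)
    then have "sym_part (poly_grad Q) i j x = 0" "skew_part (poly_grad Q) i j x = E i j" for i j x
      by (simp_all add: sym_part_def skew_part_def Eskew[of i j])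
    then have "sym_part (poly_grad Q) = (\<lambda>i j x. 0)" "skew_part (poly_grad Q) = (\<lambda>i j x. E i j)"
      by (simp_all add: fun_eq_iff)
    moreover have "mean (P i) = mean (u i)" for i using D[of i] by (simp add: D_def)
    ultimately have "(\<Sum>i\<in>UNIV. \<Sum>j\<in>UNIV. mean (skew_part (poly_grad P) i j) * E i j) = (\<Sum>i\<in>UNIV. \<Sum>j\<in>UNIV. mean (skew_part G i j) * E i j)"
      using eq[of Q, OF Q] by (simp add: projection_form_def strain_form_def)
    then have "(\<Sum>i\<in>UNIV. \<Sum>j\<in>UNIV. (E i j)\<^sup>2) = 0"
      by (simp add: E_def power2_eq_square left_diff_distrib sum_subtractf)
    then have "(\<Sum>j\<in>UNIV. (E i j)\<^sup>2) = 0" by (subst (asm) sum_nonneg_eq_0_iff) (auto intro: sum_nonneg)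
    then show ?thesis by (simp add: sum_nonneg_eq_0_iff)
  qed
  have m: "mean (P i) = mean (u i)" "mean (skew_part (poly_grad P) i j) = mean (skew_part G i j)" for i j
    using D[of i] E[of i j] by (simp_all add: D_def E_def)
  have "strain_form (poly_grad P) (poly_grad Q) = strain_form G (poly_grad Q)" if "\<forall>i. Q i \<in> poly_space l" for Q
    using eq[of Q] that by (simp add: projection_form_def m)
  then show ?thesis using P m by (simp add: is_strain_projection_def)
qed

text \<open>In the basis of monomials placed in one component, \<open>projection_form\<close> has a
  symmetric matrix. If the form vanishes on a combination, so do its three nonnegative parts, and
  \<open>strain_kernel\<close> makes the combination zero. The matrix is thus positive definite, and
  the linear system is solvable for every right-hand side.\<close>

theorem strain_projection_exists:
  assumes l: "l \<ge> 1" and G: "\<And>i j. square_integrable T (G i j)"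
    and inv: "\<And>q j. q \<in> poly_space l \<Longrightarrow> sq_norm T (partial_deriv j q) \<le> K / h\<^sup>2 * sq_norm T q" and K: "K \<ge> 0"
  shows "\<exists>P. is_strain_projection l P u G"
proof -
  define A where "A = (UNIV :: 'd set) \<times> (index_set l :: ('d \<Rightarrow> nat) set)"
  define b where "b = (\<lambda>\<iota> :: 'd \<times> ('d \<Rightarrow> nat). \<lambda>k x. if k = fst \<iota> then monomial (snd \<iota>) x else 0)"
  define lc where "lc = (\<lambda>c i x. \<Sum>\<iota>\<in>A. c \<iota> * b \<iota> i x)"
  have b: "b \<iota> i \<in> poly_space l" if "\<iota> \<in> A" for \<iota> i
    using that monomial_in_poly_space[of "snd \<iota>" l] by (cases "i = fst \<iota>") (auto simp: b_def A_def index_set_def poly_space_0)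
  have lc: "lc c i \<in> poly_space l" for c i
    unfolding lc_def by (intro poly_space_sum poly_space_cmult b)
  have lc_eq: "lc c i x = (\<Sum>\<beta>\<in>index_set l. c (i, \<beta>) * monomial \<beta> x)" for c i x
  proof -
    have "lc c i x = (\<Sum>k\<in>UNIV. \<Sum>\<beta>\<in>index_set l. if i = k then c (k, \<beta>) * monomial \<beta> x else 0)"
      unfolding lc_def A_def b_def sum.cartesian_product
      by (intro sum.cong) (auto simp: split_def)
    also have "\<dots> = (\<Sum>k\<in>UNIV. if i = k then \<Sum>\<beta>\<in>index_set l. c (k, \<beta>) * monomial \<beta> x else 0)"
      by (intro sum.cong) auto
    finally show ?thesis by simp
  qed
  define B where "B = (\<lambda>\<iota> \<kappa>. projection_form (poly_grad (b \<iota>)) (b \<iota>) (b \<kappa>))"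
  have si: "square_integrable T (poly_grad Q i j)" if "\<And>i. Q i \<in> poly_space l" for Q i j
    by (rule si_poly[OF poly_grad_in_poly_space]) (rule that)
  have comm: "projection_form (poly_grad P) P Q = projection_form (poly_grad Q) Q P" for P Q
    by (simp add: projection_form_def strain_form_commute mult.commute)
  have lin1: "(\<Sum>\<iota>\<in>A. c \<iota> * projection_form H v (b \<iota>)) = projection_form H v (lc c)" if "\<And>i j. square_integrable T (H i j)" for c H v
    unfolding lc_def by (rule projection_form_sum[symmetric, OF that b])
  have lin2: "(\<Sum>\<iota>\<in>A. c \<iota> * B \<iota> \<kappa>) = projection_form (poly_grad (lc c)) (lc c) (b \<kappa>)" if "\<kappa> \<in> A" for c \<kappa>
    using lin1[of "poly_grad (b \<kappa>)" c "b \<kappa>", OF si[OF b[OF that]]] by (simp add: B_def comm[of _ "b \<kappa>"])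
  have Q: "(\<Sum>\<iota>\<in>A. \<Sum>\<kappa>\<in>A. c \<iota> * c \<kappa> * B \<iota> \<kappa>) = projection_form (poly_grad (lc c)) (lc c) (lc c)" for c
  proof -
    have "(\<Sum>\<iota>\<in>A. \<Sum>\<kappa>\<in>A. c \<iota> * c \<kappa> * B \<iota> \<kappa>) = (\<Sum>\<kappa>\<in>A. c \<kappa> * (\<Sum>\<iota>\<in>A. c \<iota> * B \<iota> \<kappa>))"
      by (subst sum.swap) (simp add: sum_distrib_left mult_ac)
    also have "\<dots> = (\<Sum>\<kappa>\<in>A. c \<kappa> * projection_form (poly_grad (lc c)) (lc c) (b \<kappa>))" by (simp add: lin2)
    also have "\<dots> = projection_form (poly_grad (lc c)) (lc c) (lc c)" by (rule lin1[OF si[OF lc]])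
    finally show ?thesis .
  qed
  have "(\<exists>k>0. \<forall>c. k * (\<Sum>i\<in>A. (c i)\<^sup>2) \<le> (\<Sum>i\<in>A. \<Sum>j\<in>A. c i * c j * B i j)) \<and>
    (\<forall>F. \<exists>c. \<forall>j\<in>A. (\<Sum>i\<in>A. c i * B i j) = F j)"
  proof (rule positive_definite_form)
    show "finite A" by (simp add: A_def)
    show "B \<iota> \<kappa> = B \<kappa> \<iota>" for \<iota> \<kappa> unfolding B_def by (rule comm)
    fix c :: "'d \<times> ('d \<Rightarrow> nat) \<Rightarrow> real" and \<iota>
    assume \<iota>: "\<iota> \<in> A" "c \<iota> \<noteq> 0"
    obtain i \<beta> where i\<beta>: "\<iota> = (i, \<beta>)" "\<beta> \<in> index_set l" using \<iota>(1) by (auto simp: A_def)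
    define f1 f2 f3 where "f1 = strain_form (poly_grad (lc c)) (poly_grad (lc c))"
      and "f2 = (\<Sum>i\<in>UNIV. (mean (lc c i))\<^sup>2)" and "f3 = (\<Sum>i\<in>UNIV. \<Sum>j\<in>UNIV. (mean (skew_part (poly_grad (lc c)) i j))\<^sup>2)"
    have eq: "projection_form (poly_grad (lc c)) (lc c) (lc c) = f1 + f2 + f3"
      by (simp add: projection_form_def f1_def f2_def f3_def power2_eq_square)
    have nn: "f1 \<ge> 0" "f2 \<ge> 0" "f3 \<ge> 0"
      unfolding f1_def f2_def f3_def strain_form_self by (auto intro!: sum_nonneg sq_norm_nonneg)
    show "0 < (\<Sum>\<iota>\<in>A. \<Sum>\<kappa>\<in>A. c \<iota> * c \<kappa> * B \<iota> \<kappa>)"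
    proof (rule ccontr)
      assume "\<not> ?thesis"
      then have z: "f1 = 0" "f2 = 0" "f3 = 0" using nn unfolding Q eq by linarith+
      have "mean (lc c i) = 0" for i using z(2) unfolding f2_def by (subst (asm) sum_nonneg_eq_0_iff) auto
      moreover have "mean (skew_part (poly_grad (lc c)) i j) = 0" for i j
      proof -
        have "(\<Sum>j\<in>UNIV. (mean (skew_part (poly_grad (lc c)) i j))\<^sup>2) = 0"
          using z(3) unfolding f3_def by (subst (asm) sum_nonneg_eq_0_iff) (auto intro: sum_nonneg)
        then show ?thesis by (subst (asm) sum_nonneg_eq_0_iff) auto
      qed
      ultimately have "lc c i = (\<lambda>_. 0)"
        using z(1) by (intro strain_kernel[of "lc c" l K, OF lc inv K]) (auto simp: f1_def)
      then have "(\<Sum>\<beta>\<in>index_set l. c (i, \<beta>) * monomial \<beta> x) = 0" for x using lc_eq[of c i x] by simp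
      from coefficients_zero[OF open_UNIV UNIV_I this i\<beta>(2)] show False using \<iota>(2) i\<beta>(1) by simp
    qed
  qed
  then have "\<exists>c. \<forall>\<kappa>\<in>A. (\<Sum>\<iota>\<in>A. c \<iota> * B \<iota> \<kappa>) = projection_form G u (b \<kappa>)"
    by (elim conjE) (erule spec)
  then obtain c where c: "\<And>\<kappa>. \<kappa> \<in> A \<Longrightarrow> (\<Sum>\<iota>\<in>A. c \<iota> * B \<iota> \<kappa>) = projection_form G u (b \<kappa>)" by blast
  have "is_strain_projection l (lc c) u G"
  proof (rule is_strain_projectionI[OF l lc])
    fix Q :: "'d \<Rightarrow> real^'d \<Rightarrow> real" assume "\<And>i. Q i \<in> poly_space l"
    then have "\<forall>i. \<exists>d. Q i = (\<lambda>x. \<Sum>\<beta>\<in>index_set l. d \<beta> * monomial \<beta> x)" by (simp add: poly_space_iff)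
    from choice[OF this] obtain d where d: "\<And>i. Q i = (\<lambda>x. \<Sum>\<beta>\<in>index_set l. d i \<beta> * monomial \<beta> x)" by blast
    have Q: "Q = lc (\<lambda>(i, \<beta>). d i \<beta>)" by (intro ext) (simp add: lc_eq d)
    have "projection_form (poly_grad (lc c)) (lc c) Q = (\<Sum>\<kappa>\<in>A. (case \<kappa> of (i, \<beta>) \<Rightarrow> d i \<beta>) * projection_form (poly_grad (lc c)) (lc c) (b \<kappa>))"
      unfolding Q by (rule lin1[symmetric, OF si[OF lc]])
    also have "\<dots> = (\<Sum>\<kappa>\<in>A. (case \<kappa> of (i, \<beta>) \<Rightarrow> d i \<beta>) * projection_form G u (b \<kappa>))"
      by (intro sum.cong refl) (simp only: lin2[symmetric] c)
    also have "\<dots> = projection_form G u Q" unfolding Q by (rule lin1[OF G])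
    finally show "projection_form (poly_grad (lc c)) (lc c) Q = projection_form G u Q" .
  qed
  then show ?thesis by blast
qed

text \<open>In this form the invariance of polynomials enters the estimate: P - Q is a projection of
  the data minus Q, so the stability bound applies to the difference directly.\<close>

lemma is_strain_projection_diff:
  assumes P: "is_strain_projection l P u G" and Q: "\<And>i. Q i \<in> poly_space l"
    and u: "\<And>i. square_integrable T (u i)" and G: "\<And>i j. square_integrable T (G i j)"
  shows "is_strain_projection l (\<lambda>i x. P i x - Q i x) (\<lambda>i x. u i x - Q i x) (\<lambda>i j x. G i j x - poly_grad Q i j x)"
proof -
  have Pl: "\<And>i. P i \<in> poly_space l" using P by (simp add: is_strain_projection_def)
  note J = si_poly[OF poly_grad_in_poly_space[of P, OF Pl]] si_poly[OF poly_grad_in_poly_space[of Q, OF Q]]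
  have "skew_part (\<lambda>i j x. H i j x - H' i j x) i j = (\<lambda>x. skew_part H i j x - skew_part H' i j x)" for H H' :: "'d \<Rightarrow> 'd \<Rightarrow> real^'d \<Rightarrow> real" and i j
    using skew_part_diff by blast
  moreover have "strain_form (\<lambda>i j x. H i j x - poly_grad Q i j x) (poly_grad F) = strain_form H (poly_grad F) - strain_form (poly_grad Q) (poly_grad F)"
    if "\<And>i j. square_integrable T (H i j)" "\<forall>i. F i \<in> poly_space l" for H F
    by (rule strain_form_diff[OF that(1) J(2)]) (rule si_poly[OF poly_grad_in_poly_space[of F l]], use that(2) in blast)
  ultimately show ?thesis
    using P unfolding is_strain_projection_def poly_grad_diff[OF Pl Q]
    by (auto simp: poly_space_diff Q J G mean_diff si_poly[OF Pl] si_poly[OF Q] u si_skew_part)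
qed

lemma strain_projection_unique:
  assumes P: "is_strain_projection l P u G" and P': "is_strain_projection l P' u G"
    and inv: "\<And>q j. q \<in> poly_space l \<Longrightarrow> sq_norm T (partial_deriv j q) \<le> K / h\<^sup>2 * sq_norm T q" and K: "K \<ge> 0"
  shows "P = P'"
proof -
  have Pl: "\<And>i. P i \<in> poly_space l" "\<And>i. P' i \<in> poly_space l" using P P' by (simp_all add: is_strain_projection_def)
  define R where "R = (\<lambda>i x. P i x - P' i x)"
  have R: "R i \<in> poly_space l" for i unfolding R_def by (rule poly_space_diff[OF Pl])
  note J = si_poly[OF poly_grad_in_poly_space[of P, OF Pl(1)]] si_poly[OF poly_grad_in_poly_space[of P', OF Pl(2)]]
  have JR: "poly_grad R = (\<lambda>i j x. poly_grad P i j x - poly_grad P' i j x)"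
    unfolding R_def by (rule poly_grad_diff[OF Pl])
  have "R i = (\<lambda>_. 0)" for i
  proof (rule strain_kernel[OF R inv K])
    have "strain_form (poly_grad R) (poly_grad R) = strain_form (poly_grad P) (poly_grad R) - strain_form (poly_grad P') (poly_grad R)"
      by (subst JR, rule strain_form_diff[OF J]) (rule si_poly[OF poly_grad_in_poly_space[of R, OF R]])
    then show "strain_form (poly_grad R) (poly_grad R) = 0"
      using P P' R by (simp add: is_strain_projection_def)
    show "mean (R i) = 0" for i
      unfolding R_def using P P' by (simp add: mean_diff si_poly[OF Pl(1)] si_poly[OF Pl(2)] is_strain_projection_def)
    show "mean (skew_part (poly_grad R) i j) = 0" for i j
    proof -
      have "skew_part (poly_grad R) i j = (\<lambda>x. skew_part (poly_grad P) i j x - skew_part (poly_grad P') i j x)"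
        unfolding JR using skew_part_diff by blast
      then show ?thesis using P P' by (simp add: mean_diff si_skew_part J is_strain_projection_def)
    qed
  qed
  then show ?thesis by (simp add: R_def fun_eq_iff)
qed

end

section \<open>The projector of the statement as a projection of weak gradients\<close>

context star_domain
begin

definition weak_gradient :: "(real^'d \<Rightarrow> real^'d) \<Rightarrow> 'd \<Rightarrow> 'd \<Rightarrow> real^'d \<Rightarrow> real" where
  "weak_gradient v i j = weak_deriv T (unit_index j) (\<lambda>x. v x $ i)"

lemma sym_grad_nth: "sym_grad T v x $ i $ j = sym_part (weak_gradient v) i j x"
  by (simp add: sym_grad_def grad_def sym_part_def transpose_def weak_gradient_def add_divide_distrib)

lemma skew_grad_nth: "skew_grad T v x $ i $ j = skew_part (weak_gradient v) i j x"
  by (simp add: skew_grad_def grad_def skew_part_def transpose_def weak_gradient_def diff_divide_distrib)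

lemma si_weak_gradient:
  assumes "v \<in> sobolev_vec s T" "s \<ge> 1" shows "square_integrable T (weak_gradient v i j)"
  unfolding weak_gradient_def
  by (rule sobolev_weak_deriv(2)[of _ s]) (use assms in \<open>auto simp: sobolev_vec_def\<close>)

lemma weak_gradient_poly_AE:
  assumes "p \<in> poly_space_vec l"
  shows "AE x in lebesgue_on T. weak_gradient p i j x = poly_grad (\<lambda>i x. p x $ i) i j x"
proof -
  have p: "(\<lambda>x. p x $ i) \<in> poly_space l" using assms by (simp add: poly_space_vec_def)
  show ?thesis unfolding weak_gradient_def poly_grad_def partial_deriv_eq_poly_deriv[OF p]
    by (rule weak_deriv_AE[OF has_weak_deriv_poly[OF p]])
qed

lemma si_poly_grad: "p \<in> poly_space_vec l \<Longrightarrow> square_integrable T (poly_grad (\<lambda>i x. p x $ i) i j)"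
  by (rule si_poly[OF poly_grad_in_poly_space[of _ l]]) (simp add: poly_space_vec_def)

lemma si_weak_gradient_poly:
  assumes "p \<in> poly_space_vec l" shows "square_integrable T (weak_gradient p i j)"
proof -
  have "AE x in lebesgue_on T. poly_grad (\<lambda>i x. p x $ i) i j x = weak_gradient p i j x"
    using weak_gradient_poly_AE[OF assms, of i j] by eventually_elim simp
  then show ?thesis by (rule si_cong_AE[OF si_poly_grad[OF assms]])
qed

lemma L2_inner_sym_grad:
  assumes "\<And>i j. square_integrable T (weak_gradient v i j)" "\<And>i j. square_integrable T (weak_gradient w i j)"
  shows "L2_inner T (sym_grad T v) (sym_grad T w) = strain_form (weak_gradient v) (weak_gradient w)"
proof -
  have int: "integrable (lebesgue_on T) (\<lambda>x. sym_part (weak_gradient v) i j x * sym_part (weak_gradient w) i j x)" for i j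
    by (intro si_mult si_sym_part assms)
  have "L2_inner T (sym_grad T v) (sym_grad T w) =
    (\<integral>x. (\<Sum>i\<in>UNIV. \<Sum>j\<in>UNIV. sym_part (weak_gradient v) i j x * sym_part (weak_gradient w) i j x) \<partial>lebesgue_on T)"
    by (simp add: L2_inner_def set_integral_eq_lebesgue_on inner_vec_def sym_grad_nth)
  also have "\<dots> = strain_form (weak_gradient v) (weak_gradient w)"
    unfolding strain_form_def using int by simp
  finally show ?thesis .
qed

lemma integral_eq_iff_mean: "(\<integral>x. f x \<partial>lebesgue_on T) = (\<integral>x. g x \<partial>lebesgue_on T) \<longleftrightarrow> mean f = mean g"
  using measure_T_pos by (simp add: mean_def)

text \<open>On polynomials the chosen weak derivatives agree almost everywhere with the classical
  ones, so every integral may be evaluated with \<open>poly_grad\<close>. The vector and matrix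
  identities are compared entry by entry, all entries being integrable.\<close>

lemma strain_projection_iff:
  assumes v: "v \<in> sobolev_vec s T" and s: "s \<ge> 1"
  shows "(p \<in> poly_space_vec l \<and>
     (\<forall>w\<in>poly_space_vec l. L2_inner T (sym_grad T p) (sym_grad T w) = L2_inner T (sym_grad T v) (sym_grad T w)) \<and>
     (LINT x:T|lebesgue. p x) = (LINT x:T|lebesgue. v x) \<and>
     (LINT x:T|lebesgue. skew_grad T p x) = (LINT x:T|lebesgue. skew_grad T v x)) \<longleftrightarrow>
    is_strain_projection l (\<lambda>i x. p x $ i) (\<lambda>i x. v x $ i) (weak_gradient v)"
proof (cases "p \<in> poly_space_vec l")
  case p: True
  note G = si_weak_gradient[OF v s]
  have pl: "(\<lambda>x. p x $ i) \<in> poly_space l" for i using p by (simp add: poly_space_vec_def)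
  have vi: "square_integrable T (\<lambda>x. v x $ i)" for i using v by (simp add: sobolev_vec_def sobolev_def)
  have form: "L2_inner T (sym_grad T p) (sym_grad T w) = strain_form (poly_grad (\<lambda>i x. p x $ i)) (poly_grad (\<lambda>i x. w x $ i))"
    "L2_inner T (sym_grad T v) (sym_grad T w) = strain_form (weak_gradient v) (poly_grad (\<lambda>i x. w x $ i))"
    if w: "w \<in> poly_space_vec l" for w
    unfolding L2_inner_sym_grad[OF si_weak_gradient_poly[OF p] si_weak_gradient_poly[OF w]]
      L2_inner_sym_grad[OF G si_weak_gradient_poly[OF w]]
    by (rule strain_form_cong_AE; (rule G si_weak_gradient_poly[OF p] si_weak_gradient_poly[OF w]
      weak_gradient_poly_AE[OF p] weak_gradient_poly_AE[OF w] | simp))+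
  have 1: "(\<forall>w\<in>poly_space_vec l. L2_inner T (sym_grad T p) (sym_grad T w) = L2_inner T (sym_grad T v) (sym_grad T w)) \<longleftrightarrow>
    (\<forall>Q. (\<forall>i. Q i \<in> poly_space l) \<longrightarrow> strain_form (poly_grad (\<lambda>i x. p x $ i)) (poly_grad Q) = strain_form (weak_gradient v) (poly_grad Q))"
    (is "?L \<longleftrightarrow> ?R")
  proof
    assume L: ?L
    show ?R
    proof (intro allI impI)
      fix Q :: "'d \<Rightarrow> real^'d \<Rightarrow> real" assume Q: "\<forall>i. Q i \<in> poly_space l"
      have w: "(\<lambda>x. \<chi> i. Q i x) \<in> poly_space_vec l" using Q by (simp add: poly_space_vec_def)
      show "strain_form (poly_grad (\<lambda>i x. p x $ i)) (poly_grad Q) = strain_form (weak_gradient v) (poly_grad Q)"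
        using L w form[OF w] by simp
    qed
  next
    assume ?R
    then show ?L by (simp add: form) (simp add: poly_space_vec_def)
  qed
  have 2: "(LINT x:T|lebesgue. p x) = (LINT x:T|lebesgue. v x) \<longleftrightarrow> (\<forall>i. mean (\<lambda>x. p x $ i) = mean (\<lambda>x. v x $ i))"
    by (simp add: set_integral_eq_lebesgue_on vec_eq_iff integral_real_vec_nth si_integrable si_poly[OF pl] vi integral_eq_iff_mean)
  have sk: "mean (skew_part (weak_gradient p) i j) = mean (skew_part (poly_grad (\<lambda>i x. p x $ i)) i j)" for i j
  proof (rule mean_cong_AE[OF si_skew_part[OF si_weak_gradient_poly[OF p]]])
    show "AE x in lebesgue_on T. skew_part (weak_gradient p) i j x = skew_part (poly_grad (\<lambda>i x. p x $ i)) i j x"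
      using weak_gradient_poly_AE[OF p, of i j] weak_gradient_poly_AE[OF p, of j i]
      by eventually_elim (simp add: skew_part_def)
  qed
  have ski: "integrable (lebesgue_on T) (skew_part (weak_gradient p) i j)" "integrable (lebesgue_on T) (skew_part (weak_gradient v) i j)" for i j
    by (intro si_integrable si_skew_part G si_weak_gradient_poly[OF p])+
  have 3: "(LINT x:T|lebesgue. skew_grad T p x) = (LINT x:T|lebesgue. skew_grad T v x) \<longleftrightarrow>
    (\<forall>i j. mean (skew_part (poly_grad (\<lambda>i x. p x $ i)) i j) = mean (skew_part (weak_gradient v) i j))"
    unfolding sk[symmetric]
    by (simp add: set_integral_eq_lebesgue_on vec_eq_iff integral_real_matrix_nth skew_grad_nth ski integral_eq_iff_mean)
  show ?thesis unfolding 1 2 3 is_strain_projection_def using p pl by simp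
qed (auto simp: is_strain_projection_def poly_space_vec_def)

text \<open>Existence and uniqueness resolve the definite description. Uniqueness holds on the whole
  space and not only on T, since a polynomial is determined by its values on T.\<close>

lemma strain_projector_is_strain_projection:
  assumes v: "v \<in> sobolev_vec s T" and s: "s \<ge> 1" and l: "l \<ge> 1"
    and inv: "\<And>q j. q \<in> poly_space l \<Longrightarrow> sq_norm T (partial_deriv j q) \<le> K / h\<^sup>2 * sq_norm T q" and K: "K \<ge> 0"
  shows "is_strain_projection l (\<lambda>i x. strain_projector l T v x $ i) (\<lambda>i x. v x $ i) (weak_gradient v)"
proof -
  obtain P where P: "is_strain_projection l P (\<lambda>i x. v x $ i) (weak_gradient v)"
    using strain_projection_exists[of l "weak_gradient v" K, OF l si_weak_gradient[OF v s] inv K] by blast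
  show ?thesis
    unfolding strain_projector_def strain_projection_iff[OF v s]
  proof (rule theI[where a = "\<lambda>x. \<chi> i. P i x"])
    show "is_strain_projection l (\<lambda>i x. (\<chi> i. P i x) $ i) (\<lambda>i x. v x $ i) (weak_gradient v)" using P by simp
    fix p assume "is_strain_projection l (\<lambda>i x. p x $ i) (\<lambda>i x. v x $ i) (weak_gradient v)"
    from strain_projection_unique[OF this P inv K] show "p = (\<lambda>x. \<chi> i. P i x)"
      by (auto simp: fun_eq_iff vec_eq_iff)
  qed
qed

section \<open>Assembly of the estimate\<close>

lemma sobolev_seminorm_eq: "sobolev_seminorm m T v = sqrt (\<Sum>i\<in>UNIV. level_norm m (\<lambda>x. v x $ i))"
  by (simp add: sobolev_seminorm_def level_norm_def sq_norm_def set_integral_eq_lebesgue_on)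

text \<open>Bookkeeping of powers of h, kept apart from the analysis. \<open>X m\<close> stands for
  the squared seminorms of the remainder v - q and \<open>Y m\<close> for those of its projection.
  Stability gives \<open>Y 1\<close>; from there the inverse inequality climbs to higher orders, and
  the Poincare inequality descends to \<open>Y 0\<close>.\<close>

lemma scaled_bounds:
  fixes X Y :: "nat \<Rightarrow> real"
  assumes s: "s \<ge> 1" and m: "m \<le> s" and S: "S \<ge> 0" and c: "0 \<le> c" "0 \<le> k" "0 \<le> C1"
    and X: "\<And>m. m \<le> s \<Longrightarrow> X m \<le> (c * h\<^sup>2) ^ (s - m) * S"
    and Y1: "Y 1 \<le> C1 * X 1" and Y0: "Y 0 \<le> 2 * c * h\<^sup>2 * Y 1 + 2 * X 0"
    and Ys: "\<And>m. Y (Suc m) \<le> k / h\<^sup>2 * Y m"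
  shows "2 * X m + 2 * Y m \<le>
    (2 * (1 + c) ^ s + 2 * ((1 + k) ^ s * C1 * (1 + c) ^ s + 2 * (1 + c) * (C1 * (1 + c) ^ s) + 2 * (1 + c) ^ s)) * ((h ^ (s - m))\<^sup>2 * S)"
proof -
  \<comment> \<open>With 1 + c in place of c, the single exponent s dominates c ^ (s - m) for all m,
    whether c is below or above 1.\<close>
  define A where "A = (1 + c) ^ s"
  have A: "A \<ge> 1" using c by (simp add: A_def one_le_power)
  define H where "H = (\<lambda>m. (h ^ (s - m))\<^sup>2 * S)"
  have H: "H m \<ge> 0" for m using S by (simp add: H_def)
  \<comment> \<open>Consecutive orders differ by the square of h, exactly the factor that
    \<open>Ys\<close> takes away.\<close>
  have HS: "H m = h\<^sup>2 * H (Suc m)" if "Suc m \<le> s" for m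
  proof -
    have "s - m = Suc (s - Suc m)" using that by simp
    then show ?thesis by (simp add: H_def power2_eq_square)
  qed
  have XA: "X m \<le> A * H m" if "m \<le> s" for m
  proof -
    have "X m \<le> c ^ (s - m) * H m" using X[OF that] by (simp add: H_def power_mult_distrib power_mult[symmetric] mult.commute mult.left_commute)
    also have "c ^ (s - m) \<le> (1 + c) ^ (s - m)" using c by (intro power_mono) auto
    also have "(1 + c) ^ (s - m) \<le> A" unfolding A_def using c by (intro power_increasing) auto
    finally show ?thesis using H by (simp add: mult_right_mono)
  qed
  have Y1': "Y 1 \<le> C1 * A * H 1"
    using order_trans[OF Y1 mult_left_mono[OF XA[OF s] c(3)]] by (simp add: mult.assoc)
  have Ym: "Y m \<le> (1 + k) ^ m * C1 * A * H m" if "1 \<le> m" "m \<le> s" for m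
    using that
  proof (induction m rule: dec_induct)
    case base
    have "Y 1 \<le> 1 * (C1 * A * H 1)" using Y1' by simp
    also have "\<dots> \<le> (1 + k) ^ 1 * (C1 * A * H 1)"
      using c A H by (intro mult_right_mono mult_nonneg_nonneg) auto
    finally show ?case by (simp add: mult.assoc)
  next
    case (step n)
    have "Y (Suc n) \<le> k / h\<^sup>2 * ((1 + k) ^ n * C1 * A * H n)"
      using step c by (intro order_trans[OF Ys] mult_left_mono) auto
    also have "\<dots> = k * ((1 + k) ^ n * C1 * A * H (Suc n))"
      using h_pos step by (simp add: HS)
    also have "\<dots> \<le> (1 + k) * ((1 + k) ^ n * C1 * A * H (Suc n))"
      using c A H by (intro mult_right_mono mult_nonneg_nonneg) auto
    finally show ?case by (simp add: mult_ac)
  qed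
  \<comment> \<open>D1 serves the orders from 1 on and D2 serves order 0; both are nonnegative, so
    their sum serves all.\<close>
  define D1 D2 where "D1 = (1 + k) ^ s * C1 * A" and "D2 = 2 * (1 + c) * (C1 * A) + 2 * A"
  have D: "D1 \<ge> 0" "D2 \<ge> 0" unfolding D1_def D2_def using c A by auto
  have "Y m \<le> (D1 + D2) * H m"
  proof (cases "m = 0")
    case True
    have "Y 0 \<le> 2 * c * h\<^sup>2 * (C1 * A * H 1) + 2 * (A * H 0)"
      using Y0 mult_left_mono[OF Y1', of "2 * c * h\<^sup>2"] XA[of 0] c by simp
    also have "\<dots> = (2 * c * (C1 * A) + 2 * A) * H 0" using HS[of 0] s by (simp add: algebra_simps)
    also have "\<dots> \<le> (D1 + D2) * H 0"
    proof (intro mult_right_mono H)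
      have "2 * c * (C1 * A) \<le> 2 * (1 + c) * (C1 * A)" using c A by (intro mult_right_mono) auto
      then show "2 * c * (C1 * A) + 2 * A \<le> D1 + D2" using D(1) unfolding D2_def by linarith
    qed
    finally show ?thesis using True by simp
  next
    case False
    then have "Y m \<le> (1 + k) ^ m * C1 * A * H m" using Ym m by simp
    also have "\<dots> \<le> (1 + k) ^ s * C1 * A * H m"
      using c A m H by (intro mult_right_mono power_increasing) auto
    also have "\<dots> \<le> (D1 + D2) * H m"
      using D H by (intro mult_right_mono) (auto simp: D1_def)
    finally show ?thesis .
  qed
  then have "2 * X m + 2 * Y m \<le> 2 * (A * H m) + 2 * ((D1 + D2) * H m)"
    using XA[OF m] by linarith
  also have "\<dots> = (2 * A + 2 * (D1 + D2)) * H m" by (simp add: algebra_simps)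
  finally show ?thesis unfolding D1_def D2_def A_def H_def by (simp only: add.assoc)
qed

text \<open>The error is W - R, where W is the remainder v - q and R a projection of W; R is
  controlled by W, and W by the polynomial approximation. The Poincare constant of T is replaced by
  an upper bound c, so that the final constant does not mention T.\<close>

theorem strain_projector_estimate:
  assumes v: "v \<in> sobolev_vec s T" and s: "1 \<le> s" "s \<le> l + 1" and l: "l \<ge> 1" and m: "m \<le> s"
    and inv: "\<And>q j. q \<in> poly_space l \<Longrightarrow> sq_norm T (partial_deriv j q) \<le> K / h\<^sup>2 * sq_norm T q" and K: "K \<ge> 0"
    and c: "poincare_const * real CARD('d) \<le> c" and k: "k = real CARD('d) * K"
    and C1: "C1 = (real CARD('d))\<^sup>2 * (2 + 16 * (c * K)) + 4"
  shows "sobolev_seminorm m T (\<lambda>x. v x - strain_projector l T v x) \<le>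
    sqrt (2 * (1 + c) ^ s + 2 * ((1 + k) ^ s * C1 * (1 + c) ^ s + 2 * (1 + c) * (C1 * (1 + c) ^ s) + 2 * (1 + c) ^ s)) *
      h ^ (s - m) * sobolev_seminorm s T v" (is "_ \<le> sqrt ?C * _ * _")
proof -
  define P where "P = (\<lambda>i x. strain_projector l T v x $ i)"
  define u where "u = (\<lambda>i x. v x $ i)"
  have u: "u i \<in> sobolev s T" for i using v by (simp add: sobolev_vec_def u_def)
  have ui: "square_integrable T (u i)" for i using u by (simp add: sobolev_def)
  have proj: "is_strain_projection l P u (weak_gradient v)"
    unfolding P_def u_def by (rule strain_projector_is_strain_projection[OF v s(1) l inv K])
  have "\<forall>i. \<exists>q. q \<in> poly_space (s - 1) \<and> (\<lambda>x. u i x - q x) \<in> sobolev s T \<and>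
    (\<forall>m\<le>s. level_norm m (\<lambda>x. u i x - q x) \<le> (poincare_const * h\<^sup>2 * real CARD('d)) ^ (s - m) * level_norm s (u i))"
    using polynomial_approximation[OF u] by blast
  from choice[OF this] obtain q where q0: "\<And>i. q i \<in> poly_space (s - 1)" and w: "\<And>i. (\<lambda>x. u i x - q i x) \<in> sobolev s T"
    and app: "\<And>i m. m \<le> s \<Longrightarrow> level_norm m (\<lambda>x. u i x - q i x) \<le> (poincare_const * h\<^sup>2 * real CARD('d)) ^ (s - m) * level_norm s (u i)"
    by blast
  have q: "q i \<in> poly_space l" for i
  proof -
    have "s - 1 \<le> l" using s by simp
    from poly_space_mono[OF this] q0[of i] show ?thesis by blast
  qed
  define W R where "W = (\<lambda>i x. u i x - q i x)" and "R = (\<lambda>i x. P i x - q i x)"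
  define G where "G = (\<lambda>i j x. weak_gradient v i j x - poly_grad q i j x)"
  have G: "square_integrable T (G i j)" for i j
    unfolding G_def by (intro si_diff si_weak_gradient[OF v s(1)] si_poly[OF poly_grad_in_poly_space[of q, OF q]])
  have projR: "is_strain_projection l R W G"
    unfolding R_def W_def G_def by (rule is_strain_projection_diff[OF proj q ui si_weak_gradient[OF v s(1)]])
  have R: "R i \<in> poly_space l" for i using projR by (simp add: is_strain_projection_def)
  have Ws: "W i \<in> sobolev s T" for i using w by (simp add: W_def)
  have Wi: "square_integrable T (W i)" for i using Ws by (simp add: sobolev_def)
  define X Y S where "X = (\<lambda>m. \<Sum>i\<in>UNIV. level_norm m (W i))" and "Y = (\<lambda>m. \<Sum>i\<in>UNIV. level_norm m (R i))"
    and "S = (\<Sum>i\<in>UNIV. level_norm s (u i))"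
  have c0: "c \<ge> 0" using c mult_nonneg_nonneg[OF poincare_const_nonneg, of "real CARD('d)"] by simp
  have S0: "S \<ge> 0" unfolding S_def by (intro sum_nonneg level_norm_nonneg)
  have X0: "X m \<ge> 0" "Y m \<ge> 0" for m unfolding X_def Y_def by (intro sum_nonneg level_norm_nonneg)+
  have X: "X m \<le> (c * h\<^sup>2) ^ (s - m) * S" if "m \<le> s" for m
  proof -
    have "X m \<le> (poincare_const * h\<^sup>2 * real CARD('d)) ^ (s - m) * S"
      unfolding X_def S_def sum_distrib_left W_def by (intro sum_mono app that)
    also have "\<dots> \<le> (c * h\<^sup>2) ^ (s - m) * S"
      using c poincare_const_nonneg mult_right_mono[OF c, of "h\<^sup>2"]
      by (intro mult_right_mono power_mono S0) (auto simp: mult_ac)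
    finally show ?thesis .
  qed
  \<comment> \<open>G is the weak gradient of the remainder W, so its entries have the norms of the
    first-order derivatives of W.\<close>
  have GX: "(\<Sum>i\<in>UNIV. \<Sum>j\<in>UNIV. sq_norm T (G i j)) = X 1"
    unfolding X_def level_norm_1
  proof (intro sum.cong refl)
    fix i j
    have "has_weak_deriv T (unit_index j) (W i) (G i j)"
      unfolding W_def G_def weak_gradient_def poly_grad_def partial_deriv_eq_poly_deriv[OF q] u_def[symmetric]
      using sobolev_weak_deriv(1)[OF u, of "unit_index j" i] s
      by (intro has_weak_deriv_diff has_weak_deriv_poly[OF q]) (auto simp: u_def)
    from sq_norm_weak_deriv[OF this G] show "sq_norm T (G i j) = sq_norm T (weak_deriv T (unit_index j) (W i))" by simp
  qed
  have RY: "(\<Sum>i\<in>UNIV. \<Sum>j\<in>UNIV. sq_norm T (poly_grad R i j)) = Y 1"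
    unfolding Y_def poly_grad_def using level_norm_1_poly[OF R] by simp
  note stable = strain_projection_stable[OF projR Wi G inv K]
  have Y1: "Y 1 \<le> C1 * X 1"
  proof -
    have "Y 1 \<le> ((real CARD('d))\<^sup>2 * (2 + 16 * (poincare_const * K * real CARD('d))) + 4) * X 1"
      using stable(1) by (simp only: GX RY)
    also have "\<dots> \<le> C1 * X 1"
      unfolding C1 using mult_right_mono[OF c K]
      by (intro mult_right_mono add_mono mult_left_mono X0) (auto simp: mult_ac)
    finally show ?thesis .
  qed
  have Y0: "Y 0 \<le> 2 * c * h\<^sup>2 * Y 1 + 2 * X 0"
  proof -
    have "Y 0 \<le> 2 * poincare_const * h\<^sup>2 * Y 1 + 2 * X 0"
      using stable(2) by (simp add: RY) (simp add: Y_def X_def level_norm_0 Wi si_poly[OF R])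
    \<comment> \<open>The dimension is at least 1, so c bounds the Poincare constant itself and not
      only its multiple.\<close>
    also have "poincare_const \<le> c"
      using c mult_left_mono[OF _ poincare_const_nonneg, of 1 "real CARD('d)"] by (simp add: Suc_le_eq)
    finally show ?thesis using X0 by (simp add: mult_right_mono)
  qed
  have Ys: "Y (Suc m) \<le> k / h\<^sup>2 * Y m" for m
    unfolding Y_def sum_distrib_left k by (intro sum_mono level_norm_Suc_poly_le[OF R inv])
  have "(\<Sum>i\<in>UNIV. level_norm m (\<lambda>x. (v x - strain_projector l T v x) $ i)) \<le> 2 * X m + 2 * Y m"
    unfolding X_def Y_def sum_distrib_left sum.distrib[symmetric]
  proof (intro sum_mono)
    fix i
    have "(\<lambda>x. (v x - strain_projector l T v x) $ i) = (\<lambda>x. W i x - R i x)"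
      by (simp add: W_def R_def u_def P_def)
    then show "level_norm m (\<lambda>x. (v x - strain_projector l T v x) $ i) \<le> 2 * level_norm m (W i) + 2 * level_norm m (R i)"
      using level_norm_diff_le[OF Ws R m] by simp
  qed
  also have "\<dots> \<le> ?C * ((h ^ (s - m))\<^sup>2 * S)"
    by (rule scaled_bounds[OF s(1) m S0 c0 _ _ X Y1 Y0 Ys]) (use K c0 in \<open>auto simp: k C1\<close>)
  finally have "sobolev_seminorm m T (\<lambda>x. v x - strain_projector l T v x) \<le> sqrt (?C * ((h ^ (s - m))\<^sup>2 * S))"
    unfolding sobolev_seminorm_eq by (rule real_sqrt_le_mono)
  also have "\<dots> = sqrt ?C * h ^ (s - m) * sqrt S"
    using h_pos by (simp add: real_sqrt_mult)
  also have "sqrt S = sobolev_seminorm s T v" by (simp add: sobolev_seminorm_eq S_def u_def)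
  finally show ?thesis .
qed

end

lemma star_domain_of_polytopal:
  fixes T :: "(real^'d::finite) set"
  assumes T: "polytopal T" and \<rho>: "\<rho> > 0" and star: "\<forall>y\<in>ball a (\<rho> * diameter T). star_shaped_wrt T y"
  shows "star_domain T a (\<rho> * diameter T) (diameter T)"
proof
  show o: "open T" and b: "bounded T" using T by (simp_all add: polytopal_def)
  obtain x e where x: "x \<in> T" "e > 0" "ball x e \<subseteq> T" using T by (metis polytopal_def ex_in_conv openE)
  \<comment> \<open>A second point of T at distance e / 2 from x; it shows that the diameter is
    positive.\<close>
  define y where "y = x + (e / 2) *\<^sub>R axis (undefined :: 'd) 1"
  have d: "dist x y = e / 2" using x by (simp add: y_def dist_norm)
  then have "y \<in> T" using x by auto
  from diameter_bounded_bound[OF b x(1) this] show h: "diameter T > 0" using d x by simp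
  show "\<rho> * diameter T > 0" using h \<rho> by simp
  show "ball a (\<rho> * diameter T) \<subseteq> T" using star by (auto simp: star_shaped_wrt_def)
  show "closed_segment x y \<subseteq> T" if "x \<in> T" "y \<in> ball a (\<rho> * diameter T)" for x y
    using star that by (auto simp: star_shaped_wrt_def)
  show "norm (y - x) \<le> diameter T" if "x \<in> T" "y \<in> T" for x y
    using diameter_bounded_bound[OF b that] by (simp add: dist_norm norm_minus_commute)
qed

theorem theorem24:
  fixes \<rho> :: real and l s :: nat
  assumes "CARD('d::finite) \<in> {2, 3}"
    and "\<rho> > 0"
    and "l \<ge> 1"
    and "s \<in> {1..l + 1}"
  shows "\<exists>C::real. C > 0 \<and>
    (\<forall>T :: (real ^ 'd) set. polytopal T \<longrightarrow>
      (\<exists>a. \<forall>y\<in>ball a (\<rho> * diameter T). star_shaped_wrt T y) \<longrightarrow>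
      (\<forall>m\<in>{0..s}. \<forall>v\<in>sobolev_vec s T.
        sobolev_seminorm m T (\<lambda>x. v x - strain_projector l T v x)
          \<le> C * diameter T ^ (s - m) * sobolev_seminorm s T v))"
proof -
  note \<rho> = assms(2)
  obtain K where K: "K \<ge> 0" and inv: "\<And>(T :: (real^'d) set) a h p j. star_domain T a (\<rho> * h) h \<Longrightarrow> p \<in> poly_space l \<Longrightarrow>
      sq_norm T (partial_deriv j p) \<le> K / h\<^sup>2 * sq_norm T p"
    using inverse_inequality[OF \<rho>, of l] by blast
  \<comment> \<open>The bound of \<open>poincare_const_le\<close> times the dimension. It depends on
    d and \<rho> only, and K on d, \<rho> and l, so one choice serves every T.\<close>
  define c where "c = 2 ^ CARD('d) * (1 + 1 / \<rho> ^ CARD('d)) * real CARD('d)"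
  define k where "k = real CARD('d) * K"
  define C1 where "C1 = (real CARD('d))\<^sup>2 * (2 + 16 * (c * K)) + 4"
  \<comment> \<open>The constant for squared seminorms; its square root is the witness. The first
    summand makes it positive, the others are nonnegative.\<close>
  define C where "C = 2 * (1 + c) ^ s + 2 * ((1 + k) ^ s * C1 * (1 + c) ^ s + 2 * (1 + c) * (C1 * (1 + c) ^ s) + 2 * (1 + c) ^ s)"
  have c: "c \<ge> 0" using \<rho> by (simp add: c_def)
  then have "C1 \<ge> 0" "k \<ge> 0" using K by (simp_all add: C1_def k_def)
  then have "C > 0" unfolding C_def using c by (intro add_pos_nonneg) auto
  moreover have "sobolev_seminorm m T (\<lambda>x. v x - strain_projector l T v x)
      \<le> sqrt C * diameter T ^ (s - m) * sobolev_seminorm s T v"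
    if T: "polytopal T" and a: "\<forall>y\<in>ball a (\<rho> * diameter T). star_shaped_wrt T y"
      and m: "m \<in> {0..s}" and v: "v \<in> sobolev_vec s T"
    for T :: "(real ^ 'd) set" and a m v
  proof -
    have sd: "star_domain T a (\<rho> * diameter T) (diameter T)"
      by (rule star_domain_of_polytopal[OF T \<rho> a])
    have "star_domain.poincare_const T a (\<rho> * diameter T) * real CARD('d) \<le> c"
      unfolding c_def by (intro mult_right_mono poincare_const_le[OF sd \<rho>]) simp
    then show ?thesis unfolding C_def
      by (intro star_domain.strain_projector_estimate[OF sd v _ _ _ _ inv[OF sd] K _ k_def C1_def])
        (use assms(3,4) m in auto)
  qed
  ultimately show ?thesis by (intro exI[of _ "sqrt C"]) (auto simp del: real_sqrt_mult)
qed

end
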